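(* For $a>1$ let $0<c_{1}<c_{2}<c_{3}<\cdots$ denote the positive zeros $\theta=c_m=c_m(a)$ of $\theta\mapsto\mathrm{Ci}(a,a\theta)$, and for $m=1,2,3,\ldots$ let $c_{m,0}=c_{m,0}(a)$ be the positive root of $$a c_{m,0}-\arctan(c_{m,0})=\left(m-\tfrac12\right)\pi .$$ Then $$c_{m}\sim c_{m,0}+\sum_{k=2}^{\infty}\frac{q_{k}(c_{m,0})}{a^{k}}\qquad(a\to+\infty)$$ uniformly for $m=1,2,3,\ldots$; that is, for every integer $N\ge1$, $c_m-c_{m,0}-\sum_{k=2}^{N}q_k(c_{m,0})a^{-k}=\mathcal{O}(a^{-N-1})$ as $a\to+\infty$, uniformly in $m\ge1$. Here the $q_k(x)$ are the rational functions defined in the context; they vanish at $x=0$ and $x=\infty$, and the first four are $$q_{2}(x)=\frac{x(x^2-1)}{(x^2+1)^2},\qquad q_{3}(x)=\frac{4x^3(2x^2-3)}{(x^2+1)^4},$$ $$q_{4}(x)=-\frac{2x^3(8x^6-183x^4+336x^2-65)}{3(x^2+1)^6},$$ $$q_{5}(x)=-\frac{x^3(679x^8-8384x^6+17226x^4-7168x^2+431)}{3(x^2+1)^8}.$$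
   Context: $\mathrm{Ci}(a,z)=\int_0^z t^{a-1}\cos t\,dt$ for $a>0$. Coefficients: $F^{-}_{0}(z)=-\dfrac{z}{(z-1)^{2}}$, $F^{-}_{1}(z)=-\dfrac{2z(z+1)}{(z-1)^{4}}$, and for $s=1,2,3,\ldots$ $$F^{-}_{s+1}(z)=\frac{z}{1-z}\frac{dF^{-}_{s}(z)}{dz}-\frac12\sum_{j=0}^{s}F^{-}_{j}(z)F^{-}_{s-j}(z).$$ For $s\ge1$, $E^{-}_{s}$ is the rational function with $E^{-}_{s}(0)=0$ given by $E^{-}_{s}(z)=\int_{0}^{z}\frac{(t-1)F^{-}_{s}(t)}{2t}\,dt$ (e.g. $E^{-}_{1}(z)=\frac{z}{(z-1)^{2}}$, $E^{-}_{2}(z)=\frac{z(3z+2)}{2(z-1)^{4}}$). For real $\theta$ put $L_{s}(\theta)=(-1)^{s}\Im\{E^{-}_{s}(-i\theta)\}$, a real rational function of $\theta$. The functions $q_k(x)$ ($k=2,3,4,\ldots$) are the unique functions such that, as an identity of formal power series in $1/a$, the substitution $\theta=x+\sum_{k\ge2}q_k(x)a^{-k}$ gives $$a\theta-\arctan(\theta)+\sum_{s=1}^{\infty}\frac{L_s(\theta)}{a^{s}}=ax-\arctan(x)$$ (expand in inverse powers of $a$ and equate like powers, which determines $q_2,q_3,\ldots$ successively). *)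

theory Defs
  imports "HOL-Complex_Analysis.Complex_Analysis"
begin

definition Ci :: "real \<Rightarrow> real \<Rightarrow> real" where
  "Ci a z = integral {0..z} (\<lambda>t. t powr (a - 1) * cos t)"

text \<open>
  The m-th positive zero (m = 1, 2, ...) of \<open>\<theta> \<mapsto> Ci a (a * \<theta>)\<close> in increasing order:
  the one that has exactly m positive zeros at or below it.
\<close>

definition ci_zero :: "real \<Rightarrow> nat \<Rightarrow> real" where
  "ci_zero a m = (THE \<theta>. 0 < \<theta> \<and> Ci a (a * \<theta>) = 0 \<and>
     card {t. 0 < t \<and> t \<le> \<theta> \<and> Ci a (a * t) = 0} = m)"

definition ci_zero0 :: "real \<Rightarrow> nat \<Rightarrow> real" where
  "ci_zero0 a m = (THE \<theta>. 0 < \<theta> \<and> a * \<theta> - arctan \<theta> = (real m - 1/2) * pi)"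

text \<open>
  The rational functions \<open>F\<^sup>-\<^sub>s\<close> as functions on the complex plane. At the pole z = 1 the
  value is meaningless (division by zero), and it is never used.
\<close>

fun Fm :: "nat \<Rightarrow> complex \<Rightarrow> complex" where
  "Fm 0 = (\<lambda>z. - (z / (z - 1)^2))"
| "Fm (Suc 0) = (\<lambda>z. - (2 * z * (z + 1) / (z - 1)^4))"
| "Fm (Suc (Suc s)) = (\<lambda>z. z / (1 - z) * deriv (Fm (Suc s)) z
     - 1/2 * (\<Sum>j\<le>Suc s. Fm j z * Fm (Suc s - j) z))"

text \<open>
  The integral is taken along the straight segment from 0 to z, which avoids the pole 1 for
  the purely imaginary z used below. The singularity of the integrand at t = 0 is removable.
\<close>

definition Em :: "nat \<Rightarrow> complex \<Rightarrow> complex" where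
  "Em s z = contour_integral (linepath 0 z) (\<lambda>t. (t - 1) * Fm s t / (2 * t))"

definition L :: "nat \<Rightarrow> real \<Rightarrow> real" where
  "L s \<theta> = (-1)^s * Im (Em s (- \<i> * of_real \<theta>))"

text \<open>
  Substitution of a formal power series \<open>\<Theta>\<close> into a smooth function f: the Taylor series of f
  at the constant term of \<open>\<Theta>\<close>, composed with the remaining part of \<open>\<Theta>\<close>.
\<close>

definition fps_subst :: "(real \<Rightarrow> real) \<Rightarrow> real fps \<Rightarrow> real fps" where
  "fps_subst f \<Theta> =
     fps_compose (Abs_fps (\<lambda>n. (deriv ^^ n) f (fps_nth \<Theta> 0) / fact n))
       (\<Theta> - fps_const (fps_nth \<Theta> 0))"

text \<open>The formal variable is 1/a, so that a itself is the formal Laurent series \<open>fls_X_inv\<close>.\<close>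

definition Theta :: "(nat \<Rightarrow> real \<Rightarrow> real) \<Rightarrow> real \<Rightarrow> real fps" where
  "Theta q x = fps_const x + Abs_fps (\<lambda>k. if k \<ge> 2 then q k x else 0)"

definition formal_identity :: "(nat \<Rightarrow> real \<Rightarrow> real) \<Rightarrow> real \<Rightarrow> bool" where
  "formal_identity q x \<longleftrightarrow>
     fls_X_inv * fps_to_fls (Theta q x) - fps_to_fls (fps_subst arctan (Theta q x))
       + fps_to_fls (\<Sum>s. fps_X ^ Suc s * fps_subst (L (Suc s)) (Theta q x))
     = fls_X_inv * fls_const x - fls_const (arctan x)"

text \<open>
  The identity only involves \<open>q k\<close> for \<open>k \<ge> 2\<close>; the first two entries are normalised to 0
  to make the family unique.
\<close>

definition is_coeff_family :: "(nat \<Rightarrow> real \<Rightarrow> real) \<Rightarrow> bool" where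
  "is_coeff_family q \<longleftrightarrow> (\<forall>k<2. \<forall>x. q k x = 0) \<and> (\<forall>x. formal_identity q x)"

definition qf :: "nat \<Rightarrow> real \<Rightarrow> real" where
  "qf = (THE q. is_coeff_family q)"

end

theory Submission
  imports Defs
begin

text \<open>
  Why the expansion holds. Put \<open>t = 1 / (1 + \<i>\<theta>)\<close> and \<open>\<epsilon> = 1 / a\<close>. Up to the positive factor
  \<open>a powr (a - 1)\<close>, \<open>Ci a (a * \<theta>)\<close> is the real part of \<open>K(\<theta>) = a * \<integral>\<^sub>0\<^sup>\<theta> x powr (a - 1) * exp (\<i>ax) dx\<close>,
  and \<open>K\<close> has the form \<open>\<theta> powr a * exp (\<i>a\<theta>) * t * u\<close> with a slowly varying amplitude \<open>u\<close>. The
  differential equation for \<open>u\<close> has a unique formal solution \<open>u = \<Sum> u\<^sub>s \<epsilon>^s\<close>; in the variable \<open>t\<close> its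
  coefficients are polynomials, given by \<open>u\<^sub>0 = 1\<close> and \<open>u\<^sub>s\<^sub>+\<^sub>1 = (t - t\<^sup>2) (t u\<^sub>s)'\<close> (\<open>ampl\<close>). As \<open>t\<close> runs
  in the unit disc, every coefficient is bounded uniformly in \<open>\<theta>\<close>.

  The logarithm \<open>\<Sum> p\<^sub>s \<epsilon>^s\<close> of the series has polynomial coefficients too (\<open>logampl\<close>). Its \<open>t\<close>-derivative
  solves a Riccati equation (\<open>logampl_riccati\<close>), which is the recursion for the functions \<open>F\<close>
  in disguise; hence \<open>E\<^sub>s(z) = (-1)^s p\<^sub>s(1 / (1 - z))\<close> (\<open>Em_eq\<close>) and \<open>L\<^sub>s(\<theta>) = Im p\<^sub>s(t)\<close> (\<open>L_eq\<close>).
  Because each \<open>p\<^sub>s\<close> vanishes at \<open>t = 1\<close> and \<open>t = 0\<close>, \<open>L\<^sub>s\<close> vanishes at \<open>0\<close> and at infinity.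

  Error control. Truncating the amplitude after the power \<open>N\<close> leaves the residual \<open>- \<epsilon>^(N+1) u\<^sub>N\<^sub>+\<^sub>1(t)\<close>
  exactly (\<open>ampl_trunc_equation\<close>); integrating it shows that at a zero the approximate amplitude
  has real part \<open>O(\<epsilon>^(N+1))\<close> relative to its modulus, uniformly in \<open>\<theta> > 0\<close> (\<open>Re_amplitude_small\<close>).
  Replacing the truncated amplitude by the exponential of the truncated logarithm costs
  \<open>O(\<epsilon>^(N+1))\<close> again (\<open>ampl_poly_exp_logampl_poly\<close>). The argument of the approximation is the phase
  \<open>\<Phi>\<^sub>N(\<theta>) = a\<theta> - arctan \<theta> + \<Sum> L\<^sub>s(\<theta>) \<epsilon>^s\<close>, so \<open>cos \<Phi>\<^sub>N\<close> is small at every zero. Since the \<open>m\<close>-th zero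
  is caught between consecutive odd multiples of \<open>\<pi> / 2\<close>, this gives
  \<open>\<Phi>\<^sub>N(c\<^sub>m) = (m - 1/2) \<pi> + O(\<epsilon>^(N+1))\<close> (\<open>phase_at_zero\<close>).

  On the other side, the formal identity says that \<open>x + \<Sum> q\<^sub>k(x) \<epsilon>^k\<close> solves \<open>\<Phi>\<^sub>N = a x - arctan x\<close> up to
  \<open>O(\<epsilon>^N)\<close>. It amounts to an explicit recursion for the \<open>q\<^sub>k\<close> (\<open>formal_identity_iff\<close>), so they exist, are
  unique and lie in an algebra of bounded rational functions; Taylor expansion with remainders
  uniform in \<open>x\<close> turns the formal statement into an analytic one (\<open>formal_solution_phase\<close>). With
  \<open>x = c\<^sub>m\<^sub>,\<^sub>0\<close> the right-hand side is \<open>(m - 1/2) \<pi>\<close>, and as \<open>\<Phi>\<^sub>N\<close> stretches distances by at least \<open>a / 2\<close>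
  (\<open>Phi_expands\<close>) the two approximations differ by \<open>O(\<epsilon>^(N+1))\<close>.
\<close>

section \<open>The amplitude coefficients and their formal logarithm\<close>

definition tau :: "complex poly" where "tau = [:0, 1, -1:]"

text \<open>
  In the variable \<open>t = 1 / (1 - z)\<close> the amplitude equation \<open>z y' / a + (1 - z) y = 1\<close> for
  \<open>y = t (\<Sum> u\<^sub>s / a^s)\<close> becomes the recursion below.
\<close>

fun ampl :: "nat \<Rightarrow> complex poly" where
  "ampl 0 = 1"
| "ampl (Suc s) = tau * pderiv ([:0, 1:] * ampl s)"

text \<open>
  The coefficients of \<open>P = log (\<Sum> u\<^sub>s X^s)\<close>. The recursion is that of the logarithmic derivative
  \<open>n u\<^sub>n = \<Sum> k p\<^sub>k u\<^sub>n\<^sub>-\<^sub>k\<close>, which avoids division by a power series over a ring that is no field.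
\<close>

fun logampl :: "nat \<Rightarrow> complex poly" where
  "logampl n = (if n = 0 then 0 else
     ampl n - smult (1 / of_nat n) (\<Sum>k\<in>{1..<n}. smult (of_nat k) (logampl k * ampl (n - k))))"

declare logampl.simps [simp del]

lemma logampl_0 [simp]: "logampl 0 = 0"
  by (subst logampl.simps) simp

lemma ampl_log_recurrence:
  "smult (of_nat (Suc n)) (ampl (Suc n)) =
     (\<Sum>i\<le>n. smult (of_nat (Suc i)) (logampl (Suc i) * ampl (n - i)))"
proof -
  have "smult (of_nat (Suc n)) (logampl (Suc n)) = smult (of_nat (Suc n)) (ampl (Suc n))
      - (\<Sum>k\<in>{1..<Suc n}. smult (of_nat k) (logampl k * ampl (Suc n - k)))"
    by (subst logampl.simps) (simp add: smult_diff_right del: of_nat_Suc ampl.simps(2))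
  moreover have "(\<Sum>k\<in>{1..<Suc n}. smult (of_nat k) (logampl k * ampl (Suc n - k)))
      = (\<Sum>i<n. smult (of_nat (Suc i)) (logampl (Suc i) * ampl (n - i)))"
    by (rule sum.reindex_bij_witness[of _ Suc "\<lambda>k. k - 1"]) auto
  ultimately show ?thesis
    by (simp add: lessThan_Suc_atMost [symmetric] del: of_nat_Suc ampl.simps(2))
qed

lemma ampl_roots: "s > 0 \<Longrightarrow> poly (ampl s) 0 = 0 \<and> poly (ampl s) 1 = 0"
  by (cases s) (auto simp: tau_def)

text \<open>
  These two roots are what makes the functions \<open>L\<^sub>s\<close> harmless: \<open>t = 1\<close> is \<open>\<theta> = 0\<close>, and \<open>t = 0\<close> is
  \<open>\<theta> = \<infinity>\<close>. The root 0 cannot be seen from the antiderivative that defines \<open>E\<^sub>s\<close>; the logarithm shows it.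
\<close>

lemma logampl_roots: "poly (logampl s) 0 = 0 \<and> poly (logampl s) 1 = 0"
proof (induction s rule: less_induct)
  case (less s)
  show ?case
  proof (cases "s = 0")
    case False
    have "poly (\<Sum>k\<in>{1..<s}. smult (of_nat k) (logampl k * ampl (s - k))) c = 0" if "c = 0 \<or> c = 1" for c
      unfolding poly_sum by (rule sum.neutral) (use less that in auto)
    then show ?thesis
      using ampl_roots[of s] False by (subst (1 2) logampl.simps) simp
  qed simp
qed

text \<open>
  Power series in \<open>\<epsilon>\<close> over polynomials in \<open>t\<close> carry two commuting derivations: \<open>fps_deriv\<close> is the
  one in \<open>\<epsilon>\<close>, and this is the one in \<open>t\<close>.
\<close>

definition fps_dt :: "complex poly fps \<Rightarrow> complex poly fps" where
  "fps_dt F = Abs_fps (\<lambda>n. pderiv (fps_nth F n))"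

lemma fps_dt_nth [simp]: "fps_nth (fps_dt F) n = pderiv (fps_nth F n)"
  by (simp add: fps_dt_def)

lemma pderiv_sum_poly: "pderiv (sum f A) = (\<Sum>i\<in>A. pderiv (f i))"
  by (induction A rule: infinite_finite_induct) (auto simp: pderiv_add)

lemma fps_dt_mult: "fps_dt (F * G) = fps_dt F * G + F * fps_dt G"
proof (rule fps_ext)
  fix n
  have "fps_nth (fps_dt (F * G)) n =
      (\<Sum>i=0..n. pderiv (fps_nth F i) * fps_nth G (n - i) + fps_nth F i * pderiv (fps_nth G (n - i)))"
    by (simp add: fps_mult_nth pderiv_sum_poly pderiv_mult mult.commute add.commute)
  then show "fps_nth (fps_dt (F * G)) n = fps_nth (fps_dt F * G + F * fps_dt G) n"
    by (simp add: fps_mult_nth sum.distrib)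
qed

lemma fps_dt_add: "fps_dt (F + G) = fps_dt F + fps_dt G"
  by (rule fps_ext) (simp add: pderiv_add)

lemma fps_dt_const [simp]: "fps_dt (fps_const c) = fps_const (pderiv c)"
  by (rule fps_ext) auto

lemma fps_dt_1 [simp]: "fps_dt 1 = 0"
  by (rule fps_ext) auto

lemma fps_dt_X [simp]: "fps_dt fps_X = 0"
  by (rule fps_ext) (simp add: fps_X_def)

lemma fps_deriv_dt: "fps_deriv (fps_dt F) = fps_dt (fps_deriv F)"
  by (rule fps_ext) (simp add: pderiv_mult pderiv_of_nat del: of_nat_Suc)

definition ampl_fps :: "complex poly fps" where "ampl_fps = Abs_fps ampl"
definition logampl_fps :: "complex poly fps" where "logampl_fps = Abs_fps logampl"

lemma deriv_ampl_fps: "fps_deriv ampl_fps = ampl_fps * fps_deriv logampl_fps"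
proof (rule fps_ext)
  fix n
  have "fps_nth (fps_deriv ampl_fps) n = smult (of_nat (Suc n)) (ampl (Suc n))"
    by (simp add: ampl_fps_def of_nat_poly del: of_nat_Suc ampl.simps(2))
  also have "\<dots> = (\<Sum>i\<le>n. smult (of_nat (Suc i)) (logampl (Suc i) * ampl (n - i)))"
    by (rule ampl_log_recurrence)
  also have "\<dots> = fps_nth (fps_deriv logampl_fps * ampl_fps) n"
    unfolding fps_mult_nth atMost_atLeast0
    by (rule sum.cong) (auto simp: ampl_fps_def logampl_fps_def of_nat_poly simp del: of_nat_Suc ampl.simps(2))
  finally show "fps_nth (fps_deriv ampl_fps) n = fps_nth (ampl_fps * fps_deriv logampl_fps) n"
    by (simp add: mult.commute)
qed

lemma fps_linear_ode_zero:
  fixes D Q :: "complex poly fps"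
  assumes "fps_deriv D = Q * D" "fps_nth D 0 = 0"
  shows "D = 0"
proof (rule fps_ext)
  fix n
  show "fps_nth D n = fps_nth 0 n"
  proof (induction n rule: less_induct)
    case (less n)
    show ?case
    proof (cases n)
      case (Suc m)
      have "of_nat (Suc m) * fps_nth D (Suc m) = fps_nth (Q * D) m"
        by (simp flip: assms(1) del: of_nat_Suc)
      also have "\<dots> = 0"
        unfolding fps_mult_nth by (rule sum.neutral) (use less Suc in auto)
      finally show ?thesis using Suc by (simp del: of_nat_Suc)
    qed (simp add: assms)
  qed
qed

text \<open>
  The logarithmic derivative in \<open>\<epsilon>\<close> determines the one in \<open>t\<close>: the defect \<open>D\<close> solves the linear
  equation \<open>D' = P' D\<close> in \<open>\<epsilon>\<close> and vanishes at \<open>\<epsilon> = 0\<close>.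
\<close>

lemma dt_ampl_fps: "fps_dt ampl_fps = ampl_fps * fps_dt logampl_fps"
proof -
  define D where "D = fps_dt ampl_fps - ampl_fps * fps_dt logampl_fps"
  have "fps_deriv D = fps_deriv logampl_fps * D"
    unfolding D_def by (simp add: fps_deriv_dt deriv_ampl_fps fps_dt_mult algebra_simps)
  moreover have "fps_nth D 0 = 0" by (simp add: D_def ampl_fps_def logampl_fps_def)
  ultimately have "D = 0" by (rule fps_linear_ode_zero)
  then show ?thesis by (simp add: D_def)
qed

lemma ampl_fps_equation: "ampl_fps = 1 + fps_X * (fps_const tau * fps_dt (fps_const [:0,1:] * ampl_fps))"
proof (rule fps_ext)
  fix n show "fps_nth ampl_fps n = fps_nth (1 + fps_X * (fps_const tau * fps_dt (fps_const [:0,1:] * ampl_fps))) n"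
    by (cases n) (simp_all add: ampl_fps_def)
qed

text \<open>
  Differentiate the amplitude equation in \<open>t\<close>, to remove its inhomogeneous term, and divide
  by the amplitude.
\<close>

lemma riccati:
  defines "H \<equiv> fps_dt logampl_fps"
  shows "H = fps_X * (fps_const (pderiv tau) * (1 + fps_const [:0,1:] * H)
     + fps_const tau * (H + H + fps_const [:0,1:] * (H * H + fps_dt H)))" (is "_ = ?R")
proof -
  let ?t = "fps_const [:0,1::complex:]"
  have t: "pderiv [:0,1::complex:] = 1" by (simp add: pderiv_pCons)
  have 0: "fps_dt (?t * ampl_fps) = ampl_fps * (1 + ?t * H)"
    by (simp add: fps_dt_mult dt_ampl_fps H_def t algebra_simps)
  have "ampl_fps * H = fps_dt ampl_fps" by (simp add: dt_ampl_fps H_def)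
  also have "\<dots> = fps_dt (1 + fps_X * (fps_const tau * (ampl_fps * (1 + ?t * H))))"
    by (subst ampl_fps_equation) (simp only: 0)
  also have "\<dots> = ampl_fps * ?R"
    unfolding fps_dt_add fps_dt_mult fps_dt_1 fps_dt_X fps_dt_const dt_ampl_fps H_def [symmetric]
    by (simp add: t algebra_simps)
  finally have "ampl_fps * H = ampl_fps * ?R" .
  moreover have "ampl_fps \<noteq> 0"
  proof
    assume "ampl_fps = 0"
    then have "fps_nth ampl_fps 0 = 0" by simp
    then show False by (simp add: ampl_fps_def)
  qed
  ultimately show ?thesis by simp
qed

lemma logampl_riccati:
  assumes "s > 0"
  shows "pderiv (logampl (Suc s)) = pderiv tau * ([:0,1:] * pderiv (logampl s))
    + tau * (pderiv (logampl s) + pderiv (logampl s)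
        + [:0,1:] * ((\<Sum>j\<le>s. pderiv (logampl j) * pderiv (logampl (s - j))) + pderiv (pderiv (logampl s))))"
proof -
  define H where "H = fps_dt logampl_fps"
  have H: "fps_nth H n = pderiv (logampl n)" for n by (simp add: H_def logampl_fps_def)
  have "fps_nth (fps_const c * F) n = c * fps_nth F n" for c and F :: "complex poly fps" and n
    by simp
  note nths = this fps_X_mult_nth fps_add_nth
  have "fps_nth H (Suc s) = fps_nth (fps_X * (fps_const (pderiv tau) * (1 + fps_const [:0,1:] * H)
     + fps_const tau * (H + H + fps_const [:0,1:] * (H * H + fps_dt H)))) (Suc s)"
    unfolding H_def by (rule arg_cong [OF riccati])
  also have "\<dots> = pderiv tau * ([:0,1:] * fps_nth H s) + tau * (fps_nth H s + fps_nth H s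
        + [:0,1:] * (fps_nth (H * H) s + pderiv (fps_nth H s)))"
    using assms unfolding nths by simp
  finally show ?thesis
    by (simp only: H fps_mult_nth atMost_atLeast0)
qed

lemma logampl_1: "logampl (Suc 0) = tau"
  by (subst logampl.simps) (simp add: tau_def pderiv_pCons one_pCons)

section \<open>The coefficient functions \<open>F\<close>, \<open>E\<close> and \<open>L\<close> in closed form\<close>

lemma poly_inv_has_deriv:
  fixes z :: complex
  assumes "z \<noteq> 1"
  shows "((\<lambda>z. poly P (1 / (1 - z))) has_field_derivative
           poly (pderiv P) (1 / (1 - z)) * (1 / (1 - z))^2) (at z within A)"
proof -
  have "((\<lambda>z. 1 / (1 - z)) has_field_derivative (1 / (1 - z))^2) (at z within A)"
    using assms by (auto intro!: derivative_eq_intros simp: power2_eq_square)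
  moreover have "(poly P has_field_derivative poly (pderiv P) (1 / (1 - z))) (at (1 / (1 - z)))"
    by (rule poly_DERIV)
  ultimately show ?thesis
    by (rule DERIV_chain2 [where f = "poly P" and g = "\<lambda>z. 1 / (1 - z)", rotated])
qed

text \<open>
  With \<open>z = 1 - 1 / t\<close> the operator \<open>z / (1 - z) d/dz\<close> becomes \<open>(t - 1) t\<^sup>2 d/dt\<close>, and the two occurrences of
  \<open>F\<^sub>0 = t - t\<^sup>2\<close> in the convolution supply the linear term of the Riccati equation. The index starts
  at 1 since \<open>F\<^sub>0\<close> does not follow the pattern: it is half of what the formula would give for the
  logarithmic derivative of the leading factor \<open>t\<close>.
\<close>

lemma Fm_eq:
  assumes "z \<noteq> 1"
  shows "Fm (Suc s) z = 2 * (-1) ^ Suc s * (1 - 1 / (1 - z)) * (1 / (1 - z))^2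
           * poly (pderiv (logampl (Suc s))) (1 / (1 - z))"
  using assms
proof (induction s arbitrary: z rule: less_induct)
  case (less s)
  define t where "t = 1 / (1 - z)"
  have t: "t \<noteq> 0" "z = 1 - 1 / t" using less.prems by (auto simp: t_def)
  have F0: "Fm 0 z = t - t^2"
    unfolding Fm.simps t(2) using t(1) by (simp add: field_simps power2_eq_square)
  show ?case
  proof (cases s)
    case 0
    show ?thesis
      using t by (simp add: 0 logampl_1 tau_def pderiv_pCons flip: t_def) (simp add: field_simps power4_eq_xxxx power2_eq_square)
  next
    case (Suc n)
    define h where "h j = poly (pderiv (logampl j)) t" for j
    define h' where "h' = poly (pderiv (pderiv (logampl s))) t"
    \<comment> \<open>\<open>F\<^sub>s\<close> as a polynomial in \<open>t\<close>, by the induction hypothesis.\<close>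
    define Q where "Q = smult (2 * (-1) ^ s) ([:0,0,1,-1:] * pderiv (logampl s))"
    have F: "Fm (Suc j) z = 2 * (-1) ^ Suc j * (1 - t) * t^2 * h (Suc j)" if "j < s" for j
      using less.IH [OF that less.prems] by (simp add: t_def h_def)
    have Q: "poly Q v = 2 * (-1) ^ s * (1 - v) * v^2 * poly (pderiv (logampl s)) v" for v
      by (simp add: Q_def algebra_simps power2_eq_square)
    have "Fm s w = poly Q (1 / (1 - w))" if "w \<noteq> 1" for w
      using less.IH [of n w] that unfolding Suc Q by simp
    then have "eventually (\<lambda>w. Fm s w = poly Q (1 / (1 - w))) (nhds z)"
      using less.prems by (intro eventually_mono [OF t1_space_nhds]) auto
    then have "deriv (Fm s) z = deriv (\<lambda>w. poly Q (1 / (1 - w))) z"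
      by (rule deriv_cong_ev) simp
    also have "\<dots> = poly (pderiv Q) t * t^2"
      unfolding t_def by (rule DERIV_imp_deriv [OF poly_inv_has_deriv]) fact
    also have "poly (pderiv Q) t = 2 * (-1) ^ s * ((1 - t) * t^2 * h' + (2 * t - 3 * t^2) * h s)"
      unfolding Q_def h_def h'_def pderiv_mult pderiv_smult poly_smult poly_add poly_mult
      by (simp add: pderiv_pCons algebra_simps power2_eq_square)
    finally have D: "deriv (Fm s) z = 2 * (-1) ^ s * ((1 - t) * t^2 * h' + (2 * t - 3 * t^2) * h s) * t^2" .
    define S where "S = (\<Sum>j<n. h (Suc j) * h (n - j))"
    have split: "(\<Sum>j\<le>Suc n. f j * f (Suc n - j)) =
        2 * f 0 * f (Suc n) + (\<Sum>j<n. f (Suc j) * f (n - j))" for f :: "nat \<Rightarrow> complex"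
      by (subst sum.atMost_Suc_shift) (simp add: lessThan_Suc_atMost [symmetric])
    have "(\<Sum>j<n. Fm (Suc j) z * Fm (n - j) z) = 4 * (-1) ^ Suc n * ((1 - t) * t^2)^2 * S"
      unfolding S_def sum_distrib_left
    proof (rule sum.cong)
      fix j assume j: "j \<in> {..<n}"
      then obtain k where k: "n - j = Suc k" by (cases "n - j") auto
      have e: "Suc n = Suc j + Suc k" using j k by simp
      have "Fm (Suc j) z * Fm (n - j) z = (2 * (-1) ^ Suc j * (1 - t) * t^2 * h (Suc j)) *
           (2 * (-1) ^ Suc k * (1 - t) * t^2 * h (Suc k))"
        using F[of j] F[of k] j k Suc by simp
      also have "\<dots> = 4 * (-1) ^ Suc n * ((1 - t) * t^2)^2 * (h (Suc j) * h (n - j))"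
        unfolding e k power_add by (simp add: power2_eq_square)
      finally show "Fm (Suc j) z * Fm (n - j) z
        = 4 * (-1) ^ Suc n * ((1 - t) * t^2)^2 * (h (Suc j) * h (n - j))" .
    qed simp
    then have conv: "(\<Sum>j\<le>Suc n. Fm j z * Fm (Suc n - j) z) =
        2 * (t - t^2) * (2 * (-1) ^ s * (1 - t) * t^2 * h s) + 4 * (-1) ^ s * ((1 - t) * t^2)^2 * S"
      using F[of n] unfolding split[of "\<lambda>j. Fm j z"] F0 Suc by simp
    have "(\<Sum>j\<le>s. h j * h (s - j)) = S"
      unfolding Suc split S_def by (simp add: h_def)
    then have ric: "h (Suc s) = (1 - 2 * t) * t * h s + (t - t^2) * (2 * h s + t * (S + h'))"
      using logampl_riccati[of s] Suc
      by (simp add: h_def h'_def tau_def poly_sum pderiv_pCons algebra_simps power2_eq_square)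
    have zt: "z / (1 - z) = t - 1" using less.prems unfolding t_def by (simp add: field_simps)
    have "Fm (Suc s) z = (t - 1) * deriv (Fm s) z
        - 1/2 * (\<Sum>j\<le>Suc n. Fm j z * Fm (Suc n - j) z)"
      unfolding Suc Fm.simps(3) zt by (rule refl)
    also have "\<dots> = 2 * (-1) ^ Suc s * (1 - t) * t^2 * h (Suc s)"
      unfolding D conv ric by simp algebra
    finally show ?thesis by (simp add: t_def h_def)
  qed
qed

lemma Em_eq:
  assumes "Re z = 0"
  shows "Em (Suc s) z = (-1) ^ Suc s * poly (logampl (Suc s)) (1 / (1 - z))"
proof -
  define P where "P = smult ((-1) ^ Suc s) (logampl (Suc s))"
  define g where "g w = poly (pderiv P) (1 / (1 - w)) * (1 / (1 - w))^2" for w :: complex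
  have ne: "w \<noteq> 1" if "w \<in> closed_segment 0 z" for w
    using that assms by (auto simp: closed_segment_def dest: arg_cong [where f = Re])
  have "(g has_contour_integral (poly P (1 / (1 - pathfinish (linepath 0 z)))
      - poly P (1 / (1 - pathstart (linepath 0 z))))) (linepath 0 z)"
    using ne unfolding g_def
    by (intro contour_integral_primitive [of "closed_segment 0 z" "\<lambda>w. poly P (1 / (1 - w))"])
      (auto intro: poly_inv_has_deriv)
  then have "(g has_contour_integral poly P (1 / (1 - z))) (linepath 0 z)"
    using logampl_roots[of "Suc s"] by (simp add: P_def)
  then have "((\<lambda>x. g (linepath 0 z x) * z) has_integral poly P (1 / (1 - z))) {0..1}"
    by (simp add: has_contour_integral_linepath)
  then have "((\<lambda>x. (linepath 0 z x - 1) * Fm (Suc s) (linepath 0 z x) / (2 * linepath 0 z x) * z)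
      has_integral poly P (1 / (1 - z))) {0..1}"
  \<comment> \<open>At the parameter 0, division by zero sets the integrand to 0, whereas the limit differs from 0.\<close>
  proof (rule has_integral_spike_finite [of "{0}", rotated 2])
    fix x :: real assume x: "x \<in> {0..1} - {0}"
    define w where "w = linepath 0 z x"
    show "(linepath 0 z x - 1) * Fm (Suc s) (linepath 0 z x) / (2 * linepath 0 z x) * z
        = g (linepath 0 z x) * z"
    proof (cases "z = 0")
      case False
      have w: "w \<noteq> 0" "w \<noteq> 1" using False x ne[of w]
        by (auto simp: w_def linepath_def in_segment scaleR_conv_of_real) 
      define t where "t = 1 / (1 - w)"
      have t: "t \<noteq> 0" "t \<noteq> 1" "w = 1 - 1 / t" using w by (auto simp: t_def)
      have "(w - 1) * Fm (Suc s) w / (2 * w) = g w"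
        unfolding Fm_eq[OF w(2)] g_def t_def [symmetric] P_def pderiv_smult poly_smult
        unfolding t(3) using t(1,2) by (simp add: field_simps)
      then show ?thesis by (simp add: w_def)
    qed simp
  qed simp
  then have "((\<lambda>w. (w - 1) * Fm (Suc s) w / (2 * w)) has_contour_integral poly P (1 / (1 - z))) (linepath 0 z)"
    by (simp add: has_contour_integral_linepath)
  then show ?thesis
    unfolding Em_def P_def by (simp add: contour_integral_unique)
qed

lemma L_eq: "L (Suc s) x = Im (poly (logampl (Suc s)) (1 / (1 + \<i> * of_real x)))"
proof -
  have sgn: "(-1) ^ Suc s * ((-1) ^ Suc s * w) = (w :: complex)" for w
    by (simp flip: power_mult_distrib mult.assoc)
  have im: "Im (of_real c * w) = c * Im w" for c w by simp
  have "of_real ((-1) ^ Suc s) * Em (Suc s) (- \<i> * of_real x) = poly (logampl (Suc s)) (1 / (1 + \<i> * of_real x))"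
    using sgn by (subst Em_eq) auto
  then show ?thesis
    unfolding L_def by (metis im)
qed

section \<open>Bounded rational functions of a real variable\<close>

text \<open>
  The algebra generated by the real and imaginary part of \<open>1 / (1 + \<i>x)\<close>. It is closed under
  differentiation, and the properties needed of \<open>L\<^sub>s\<close> and \<open>q\<^sub>k\<close> (bounded, rational without real poles,
  controlled at infinity) follow by induction on its elements.
\<close>

inductive_set rat_bdd :: "(real \<Rightarrow> real) set" where
  const: "(\<lambda>x. c) \<in> rat_bdd"
| inv: "(\<lambda>x. 1 / (1 + x^2)) \<in> rat_bdd"
| xinv: "(\<lambda>x. x / (1 + x^2)) \<in> rat_bdd"
| add: "f \<in> rat_bdd \<Longrightarrow> g \<in> rat_bdd \<Longrightarrow> (\<lambda>x. f x + g x) \<in> rat_bdd"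
| mult: "f \<in> rat_bdd \<Longrightarrow> g \<in> rat_bdd \<Longrightarrow> (\<lambda>x. f x * g x) \<in> rat_bdd"

lemma one_plus_square_neq_0 [simp]: "1 + (x::real)^2 \<noteq> 0"
  by (metis add_pos_nonneg less_irrefl zero_le_power2 zero_less_one)

lemma one_plus_square_pos [simp]: "0 < 1 + (x::real)^2"
  by (simp add: add_pos_nonneg)

lemma rat_bdd_cmult: "f \<in> rat_bdd \<Longrightarrow> (\<lambda>x. c * f x) \<in> rat_bdd"
  by (rule rat_bdd.mult [OF rat_bdd.const])

lemma rat_bdd_diff: "f \<in> rat_bdd \<Longrightarrow> g \<in> rat_bdd \<Longrightarrow> (\<lambda>x. f x - g x) \<in> rat_bdd"
  using rat_bdd.add [OF _ rat_bdd_cmult [of g "-1"]] by simp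

lemma rat_bdd_bounded:
  assumes "f \<in> rat_bdd" shows "\<exists>B\<ge>0. \<forall>x. \<bar>f x\<bar> \<le> B"
  using assms
proof induction
  case (const c)
  show ?case by (rule exI [of _ "\<bar>c\<bar>"]) auto
next
  case inv
  have "\<bar>1 / (1 + x^2)\<bar> \<le> 1" for x :: real
    by (simp add: abs_divide)
  then show ?case by (intro exI [of _ 1]) auto
next
  case xinv
  have "\<bar>x / (1 + x^2)\<bar> \<le> 1" for x :: real
  proof -
    have "2 * \<bar>x\<bar> \<le> 1 + x^2" using sum_power2_ge_zero[of "\<bar>x\<bar> - 1" 0] by (simp add: power2_diff)
    then show ?thesis by (simp add: abs_divide)
  qed
  then show ?case by (intro exI [of _ 1]) auto
next
  case (add f g)
  then obtain A B where "A \<ge> 0" "\<forall>x. \<bar>f x\<bar> \<le> A" "B \<ge> 0" "\<forall>x. \<bar>g x\<bar> \<le> B" by blast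
  then show ?case by (intro exI[of _ "A + B"]) (auto intro: abs_triangle_ineq [THEN order_trans] add_mono)
next
  case (mult f g)
  then obtain A B where "A \<ge> 0" "\<forall>x. \<bar>f x\<bar> \<le> A" "B \<ge> 0" "\<forall>x. \<bar>g x\<bar> \<le> B" by blast
  then show ?case by (intro exI[of _ "A * B"]) (auto simp: abs_mult intro: mult_mono)
qed

definition rat_null :: "(real \<Rightarrow> real) set" where
  "rat_null = {f \<in> rat_bdd. (f \<longlongrightarrow> 0) at_infinity}"

lemma rat_null_inv: "(\<lambda>x. 1 / (1 + x^2)) \<in> rat_null"
  and rat_null_xinv: "(\<lambda>x. x / (1 + x^2)) \<in> rat_null"
proof -
  have a: "norm (1 / (1 + x^2)) \<le> norm (inverse x) * 1" if "x \<noteq> 0" for x :: real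
  proof -
    have "2 * \<bar>x\<bar> \<le> 1 + x^2" using sum_power2_ge_zero[of "\<bar>x\<bar> - 1" 0] by (simp add: power2_diff)
    then have "\<bar>x\<bar> \<le> 1 + x^2" by linarith
    then show ?thesis using that by (simp add: field_simps abs_divide)
  qed
  have b: "norm (x / (1 + x^2)) \<le> norm (inverse x) * 1" if "x \<noteq> 0" for x :: real
    using that by (simp add: divide_simps abs_divide flip: power2_eq_square) 
  have nz: "eventually (\<lambda>x::real. x \<noteq> 0) at_infinity"
    by (rule eventually_not_equal_at_infinity)
  have "((\<lambda>x::real. 1 / (1 + x^2)) \<longlongrightarrow> 0) at_infinity"
    by (rule tendsto_0_le [OF tendsto_inverse_0 eventually_mono [OF nz a]])
  then show "(\<lambda>x. 1 / (1 + x^2)) \<in> rat_null"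
    by (simp add: rat_null_def rat_bdd.inv)
  have "((\<lambda>x::real. x / (1 + x^2)) \<longlongrightarrow> 0) at_infinity"
    by (rule tendsto_0_le [OF tendsto_inverse_0 eventually_mono [OF nz b]])
  then show "(\<lambda>x. x / (1 + x^2)) \<in> rat_null"
    by (simp add: rat_null_def rat_bdd.xinv)
qed

lemma rat_null_imp_bdd: "f \<in> rat_null \<Longrightarrow> f \<in> rat_bdd"
  by (simp add: rat_null_def)

lemma rat_null_0: "(\<lambda>x. 0) \<in> rat_null"
  by (simp add: rat_null_def rat_bdd.const)

lemma rat_null_add: "f \<in> rat_null \<Longrightarrow> g \<in> rat_null \<Longrightarrow> (\<lambda>x. f x + g x) \<in> rat_null"
  unfolding rat_null_def using tendsto_add[of f 0 at_infinity g 0] by (simp add: rat_bdd.add)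

lemma rat_null_mult:
  assumes "f \<in> rat_bdd" "g \<in> rat_null" shows "(\<lambda>x. f x * g x) \<in> rat_null"
proof -
  obtain B where B: "\<forall>x. \<bar>f x\<bar> \<le> B" using rat_bdd_bounded[OF assms(1)] by blast
  have "norm (f x * g x) \<le> norm (g x) * B" for x
  proof -
    have "\<bar>f x\<bar> * \<bar>g x\<bar> \<le> B * \<bar>g x\<bar>" using B by (intro mult_right_mono) auto
    then show ?thesis by (simp only: real_norm_def abs_mult mult.commute)
  qed
  note le = this
  have "(g \<longlongrightarrow> 0) at_infinity" using assms(2) by (simp add: rat_null_def)
  then have "((\<lambda>x. f x * g x) \<longlongrightarrow> 0) at_infinity"
    by (rule tendsto_0_le [where K = B]) (simp only: le eventually_True)
  then show ?thesis using assms by (simp add: rat_null_def rat_bdd.mult)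
qed

lemma rat_null_mult': "f \<in> rat_null \<Longrightarrow> g \<in> rat_bdd \<Longrightarrow> (\<lambda>x. f x * g x) \<in> rat_null"
  using rat_null_mult[of g f] by (simp add: mult.commute)

lemma rat_null_cmult: "f \<in> rat_null \<Longrightarrow> (\<lambda>x. c * f x) \<in> rat_null"
  by (rule rat_null_mult [OF rat_bdd.const])

lemma rat_null_diff: "f \<in> rat_null \<Longrightarrow> g \<in> rat_null \<Longrightarrow> (\<lambda>x. f x - g x) \<in> rat_null"
  using rat_null_add [OF _ rat_null_cmult [of g "-1"]] by simp

lemma rat_null_sum:
  "(\<And>i. i \<in> A \<Longrightarrow> f i \<in> rat_null) \<Longrightarrow> (\<lambda>x. \<Sum>i\<in>A. f i x) \<in> rat_null"
proof (induction A rule: infinite_finite_induct)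
  case (insert i A)
  then show ?case using rat_null_add[of "f i" "\<lambda>x. \<Sum>i\<in>A. f i x"] by simp
qed (auto simp: rat_null_0)

lemma rat_bdd_deriv:
  assumes "f \<in> rat_bdd"
  shows "\<exists>g\<in>rat_null. \<forall>x. (f has_real_derivative g x) (at x)"
  using assms
proof induction
  case (const c)
  show ?case by (rule bexI [OF _ rat_null_0]) auto
next
  case inv
  have "((\<lambda>x. 1 / (1 + x^2)) has_real_derivative (-2) * (1 / (1 + x^2) * (x / (1 + x^2)))) (at x)" for x :: real
  proof -
    have "((\<lambda>x. 1 / (1 + x^2)) has_real_derivative (0 * (1 + x^2) - 1 * (2 * x)) / ((1 + x^2) * (1 + x^2))) (at x)"
      by (rule DERIV_divide) (auto intro!: derivative_eq_intros)
    then show ?thesis by simp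
  qed
  then show ?case
    by (intro bexI [of _ "\<lambda>x. (-2) * (1 / (1 + x^2) * (x / (1 + x^2)))"] rat_null_cmult rat_null_mult rat_bdd.inv rat_null_xinv allI)
next
  case xinv
  have "((\<lambda>x. x / (1 + x^2)) has_real_derivative 1 / (1 + x^2) - 2 * (x / (1 + x^2) * (x / (1 + x^2)))) (at x)" for x :: real
  proof -
    have "((\<lambda>x. x / (1 + x^2)) has_real_derivative (1 * (1 + x^2) - x * (2 * x)) / ((1 + x^2) * (1 + x^2))) (at x)"
      by (rule DERIV_divide) (auto intro!: derivative_eq_intros)
    moreover have "(1 * (1 + x^2) - x * (2 * x)) / ((1 + x^2) * (1 + x^2)) = 1 / (1 + x^2) - 2 * (x / (1 + x^2) * (x / (1 + x^2)))"
      by (simp add: diff_divide_distrib)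
    ultimately show ?thesis by simp
  qed
  then show ?case
    by (intro bexI [of _ "\<lambda>x. 1 / (1 + x^2) - 2 * (x / (1 + x^2) * (x / (1 + x^2)))"] rat_null_diff rat_null_cmult rat_null_mult
        rat_bdd.xinv rat_null_xinv rat_null_inv allI)
next
  case (add f g)
  then obtain f' g' where "f' \<in> rat_null" "g' \<in> rat_null"
    "\<forall>x. (f has_real_derivative f' x) (at x)" "\<forall>x. (g has_real_derivative g' x) (at x)" by blast
  then show ?case by (intro bexI [of _ "\<lambda>x. f' x + g' x"] rat_null_add) (auto intro: DERIV_add)
next
  case (mult f g)
  then obtain f' g' where *: "f' \<in> rat_null" "g' \<in> rat_null"
    "\<forall>x. (f has_real_derivative f' x) (at x)" "\<forall>x. (g has_real_derivative g' x) (at x)" by blast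
  then show ?case
    by (intro bexI [of _ "\<lambda>x. f' x * g x + g' x * f x"] rat_null_add rat_null_mult' mult.hyps) (auto intro: DERIV_mult)
qed

lemma rat_bdd_rational:
  assumes "f \<in> rat_bdd"
  shows "\<exists>p d :: real poly. \<forall>x. poly d x \<noteq> 0 \<and> f x = poly p x / poly d x"
  using assms
proof induction
  case (const c)
  show ?case by (rule exI[of _ "[:c:]"], rule exI[of _ 1]) simp
next
  case inv
  show ?case by (rule exI[of _ 1], rule exI[of _ "[:1,0,1:]"]) (simp flip: power2_eq_square)
next
  case xinv
  show ?case by (rule exI[of _ "[:0,1:]"], rule exI[of _ "[:1,0,1:]"]) (simp flip: power2_eq_square)
next
  case (add f g)
  then obtain p d p' d' where "\<forall>x. poly d x \<noteq> 0 \<and> f x = poly p x / poly d x"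
    "\<forall>x. poly d' x \<noteq> 0 \<and> g x = poly p' x / poly d' x" by blast
  then show ?case
    by (intro exI[of _ "p * d' + p' * d"] exI[of _ "d * d'"]) (auto simp: add_frac_eq)
next
  case (mult f g)
  then obtain p d p' d' where "\<forall>x. poly d x \<noteq> 0 \<and> f x = poly p x / poly d x"
    "\<forall>x. poly d' x \<noteq> 0 \<and> g x = poly p' x / poly d' x" by blast
  then show ?case
    by (intro exI[of _ "p * p'"] exI[of _ "d * d'"]) auto
qed

lemma poly_inv_rat_bdd:
  "(\<lambda>x. Re (poly P (1 / (1 + \<i> * of_real x)))) \<in> rat_bdd \<and>
   (\<lambda>x. Im (poly P (1 / (1 + \<i> * of_real x)))) \<in> rat_bdd"
proof (induction P)
  case 0
  then show ?case by (auto intro: rat_bdd.const)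
next
  case (pCons c P)
  have t: "Re (1 / (1 + \<i> * of_real x)) = 1 / (1 + x^2)" "Im (1 / (1 + \<i> * of_real x)) = - 1 * (x / (1 + x^2))" for x
    by (simp_all add: Re_divide Im_divide)
  show ?case
    unfolding poly_pCons plus_complex.sel times_complex.sel t
    using pCons.IH by (intro conjI rat_bdd.add rat_bdd_diff rat_bdd.mult rat_bdd.const rat_bdd.inv rat_bdd.xinv) auto
qed

text \<open>
  The functions that are composed with \<open>x + \<Sum> q\<^sub>k(x) \<epsilon>^k\<close>: the class contains \<open>arctan\<close> in addition to
  \<open>rat_bdd\<close>, and all derivatives of its members are bounded on the whole line.
\<close>

definition admissible :: "(real \<Rightarrow> real) \<Rightarrow> bool" where
  "admissible f \<longleftrightarrow> (\<exists>B. \<forall>x. \<bar>f x\<bar> \<le> B) \<and> (\<exists>g\<in>rat_null. \<forall>x. (f has_real_derivative g x) (at x))"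

lemma admissible_rat_bdd: "f \<in> rat_bdd \<Longrightarrow> admissible f"
  using rat_bdd_bounded rat_bdd_deriv unfolding admissible_def by blast

lemma admissible_arctan: "admissible arctan"
  unfolding admissible_def
proof
  have "\<bar>arctan x\<bar> \<le> pi" for x
    using arctan_bounded[of x] by (auto simp: abs_if)
  then show "\<exists>B. \<forall>x. \<bar>arctan x\<bar> \<le> B" by blast
  show "\<exists>g\<in>rat_null. \<forall>x. (arctan has_real_derivative g x) (at x)"
    using DERIV_arctan by (intro bexI[OF _ rat_null_inv]) (auto simp: inverse_eq_divide)
qed

lemma admissible_deriv:
  assumes "admissible f"
  shows "(\<forall>x. ((deriv ^^ n) f has_real_derivative (deriv ^^ Suc n) f x) (at x)) \<and> (deriv ^^ Suc n) f \<in> rat_null"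
proof (induction n)
  case 0
  obtain g where g: "g \<in> rat_null" "\<forall>x. (f has_real_derivative g x) (at x)"
    using assms by (auto simp: admissible_def)
  then have "deriv f = g" by (auto intro: DERIV_imp_deriv)
  with g show ?case by simp
next
  case (Suc n)
  let ?f = "(deriv ^^ Suc n) f"
  obtain g where g: "g \<in> rat_null" "\<forall>x. (?f has_real_derivative g x) (at x)"
    using Suc rat_bdd_deriv rat_null_imp_bdd by blast
  then have "deriv ?f = g" by (auto intro: DERIV_imp_deriv)
  with g show ?case by simp
qed

lemma admissible_deriv_bounded:
  assumes "admissible f"
  shows "\<exists>B. \<forall>x. \<bar>(deriv ^^ n) f x\<bar> \<le> B"
proof (cases n)
  case 0
  then show ?thesis using assms by (simp add: admissible_def)
next
  case (Suc m)
  then show ?thesis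
    using rat_bdd_bounded [OF rat_null_imp_bdd] admissible_deriv [OF assms, of m] by metis
qed

lemma admissible_taylor:
  assumes "admissible f"
  shows "\<exists>C\<ge>0. \<forall>x h. \<bar>f (x + h) - (\<Sum>n<M. (deriv ^^ n) f x / fact n * h ^ n)\<bar> \<le> C * \<bar>h\<bar> ^ M"
proof -
  obtain B where B: "\<And>x. \<bar>(deriv ^^ M) f x\<bar> \<le> B" using admissible_deriv_bounded[OF assms] by blast
  have "\<bar>f (x + h) - (\<Sum>n<M. (deriv ^^ n) f x / fact n * h ^ n)\<bar> \<le> B / fact M * \<bar>h\<bar> ^ M" for x h
  proof -
    have "((\<lambda>t. (deriv ^^ n) f (x + t)) has_real_derivative (deriv ^^ Suc n) f (x + t)) (at t)" for n t
      using admissible_deriv[OF assms, of n] DERIV_shift[of "(deriv ^^ n) f" "(deriv ^^ Suc n) f (x + t)" t x]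
      by (simp add: add.commute)
    then obtain t where "f (x + h) = (\<Sum>n<M. (deriv ^^ n) f x / fact n * h ^ n) + (deriv ^^ M) f (x + t) / fact M * h ^ M"
      using Maclaurin_all_le[of "\<lambda>n t. (deriv ^^ n) f (x + t)" "\<lambda>t. f (x + t)" h M] by auto
    then have "\<bar>f (x + h) - (\<Sum>n<M. (deriv ^^ n) f x / fact n * h ^ n)\<bar> = \<bar>(deriv ^^ M) f (x + t)\<bar> / fact M * \<bar>h\<bar> ^ M"
      by (simp add: abs_mult power_abs)
    also have "\<dots> \<le> B / fact M * \<bar>h\<bar> ^ M"
      by (intro mult_right_mono divide_right_mono B) auto
    finally show ?thesis .
  qed
  moreover have "B / fact M \<ge> 0" using B[of 0] by auto
  ultimately show ?thesis by blast
qed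

section \<open>Uniform expansions in powers of a small parameter\<close>

text \<open>
  \<open>g x e = \<Sum> c\<^sub>n(x) e^n + O(e^M)\<close>, uniformly in \<open>x\<close>. Boundedness of the coefficients is part of the notion
  because it is needed for products.
\<close>

definition unif_exp :: "nat \<Rightarrow> (real \<Rightarrow> real \<Rightarrow> real) \<Rightarrow> (real \<Rightarrow> real fps) \<Rightarrow> bool" where
  "unif_exp M g c \<longleftrightarrow> (\<forall>n<M. \<exists>B. \<forall>x. \<bar>fps_nth (c x) n\<bar> \<le> B) \<and>
     (\<exists>C. \<forall>x e. 0 < e \<and> e \<le> 1 \<longrightarrow> \<bar>g x e - (\<Sum>n<M. fps_nth (c x) n * e ^ n)\<bar> \<le> C * e ^ M)"

lemma unif_exp_error:
  assumes "unif_exp M g c"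
  obtains C where "\<And>x e. 0 < e \<Longrightarrow> e \<le> 1 \<Longrightarrow> \<bar>g x e - (\<Sum>n<M. fps_nth (c x) n * e ^ n)\<bar> \<le> C * e ^ M"
  using assms unfolding unif_exp_def by blast

lemma unif_exp_coeff:
  assumes "unif_exp M g c" "n < M"
  obtains B where "\<And>x. \<bar>fps_nth (c x) n\<bar> \<le> B"
  using assms unfolding unif_exp_def by blast

lemma unif_exp_0: "unif_exp 0 g c \<longleftrightarrow> (\<exists>C. \<forall>x e. 0 < e \<and> e \<le> 1 \<longrightarrow> \<bar>g x e\<bar> \<le> C)"
  by (simp add: unif_exp_def)

text \<open>
  Peeling off the constant term reduces the order by one; products are then handled by induction
  on the order, without estimating double sums.
\<close>

lemma unif_exp_Suc:
  "unif_exp (Suc M) g c \<longleftrightarrow> (\<exists>B. \<forall>x. \<bar>fps_nth (c x) 0\<bar> \<le> B) \<and>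
     unif_exp M (\<lambda>x e. (g x e - fps_nth (c x) 0) / e) (\<lambda>x. fps_shift 1 (c x))"
proof -
  have err: "\<bar>g x e - (\<Sum>n<Suc M. fps_nth (c x) n * e ^ n)\<bar> \<le> C * e ^ Suc M \<longleftrightarrow>
     \<bar>(g x e - fps_nth (c x) 0) / e - (\<Sum>n<M. fps_nth (fps_shift 1 (c x)) n * e ^ n)\<bar> \<le> C * e ^ M"
    if "0 < e" for x e C
  proof -
    have "g x e - (\<Sum>n<Suc M. fps_nth (c x) n * e ^ n) =
        e * ((g x e - fps_nth (c x) 0) / e - (\<Sum>n<M. fps_nth (fps_shift 1 (c x)) n * e ^ n))"
    proof -
      have "g x e - fps_nth (c x) 0 = e * ((g x e - fps_nth (c x) 0) / e)" using that by simp
      moreover have "(\<Sum>n<Suc M. fps_nth (c x) n * e ^ n) =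
          fps_nth (c x) 0 + e * (\<Sum>n<M. fps_nth (fps_shift 1 (c x)) n * e ^ n)"
        by (subst sum.lessThan_Suc_shift) (simp add: sum_distrib_left mult.left_commute)
      ultimately show ?thesis unfolding right_diff_distrib by linarith
    qed
    then have "\<bar>g x e - (\<Sum>n<Suc M. fps_nth (c x) n * e ^ n)\<bar> =
        e * \<bar>(g x e - fps_nth (c x) 0) / e - (\<Sum>n<M. fps_nth (fps_shift 1 (c x)) n * e ^ n)\<bar>"
      using that by (simp only: abs_mult abs_of_pos)
    moreover have "C * e ^ Suc M = e * (C * e ^ M)" by simp
    ultimately show ?thesis using mult_le_cancel_left_pos[OF that] by (simp only:)
  qed
  have "(\<exists>C. \<forall>x e. 0 < e \<and> e \<le> 1 \<longrightarrow> \<bar>g x e - (\<Sum>n<Suc M. fps_nth (c x) n * e ^ n)\<bar> \<le> C * e ^ Suc M) \<longleftrightarrow>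
     (\<exists>C. \<forall>x e. 0 < e \<and> e \<le> 1 \<longrightarrow>
       \<bar>(g x e - fps_nth (c x) 0) / e - (\<Sum>n<M. fps_nth (fps_shift 1 (c x)) n * e ^ n)\<bar> \<le> C * e ^ M)"
    by (intro iff_exI iff_allI imp_cong refl err) simp
  moreover have "(\<forall>n<Suc M. \<exists>B. \<forall>x. \<bar>fps_nth (c x) n\<bar> \<le> B) \<longleftrightarrow>
      (\<exists>B. \<forall>x. \<bar>fps_nth (c x) 0\<bar> \<le> B) \<and> (\<forall>n<M. \<exists>B. \<forall>x. \<bar>fps_nth (fps_shift 1 (c x)) n\<bar> \<le> B)"
    by (simp add: All_less_Suc2)
  ultimately show ?thesis unfolding unif_exp_def by (simp only: conj_assoc)
qed

lemma unif_exp_perturb: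
  assumes "unif_exp M g c" "\<And>x e. 0 < e \<Longrightarrow> e \<le> 1 \<Longrightarrow> \<bar>h x e - g x e\<bar> \<le> K * e ^ M"
  shows "unif_exp M h c"
proof -
  obtain C where C: "\<And>x e. 0 < e \<Longrightarrow> e \<le> 1 \<Longrightarrow> \<bar>g x e - (\<Sum>n<M. fps_nth (c x) n * e ^ n)\<bar> \<le> C * e ^ M"
    using assms(1) by (rule unif_exp_error) blast
  have "\<bar>h x e - (\<Sum>n<M. fps_nth (c x) n * e ^ n)\<bar> \<le> (K + C) * e ^ M" if "0 < e" "e \<le> 1" for x e
    using C[OF that, of x] assms(2)[OF that, of x] by (simp add: distrib_right) 
  then show ?thesis using assms(1) by (auto simp: unif_exp_def)
qed

lemma unif_exp_cong:
  assumes "unif_exp M g c" "\<And>x n. n < M \<Longrightarrow> fps_nth (c x) n = fps_nth (d x) n"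
  shows "unif_exp M g d"
proof -
  have "(\<Sum>n<M. fps_nth (c x) n * e ^ n) = (\<Sum>n<M. fps_nth (d x) n * e ^ n)" for x e
    by (rule sum.cong) (use assms(2) in auto)
  then show ?thesis using assms by (auto simp: unif_exp_def)
qed

lemma unif_exp_SucD: assumes "unif_exp (Suc M) g c" shows "unif_exp M g c"
proof -
  obtain B where B: "\<And>x. \<bar>fps_nth (c x) M\<bar> \<le> B" using assms by (rule unif_exp_coeff [where n = M]) auto
  obtain C where C: "\<And>x e. 0 < e \<Longrightarrow> e \<le> 1 \<Longrightarrow> \<bar>g x e - (\<Sum>n<Suc M. fps_nth (c x) n * e ^ n)\<bar> \<le> C * e ^ Suc M"
    using assms by (rule unif_exp_error) blast
  have "\<bar>g x e - (\<Sum>n<M. fps_nth (c x) n * e ^ n)\<bar> \<le> (\<bar>C\<bar> + B) * e ^ M" if e: "0 < e" "e \<le> 1" for x e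
  proof -
    have "\<bar>g x e - (\<Sum>n<M. fps_nth (c x) n * e ^ n)\<bar> \<le>
        \<bar>g x e - (\<Sum>n<Suc M. fps_nth (c x) n * e ^ n)\<bar> + \<bar>fps_nth (c x) M * e ^ M\<bar>"
      by simp
    also have "\<dots> \<le> C * e ^ Suc M + B * e ^ M"
      using C[OF e, of x] B[of x] e by (intro add_mono) (auto simp: abs_mult intro: mult_right_mono)
    also have "C * e ^ Suc M \<le> \<bar>C\<bar> * e ^ M"
      using e by (intro mult_mono power_decreasing) auto
    finally show ?thesis by (simp add: distrib_right)
  qed
  then show ?thesis using assms by (auto simp: unif_exp_def)
qed

lemma unif_exp_mono: "unif_exp M g c \<Longrightarrow> m \<le> M \<Longrightarrow> unif_exp m g c"
  by (induction M) (auto simp: le_Suc_eq dest: unif_exp_SucD)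

lemma unif_exp_add:
  assumes "unif_exp M g c" "unif_exp M h d"
  shows "unif_exp M (\<lambda>x e. g x e + h x e) (\<lambda>x. c x + d x)"
  unfolding unif_exp_def
proof (intro conjI allI impI)
  fix n assume "n < M"
  then obtain A B where A: "\<And>x. \<bar>fps_nth (c x) n\<bar> \<le> A" and B: "\<And>x. \<bar>fps_nth (d x) n\<bar> \<le> B"
    using assms unfolding unif_exp_def by meson
  have "\<bar>fps_nth (c x + d x) n\<bar> \<le> A + B" for x
    using A[of x] B[of x] by simp
  then show "\<exists>B. \<forall>x. \<bar>fps_nth (c x + d x) n\<bar> \<le> B" by blast
next
  obtain A where A: "\<And>x e. 0 < e \<Longrightarrow> e \<le> 1 \<Longrightarrow> \<bar>g x e - (\<Sum>n<M. fps_nth (c x) n * e ^ n)\<bar> \<le> A * e ^ M"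
    using assms(1) by (rule unif_exp_error) blast
  obtain B where B: "\<And>x e. 0 < e \<Longrightarrow> e \<le> 1 \<Longrightarrow> \<bar>h x e - (\<Sum>n<M. fps_nth (d x) n * e ^ n)\<bar> \<le> B * e ^ M"
    using assms(2) by (rule unif_exp_error) blast
  have "\<bar>g x e + h x e - (\<Sum>n<M. fps_nth (c x + d x) n * e ^ n)\<bar> \<le> (A + B) * e ^ M"
    if "0 < e" "e \<le> 1" for x e
    using A[OF that, of x] B[OF that, of x] by (simp add: distrib_right sum.distrib)
  then show "\<exists>C. \<forall>x e. 0 < e \<and> e \<le> 1 \<longrightarrow>
      \<bar>g x e + h x e - (\<Sum>n<M. fps_nth (c x + d x) n * e ^ n)\<bar> \<le> C * e ^ M" by blast
qed

lemma unif_exp_const: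
  assumes "\<exists>B. \<forall>x. \<bar>a x\<bar> \<le> B"
  shows "unif_exp M (\<lambda>x e. a x) (\<lambda>x. fps_const (a x))"
proof (cases M)
  case 0
  then show ?thesis using assms by (auto simp: unif_exp_0)
next
  case (Suc m)
  have "\<exists>B. \<forall>x. \<bar>fps_nth (fps_const (a x)) n\<bar> \<le> B" for n
    using assms by (cases "n = 0") auto
  moreover have "(\<Sum>n<Suc m. fps_nth (fps_const (a x)) n * e ^ n) = a x" for x e
    by (simp add: sum.lessThan_Suc_shift del: sum.lessThan_Suc)
  ultimately show ?thesis unfolding unif_exp_def Suc by (auto intro: exI[of _ 0])
qed

lemma unif_exp_zero: "unif_exp M (\<lambda>x e. 0) (\<lambda>x. 0)"
  unfolding unif_exp_def by (auto intro!: exI[of _ 0])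

lemma unif_exp_X: "unif_exp M (\<lambda>x e. e) (\<lambda>x. fps_X)"
proof (cases M)
  case 0
  then show ?thesis by (auto simp: unif_exp_0 intro: exI[of _ 1])
next
  case (Suc m)
  have "(\<lambda>x. fps_shift 1 fps_X) = (\<lambda>x::real. fps_const (1 :: real))"
    by (auto simp: fps_eq_iff fps_X_def)
  moreover have "unif_exp m (\<lambda>x e. e / e) (\<lambda>x. fps_const 1)"
    by (rule unif_exp_perturb[OF unif_exp_const[of "\<lambda>_. 1"], where K = 0]) auto
  moreover have "\<exists>B::real. \<forall>x::real. \<bar>fps_nth fps_X 0\<bar> \<le> B" by (rule exI[of _ 0]) simp
  ultimately show ?thesis unfolding Suc unif_exp_Suc by simp
qed

lemma unif_exp_mult:
  assumes "unif_exp M g c" "unif_exp M h d"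
  shows "unif_exp M (\<lambda>x e. g x e * h x e) (\<lambda>x. c x * d x)"
  using assms
proof (induction M arbitrary: g c h d)
  case 0
  then obtain A B where A: "\<And>x e. 0 < e \<Longrightarrow> e \<le> 1 \<Longrightarrow> \<bar>g x e\<bar> \<le> A"
    and B: "\<And>x e. 0 < e \<Longrightarrow> e \<le> 1 \<Longrightarrow> \<bar>h x e\<bar> \<le> B"
    unfolding unif_exp_0 by blast
  have "\<bar>g x e * h x e\<bar> \<le> A * B" if "0 < e" "e \<le> 1" for x e
    unfolding abs_mult using A[OF that, of x] B[OF that, of x] by (intro mult_mono) auto
  then show ?case unfolding unif_exp_0 by blast
next
  case (Suc M)
  let ?sh = "fps_shift 1 :: real fps \<Rightarrow> real fps"
  have bc: "\<exists>B. \<forall>x. \<bar>fps_nth (c x) 0\<bar> \<le> B" and bd: "\<exists>B. \<forall>x. \<bar>fps_nth (d x) 0\<bar> \<le> B"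
    and g: "unif_exp M (\<lambda>x e. (g x e - fps_nth (c x) 0) / e) (\<lambda>x. ?sh (c x))"
    and h: "unif_exp M (\<lambda>x e. (h x e - fps_nth (d x) 0) / e) (\<lambda>x. ?sh (d x))"
    using Suc.prems unfolding unif_exp_Suc by auto
  have 1: "unif_exp M (\<lambda>x e. (g x e - fps_nth (c x) 0) / e * h x e + fps_nth (c x) 0 * ((h x e - fps_nth (d x) 0) / e))
     (\<lambda>x. ?sh (c x) * d x + fps_const (fps_nth (c x) 0) * ?sh (d x))"
    by (intro unif_exp_add Suc.IH unif_exp_const g h bc unif_exp_SucD[OF Suc.prems(2)])
  have 2: "?sh (u * v) = ?sh u * v + fps_const (fps_nth u 0) * ?sh v" for u v :: "real fps"
  proof (rule fps_ext)
    fix n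
    show "fps_nth (?sh (u * v)) n = fps_nth (?sh u * v + fps_const (fps_nth u 0) * ?sh v) n"
    proof -
      have "fps_nth (u * v) (Suc n) = (\<Sum>i=0..Suc n. fps_nth u i * fps_nth v (Suc n - i))"
        by (rule fps_mult_nth)
      also have "\<dots> = fps_nth u 0 * fps_nth v (Suc n) + (\<Sum>i=0..n. fps_nth u (Suc i) * fps_nth v (n - i))"
        by (subst sum.atLeast0_atMost_Suc_shift) simp
      finally show ?thesis
        by (simp add: fps_mult_nth[of "fps_shift (Suc 0) u"])
    qed
  qed
  have "unif_exp M (\<lambda>x e. (g x e * h x e - fps_nth (c x * d x) 0) / e) (\<lambda>x. ?sh (c x * d x))"
    unfolding 2
    by (rule unif_exp_perturb[OF 1, where K = 0]) (simp add: diff_divide_distrib algebra_simps)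
  moreover obtain A B where A: "\<And>x. \<bar>fps_nth (c x) 0\<bar> \<le> A" and B: "\<And>x. \<bar>fps_nth (d x) 0\<bar> \<le> B"
    using bc bd by auto
  have "\<bar>fps_nth (c x * d x) 0\<bar> \<le> A * B" for x
    unfolding fps_mult_nth_0 abs_mult using A[of x] B[of x] by (intro mult_mono) auto
  ultimately show ?case unfolding unif_exp_Suc by blast
qed

lemma unif_exp_power: "unif_exp M g c \<Longrightarrow> unif_exp M (\<lambda>x e. g x e ^ k) (\<lambda>x. c x ^ k)"
proof (induction k)
  case 0
  have "\<exists>B. \<forall>x::real. \<bar>1::real\<bar> \<le> B" by (rule exI[of _ 1]) simp
  from unif_exp_const[OF this] show ?case by simp
next
  case (Suc k)
  then show ?case using unif_exp_mult[of M g c "\<lambda>x e. g x e ^ k"] by simp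
qed

lemma unif_exp_sum:
  "(\<And>i. i \<in> I \<Longrightarrow> unif_exp M (g i) (c i)) \<Longrightarrow> unif_exp M (\<lambda>x e. \<Sum>i\<in>I. g i x e) (\<lambda>x. \<Sum>i\<in>I. c i x)"
proof (induction I rule: infinite_finite_induct)
  case (insert i I)
  then show ?case using unif_exp_add[of M "g i" "c i" "\<lambda>x e. \<Sum>i\<in>I. g i x e"] by simp
qed (simp_all add: unif_exp_zero)

text \<open>
  Taylor's formula at \<open>x\<close> with remainder \<open>O(|\<delta>|^M) = O(e^M)\<close>; the Taylor polynomial is an algebraic
  expression in \<open>\<delta>\<close>, whose expansion agrees with the formal composition up to order \<open>M\<close>.
\<close>

lemma unif_exp_subst:
  assumes f: "admissible f" and d: "unif_exp M \<delta> d" and d0: "\<And>x. fps_nth (d x) 0 = 0"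
  shows "unif_exp M (\<lambda>x e. f (x + \<delta> x e))
    (\<lambda>x. fps_compose (Abs_fps (\<lambda>n. (deriv ^^ n) f x / fact n)) (d x))"
proof (cases M)
  case 0
  then show ?thesis using f by (auto simp: unif_exp_0 admissible_def)
next
  case (Suc m)
  have "unif_exp 1 \<delta> d" using d Suc unif_exp_mono by force
  then obtain K where K: "\<And>x e. 0 < e \<Longrightarrow> e \<le> 1 \<Longrightarrow> \<bar>\<delta> x e\<bar> \<le> K * e"
    by (auto simp: unif_exp_def d0)
  have K0: "K \<ge> 0" using K[of 1 0] by auto
  obtain C where C: "C \<ge> 0" "\<And>x h. \<bar>f (x + h) - (\<Sum>n<M. (deriv ^^ n) f x / fact n * h ^ n)\<bar> \<le> C * \<bar>h\<bar> ^ M"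
    using admissible_taylor[OF f] by blast
  have bd: "\<exists>B. \<forall>x. \<bar>(deriv ^^ n) f x / fact n\<bar> \<le> B" for n
  proof -
    obtain B where "\<forall>x. \<bar>(deriv ^^ n) f x\<bar> \<le> B" using admissible_deriv_bounded[OF f] by blast
    then show ?thesis by (intro exI[of _ "B / fact n"]) (simp add: divide_right_mono)
  qed
  have "unif_exp M (\<lambda>x e. \<Sum>n<M. (deriv ^^ n) f x / fact n * \<delta> x e ^ n)
      (\<lambda>x. \<Sum>n<M. fps_const ((deriv ^^ n) f x / fact n) * d x ^ n)"
    by (intro unif_exp_sum unif_exp_mult unif_exp_const bd unif_exp_power d)
  then have "unif_exp M (\<lambda>x e. f (x + \<delta> x e))
      (\<lambda>x. \<Sum>n<M. fps_const ((deriv ^^ n) f x / fact n) * d x ^ n)"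
  proof (rule unif_exp_perturb)
    fix x e :: real assume e: "0 < e" "e \<le> 1"
    have "\<bar>f (x + \<delta> x e) - (\<Sum>n<M. (deriv ^^ n) f x / fact n * \<delta> x e ^ n)\<bar> \<le> C * \<bar>\<delta> x e\<bar> ^ M"
      by (rule C)
    also have "\<dots> \<le> C * (K * e) ^ M"
      using K[OF e, of x] C(1) by (intro mult_left_mono power_mono) auto
    finally show "\<bar>f (x + \<delta> x e) - (\<Sum>n<M. (deriv ^^ n) f x / fact n * \<delta> x e ^ n)\<bar> \<le> C * K ^ M * e ^ M"
      by (simp add: power_mult_distrib)
  qed
  then show ?thesis
  proof (rule unif_exp_cong)
    fix x n assume n: "n < M"
    have "fps_nth (fps_compose (Abs_fps (\<lambda>n. (deriv ^^ n) f x / fact n)) (d x)) n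
        = (\<Sum>i=0..n. (deriv ^^ i) f x / fact i * fps_nth (d x ^ i) n)"
      by (simp add: fps_compose_nth)
    also have "\<dots> = (\<Sum>i<M. (deriv ^^ i) f x / fact i * fps_nth (d x ^ i) n)"
      using n d0 by (intro sum.mono_neutral_left) (auto simp: startsby_zero_power_prefix)
    finally show "fps_nth (\<Sum>i<M. fps_const ((deriv ^^ i) f x / fact i) * d x ^ i) n =
      fps_nth (fps_compose (Abs_fps (\<lambda>n. (deriv ^^ n) f x / fact n)) (d x)) n"
      by (simp add: fps_sum_nth)
  qed
qed

section \<open>The formal identity as a recursion\<close>

definition taylor_comp :: "(real \<Rightarrow> real) \<Rightarrow> real \<Rightarrow> real fps \<Rightarrow> real fps" where
  "taylor_comp f x d = fps_compose (Abs_fps (\<lambda>n. (deriv ^^ n) f x / fact n)) d"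

definition incr :: "(nat \<Rightarrow> real \<Rightarrow> real) \<Rightarrow> real \<Rightarrow> real fps" where
  "incr q x = Abs_fps (\<lambda>k. if k \<ge> 2 then q k x else 0)"

lemma taylor_comp_nth:
  "fps_nth (taylor_comp f x d) n = (\<Sum>i=0..n. (deriv ^^ i) f x / fact i * fps_nth (d ^ i) n)"
  by (simp add: taylor_comp_def fps_compose_nth)

lemma incr_nth: "fps_nth (incr q x) k = (if k \<ge> 2 then q k x else 0)"
  by (simp add: incr_def)

lemma fps_subst_Theta: "fps_subst f (Theta q x) = taylor_comp f x (incr q x)"
  by (simp add: fps_subst_def Theta_def taylor_comp_def incr_def)

lemma taylor_comp_cong:
  assumes "\<And>i. i \<le> n \<Longrightarrow> fps_nth d i = fps_nth e i"
  shows "fps_nth (taylor_comp f x d) n = fps_nth (taylor_comp f x e) n"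
proof -
  have "\<forall>m\<le>n. fps_nth (d ^ i) m = fps_nth (e ^ i) m" for i
  proof (induction i)
    case (Suc i)
    show ?case
      unfolding power_Suc fps_mult_nth
      by (intro allI impI sum.cong refl arg_cong2[where f = "(*)"]) (use assms Suc in auto)
  qed simp
  then show ?thesis by (simp add: taylor_comp_nth)
qed

text \<open>
  The coefficient of \<open>a^(-k)\<close> of \<open>arctan \<Theta> - \<Sum> L\<^sub>s(\<Theta>) / a^s\<close>. The term \<open>a \<Theta>\<close> of the formal identity contributes
  \<open>q\<^sub>k\<^sub>+\<^sub>1\<close> to the same power.
\<close>

definition rec_rhs :: "(nat \<Rightarrow> real \<Rightarrow> real) \<Rightarrow> real \<Rightarrow> nat \<Rightarrow> real" where
  "rec_rhs q x k = fps_nth (taylor_comp arctan x (incr q x)) k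
     - (\<Sum>s<k. fps_nth (taylor_comp (L (Suc s)) x (incr q x)) (k - Suc s))"

text \<open>
  Only \<open>q\<^sub>2, \<dots>, q\<^sub>k\<close> enter, so that the formal identity determines \<open>q\<^sub>k\<^sub>+\<^sub>1\<close> from its predecessors.
\<close>

lemma rec_rhs_cong:
  assumes "\<And>i. 2 \<le> i \<Longrightarrow> i \<le> k \<Longrightarrow> q i x = r i x"
  shows "rec_rhs q x k = rec_rhs r x k"
  unfolding rec_rhs_def
  by (intro arg_cong2[where f = "(-)"] sum.cong refl taylor_comp_cong) (use assms in \<open>auto simp: incr_nth\<close>)

lemma suminf_shifted_fps:
  fixes F :: "nat \<Rightarrow> real fps"
  shows "fps_nth (\<Sum>s. fps_X ^ Suc s * F s) n = (\<Sum>s<n. fps_nth (F s) (n - Suc s))"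
proof -
  define S where "S = Abs_fps (\<lambda>n. \<Sum>s<n. fps_nth (F s) (n - Suc s))"
  have "(\<lambda>s. fps_X ^ Suc s * F s) sums S"
    unfolding sums_def
  proof (rule tendsto_fpsI)
    fix n
    have "fps_nth (\<Sum>s<N. fps_X ^ Suc s * F s) n = fps_nth S n" if "N \<ge> n" for N
    proof -
      have "fps_nth (\<Sum>s<N. fps_X ^ Suc s * F s) n =
          (\<Sum>s<N. if n < Suc s then 0 else fps_nth (F s) (n - Suc s))"
        by (simp add: fps_sum_nth fps_X_power_mult_nth del: power_Suc)
      also have "\<dots> = (\<Sum>s<n. fps_nth (F s) (n - Suc s))"
        using that by (intro sum.mono_neutral_cong_right) auto
      finally show ?thesis by (simp add: S_def)
    qed
    then show "eventually (\<lambda>N. fps_nth (\<Sum>s<N. fps_X ^ Suc s * F s) n = fps_nth S n) sequentially"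
      by (auto simp: eventually_sequentially)
  qed
  then have "(\<Sum>s. fps_X ^ Suc s * F s) = S" by (rule sums_unique[symmetric])
  then show ?thesis by (simp add: S_def)
qed

lemma taylor_comp_nth_0 [simp]: "fps_nth (taylor_comp f x d) 0 = f x"
  by (simp add: taylor_comp_nth)

text \<open>
  In powers of \<open>1 / a\<close> the term \<open>a \<Theta>\<close> is shifted down by one. At the exponents -1 and 0 the identity
  reads \<open>x = x\<close> and \<open>arctan x = arctan x\<close>; the information starts at \<open>k = 1\<close>.
\<close>

lemma formal_identity_iff:
  "formal_identity q x \<longleftrightarrow> (\<forall>k\<ge>1. q (Suc k) x = rec_rhs q x k)"
proof -
  define P where "P = taylor_comp arctan x (incr q x)"
  define S where "S = (\<Sum>s. fps_X ^ Suc s * taylor_comp (L (Suc s)) x (incr q x))"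
  have S: "fps_nth S n = (\<Sum>s<n. fps_nth (taylor_comp (L (Suc s)) x (incr q x)) (n - Suc s))" for n
    unfolding S_def by (rule suminf_shifted_fps)
  have Th: "fps_nth (Theta q x) n = (if n = 0 then x else fps_nth (incr q x) n)" for n
    by (auto simp: Theta_def incr_def)
  have c: "fls_nth (fls_X_inv * fps_to_fls (Theta q x) - fps_to_fls P + fps_to_fls S) j
      = (if j = -1 then x else if j < -1 then 0
         else fps_nth (incr q x) (Suc (nat j)) - fps_nth P (nat j) + fps_nth S (nat j))" for j :: int
    by (auto simp: fls_X_inv_times_conv_shift Th nat_add_distrib)
  have r: "fls_nth (fls_X_inv * fls_const x - fls_const (arctan x)) j
      = (if j = -1 then x else if j = 0 then - arctan x else 0)" for j :: int
    by (auto simp: fls_X_inv_times_conv_shift)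
  have "formal_identity q x \<longleftrightarrow> (\<forall>j. fls_nth (fls_X_inv * fps_to_fls (Theta q x) - fps_to_fls P + fps_to_fls S) j
      = fls_nth (fls_X_inv * fls_const x - fls_const (arctan x)) j)"
    unfolding formal_identity_def fps_subst_Theta P_def S_def fls_eq_iff ..
  also have "\<dots> \<longleftrightarrow> (\<forall>k. fps_nth (incr q x) (Suc k) - fps_nth P k + fps_nth S k = (if k = 0 then - arctan x else 0))"
    unfolding c r
  proof safe
    fix k
    assume *: "\<forall>j. (if j = -1 then x else if j < -1 then 0
         else fps_nth (incr q x) (Suc (nat j)) - fps_nth P (nat j) + fps_nth S (nat j))
       = (if j = -1 then x else if j = 0 then - arctan x else 0)"
    show "fps_nth (incr q x) (Suc k) - fps_nth P k + fps_nth S k = (if k = 0 then - arctan x else 0)"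
      using *[rule_format, of "int k"] by simp
  next
    fix j :: int
    assume *: "\<forall>k. fps_nth (incr q x) (Suc k) - fps_nth P k + fps_nth S k = (if k = 0 then - arctan x else 0)"
    show "(if j = -1 then x else if j < -1 then 0
         else fps_nth (incr q x) (Suc (nat j)) - fps_nth P (nat j) + fps_nth S (nat j))
       = (if j = -1 then x else if j = 0 then - arctan x else 0)"
      using *[rule_format, of "nat j"] by auto
  qed
  also have "\<dots> \<longleftrightarrow> (\<forall>k\<ge>1. q (Suc k) x = rec_rhs q x k)"
  proof -
    have "fps_nth (incr q x) (Suc k) - fps_nth P k + fps_nth S k = (if k = 0 then - arctan x else 0)
       \<longleftrightarrow> (k \<ge> 1 \<longrightarrow> q (Suc k) x = rec_rhs q x k)" for k
      by (cases k) (auto simp: S P_def rec_rhs_def incr_nth)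
    then show ?thesis by (simp only:)
  qed
  finally show ?thesis .
qed

text \<open>
  The conditional inside the abstraction makes the recursion visibly well-founded; by
  \<open>rec_rhs_cong\<close> it does not change the value.
\<close>

function qcoeff :: "nat \<Rightarrow> real \<Rightarrow> real" where
  "qcoeff k x = (if k < 2 then 0 else rec_rhs (\<lambda>i y. if i < k then qcoeff i y else 0) x (k - 1))"
  by auto
termination by (relation "Wellfounded.measure fst") auto

declare qcoeff.simps [simp del]

lemma qcoeff_rec: "k \<ge> 1 \<Longrightarrow> qcoeff (Suc k) x = rec_rhs qcoeff x k"
  by (subst qcoeff.simps) (auto intro!: rec_rhs_cong)

lemma is_coeff_family_qcoeff: "is_coeff_family qcoeff"
  unfolding is_coeff_family_def formal_identity_iff
  using qcoeff_rec by (auto simp: qcoeff.simps[of 0] qcoeff.simps[of "Suc 0"] less_2_cases_iff)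

lemma is_coeff_family_unique:
  assumes "is_coeff_family q" shows "q = qcoeff"
proof (intro ext)
  fix k x
  show "q k x = qcoeff k x"
  proof (induction k rule: less_induct)
    case (less k)
    show ?case
    proof (cases "k < 2")
      case True
      then show ?thesis using assms is_coeff_family_qcoeff by (simp add: is_coeff_family_def)
    next
      case False
      then obtain j where j: "k = Suc j" "j \<ge> 1" by (cases k) auto
      have "q k x = rec_rhs q x j"
        using assms j unfolding is_coeff_family_def formal_identity_iff by blast
      also have "\<dots> = rec_rhs qcoeff x j"
        by (rule rec_rhs_cong) (use less j in auto)
      finally show ?thesis using j qcoeff_rec by simp
    qed
  qed
qed

lemma qf_eq_qcoeff: "qf = qcoeff"
  unfolding qf_def using is_coeff_family_qcoeff is_coeff_family_unique by (rule the_equality)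

lemma L_rat_null: "L (Suc s) \<in> rat_null"
proof -
  have "[:0, 1:] dvd logampl (Suc s)" using logampl_roots[of "Suc s"] poly_eq_0_iff_dvd[of "logampl (Suc s)" 0] by simp
  then obtain r where r: "logampl (Suc s) = [:0, 1:] * r" by (elim dvdE)
  define t where "t x = 1 / (1 + \<i> * of_real x)" for x :: real
  have t: "Re (t x) = 1 / (1 + x^2)" "Im (t x) = - 1 * (x / (1 + x^2))" for x
    by (simp_all add: t_def Re_divide Im_divide)
  have "L (Suc s) = (\<lambda>x. 1 / (1 + x^2) * Im (poly r (t x)) + (- 1 * (x / (1 + x^2))) * Re (poly r (t x)))"
    by (rule ext) (simp add: L_eq r t flip: t_def)
  also have "\<dots> \<in> rat_null"
    unfolding t_def using poly_inv_rat_bdd[of r]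
    by (intro rat_null_add rat_null_mult' rat_null_inv rat_null_cmult rat_null_xinv) auto
  finally show ?thesis .
qed

lemma L_0: "L (Suc s) 0 = 0"
  using logampl_roots[of "Suc s"] by (simp add: L_eq)

lemma incr_power_rat_bdd:
  assumes "\<And>i. 2 \<le> i \<Longrightarrow> i \<le> n \<Longrightarrow> q i \<in> rat_null" "m \<le> n"
  shows "(\<lambda>x. fps_nth (incr q x ^ j) m) \<in> rat_bdd"
  using assms(2)
proof (induction j arbitrary: m)
  case 0
  show ?case by (simp add: rat_bdd.const)
next
  case (Suc j)
  have sum: "(\<lambda>x. \<Sum>i\<in>A. f i x) \<in> rat_bdd" if "\<And>i. i \<in> A \<Longrightarrow> f i \<in> rat_bdd" for A and f :: "nat \<Rightarrow> real \<Rightarrow> real"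
    using that
  proof (induction A rule: infinite_finite_induct)
    case (insert i I)
    then show ?case using rat_bdd.add[of "f i" "\<lambda>x. \<Sum>i\<in>I. f i x"] by simp
  qed (simp_all add: rat_bdd.const)
  have "(\<lambda>x. fps_nth (incr q x) i) \<in> rat_bdd" if "i \<le> n" for i
    using assms(1)[of i] that by (cases "2 \<le> i") (simp_all add: incr_nth rat_bdd.const rat_null_imp_bdd)
  then show ?case
    unfolding power_Suc fps_mult_nth using Suc by (intro sum rat_bdd.mult) auto
qed

text \<open>
  Every term contains a derivative of \<open>f\<close> of positive order, which vanishes at infinity even for
  \<open>arctan\<close>; the only exception is the constant coefficient, hence the case distinction on \<open>n\<close>.
\<close>

lemma taylor_comp_rat_null:
  assumes "admissible f" "n = 0 \<Longrightarrow> f \<in> rat_null" "\<And>i. 2 \<le> i \<Longrightarrow> i \<le> n \<Longrightarrow> q i \<in> rat_null"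
  shows "(\<lambda>x. fps_nth (taylor_comp f x (incr q x)) n) \<in> rat_null"
  unfolding taylor_comp_nth
proof (rule rat_null_sum)
  fix i assume "i \<in> {0..n}"
  have pw: "(\<lambda>x. fps_nth (incr q x ^ i) n) \<in> rat_bdd"
    by (rule incr_power_rat_bdd[OF assms(3)]) auto
  show "(\<lambda>x. (deriv ^^ i) f x / fact i * fps_nth (incr q x ^ i) n) \<in> rat_null"
  proof (cases i)
    case 0
    then show ?thesis using assms(2) by (cases "n = 0") (auto simp: rat_null_0)
  next
    case (Suc j)
    then have "(deriv ^^ i) f \<in> rat_null" using admissible_deriv[OF assms(1), of j] by simp
    then have "(\<lambda>x. 1 / fact i * (deriv ^^ i) f x) \<in> rat_null" by (rule rat_null_cmult)
    from rat_null_mult'[OF this pw] show ?thesis by simp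
  qed
qed

lemma admissible_L: "admissible (L (Suc s))"
  by (rule admissible_rat_bdd[OF rat_null_imp_bdd[OF L_rat_null]])

lemma qcoeff_rat_null: "qcoeff k \<in> rat_null"
proof (induction k rule: less_induct)
  case (less k)
  show ?case
  proof (cases "k < 2")
    case True
    then have "qcoeff k = (\<lambda>x. 0)" by (intro ext) (simp add: qcoeff.simps)
    then show ?thesis by (simp add: rat_null_0)
  next
    case False
    then obtain j where j: "k = Suc j" "j \<ge> 1" by (cases k) auto
    have "qcoeff k = (\<lambda>x. rec_rhs qcoeff x j)" using j qcoeff_rec by (intro ext) simp
    also have "\<dots> \<in> rat_null"
      unfolding rec_rhs_def
      by (intro rat_null_diff rat_null_sum taylor_comp_rat_null admissible_arctan admissible_L L_rat_null less) (use j in auto)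
    finally show ?thesis .
  qed
qed

lemma qcoeff_0: "qcoeff k 0 = 0"
proof (induction k rule: less_induct)
  case (less k)
  show ?case
  proof (cases "k < 2")
    case False
    then obtain j where j: "k = Suc j" "j \<ge> 1" by (cases k) auto
    have "qcoeff k 0 = rec_rhs qcoeff 0 j" using j qcoeff_rec by simp
    also have "\<dots> = rec_rhs (\<lambda>_ _. 0) 0 j"
      by (rule rec_rhs_cong) (use less j in auto)
    also have "\<dots> = 0"
    proof -
      have i: "incr (\<lambda>_ _. 0) 0 = 0" by (rule fps_ext) (simp add: incr_nth)
      have t: "fps_nth (taylor_comp f 0 0) n = (if n = 0 then f 0 else 0)" for f n
        by (simp add: taylor_comp_def)
      show ?thesis using j unfolding rec_rhs_def i t by (auto simp: L_0 intro!: sum.neutral)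
    qed
    finally show ?thesis .
  qed (simp add: qcoeff.simps)
qed

section \<open>The first coefficients\<close>

lemma ampl_values:
  "ampl (Suc 0) = [:0, 1, -1:]"
  "ampl (Suc (Suc 0)) = [:0, 0, 2, -5, 3:]"
  "ampl (Suc (Suc (Suc 0))) = [:0, 0, 0, 6, -26, 35, -15:]"
  "ampl (Suc (Suc (Suc (Suc 0)))) = [:0, 0, 0, 0, 24, -154, 340, -315, 105:]"
  by (simp_all add: tau_def pderiv_pCons one_pCons)

lemma logampl_values:
  "logampl 2 = [:0, 0, 3/2, -4, 5/2:]"
  "logampl 3 = [:0, 0, 0, 13/3, -20, 28, -37/3:]"
  "logampl 4 = [:0, 0, 0, 0, 71/4, -120, 274, -260, 353/4:]"
proof -
  have s: "{Suc 0..<2} = {1::nat}" "{Suc 0..<3} = {1, 2::nat}" "{Suc 0..<4} = {1, 2, 3::nat}" by auto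
  note u = ampl_values[folded numeral_2_eq_2 numeral_3_eq_3]
  have u4: "ampl 4 = [:0, 0, 0, 0, 24, -154, 340, -315, 105:]"
    using ampl_values(4) by (simp add: eval_nat_numeral)
  show 2: "logampl 2 = [:0, 0, 3/2, -4, 5/2:]"
    by (subst logampl.simps) (simp add: s logampl_1 tau_def u(1,2) del: ampl.simps)
  show 3: "logampl 3 = [:0, 0, 0, 13/3, -20, 28, -37/3:]"
    by (subst logampl.simps) (simp add: s logampl_1 2 tau_def u(1,2,3) del: ampl.simps)
  show 4: "logampl 4 = [:0, 0, 0, 0, 71/4, -120, 274, -260, 353/4:]"
    by (subst logampl.simps) (simp add: s logampl_1 2 3 tau_def u(1,2,3) u4 del: ampl.simps)
qed

text \<open>
  With \<open>u = 1 + \<i>x\<close> and its conjugate \<open>v\<close>, the polynomial in \<open>1 / u\<close> becomes a fraction with denominator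
  \<open>(u v)^m = (1 + x\<^sup>2)^m\<close>.
\<close>

lemma L_values:
  "L 1 x = x * (1 - x^2) / (1 + x^2)^2"
  "L 2 x = (- x + 12 * x^3 - 7 * x^5) / (1 + x^2)^4"
  "L 3 x = (x - 184/3 * x^3 + 220 * x^5 - 108 * x^7 + 13/3 * x^9) / (1 + x^2)^6"
  "L 4 x = (- x + 241 * x^3 - 2732 * x^5 + 5600 * x^7 - 2531 * x^9 + 191 * x^11) / (1 + x^2)^8"
proof -
  define u v where "u = Complex 1 x" and "v = Complex 1 (- x)"
  have u: "u \<noteq> 0" "1 + \<i> * of_real x = u" by (auto simp: u_def complex_eq_iff)
  have uv: "u * v = of_real (1 + x^2)" by (simp add: u_def v_def complex_eq_iff power2_eq_square)
  have quot: "Im (A / u ^ m) = Im (A * v ^ m) / (1 + x^2) ^ m" for A m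
  proof -
    have v: "v \<noteq> 0" by (auto simp: v_def complex_eq_iff)
    have "A / u ^ m = A * v ^ m / (u * v) ^ m" using u v by (simp add: power_mult_distrib)
    then show ?thesis unfolding uv by (metis Im_divide_of_real of_real_power)
  qed
  have u_pow: "u^2 = Complex (1 - x^2) (2 * x)" "u^3 = Complex (1 - 3 * x^2) (3 * x - x^3)"
    "u^4 = Complex (1 - 6 * x^2 + x^4) (4 * x - 4 * x^3)"
    by (simp_all add: u_def complex_eq_iff eval_nat_numeral algebra_simps)
  have v2: "v^2 = Complex (1 - x^2) (- 2 * x)" and v4: "v^4 = Complex (1 - 6 * x^2 + x^4) (- 4 * x + 4 * x^3)"
    by (simp_all add: v_def complex_eq_iff eval_nat_numeral algebra_simps)
  have v6: "v^6 = Complex (1 - 15 * x^2 + 15 * x^4 - x^6) (- 6 * x + 20 * x^3 - 6 * x^5)"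
  proof -
    have "v^6 = v^4 * v^2" by (simp flip: power_add)
    then show ?thesis unfolding v2 v4 by (simp add: complex_eq_iff eval_nat_numeral algebra_simps)
  qed
  have v8: "v^8 = Complex (1 - 28 * x^2 + 70 * x^4 - 28 * x^6 + x^8) (- 8 * x + 56 * x^3 - 56 * x^5 + 8 * x^7)"
  proof -
    have "v^8 = v^4 * v^4" by (simp flip: power_add)
    then show ?thesis unfolding v4 by (simp add: complex_eq_iff eval_nat_numeral algebra_simps)
  qed
  have p1: "poly (logampl 1) (1 / u) = (u - 1) / u^2"
    using u(1) by (simp add: logampl_1 tau_def divide_simps power2_eq_square algebra_simps)
  have p2: "poly (logampl 2) (1 / u) = (3/2 * u^2 - 4 * u + 5/2) / u^4"
    using u(1) by (simp add: logampl_values divide_simps) (simp add: eval_nat_numeral algebra_simps)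
  have p3: "poly (logampl 3) (1 / u) = (13/3 * u^3 - 20 * u^2 + 28 * u - 37/3) / u^6"
    using u(1) by (simp add: logampl_values divide_simps) (simp add: eval_nat_numeral algebra_simps)
  have p4: "poly (logampl 4) (1 / u) = (71/4 * u^4 - 120 * u^3 + 274 * u^2 - 260 * u + 353/4) / u^8"
    using u(1) by (simp add: logampl_values divide_simps) (simp add: eval_nat_numeral algebra_simps)
  have L: "L s x = Im (poly (logampl s) (1 / u))" if "s > 0" for s
    using L_eq[of "s - 1" x] that u by simp
  show "L 1 x = x * (1 - x^2) / (1 + x^2)^2"
  proof -
    have "L 1 x = Im (poly (logampl 1) (1 / u))" by (rule L) simp
    then show ?thesis unfolding p1 quot v2 by (simp add: u_def algebra_simps)
  qed
  show "L 2 x = (- x + 12 * x^3 - 7 * x^5) / (1 + x^2)^4"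
  proof -
    have "L 2 x = Im (poly (logampl 2) (1 / u))" by (rule L) simp
    then show ?thesis unfolding p2 quot unfolding v4 u_pow
      by (elim trans, intro arg_cong[where f = "\<lambda>a. a / (1 + x^2)^4"])
        (simp add: u_def eval_nat_numeral field_simps)
  qed
  show "L 3 x = (x - 184/3 * x^3 + 220 * x^5 - 108 * x^7 + 13/3 * x^9) / (1 + x^2)^6"
  proof -
    have "L 3 x = Im (poly (logampl 3) (1 / u))" by (rule L) simp
    then show ?thesis unfolding p3 quot unfolding v6 u_pow
      by (elim trans, intro arg_cong[where f = "\<lambda>a. a / (1 + x^2)^6"])
        (simp add: u_def eval_nat_numeral field_simps)
  qed
  show "L 4 x = (- x + 241 * x^3 - 2732 * x^5 + 5600 * x^7 - 2531 * x^9 + 191 * x^11) / (1 + x^2)^8"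
  proof -
    have "L 4 x = Im (poly (logampl 4) (1 / u))" by (rule L) simp
    then show ?thesis unfolding p4 quot unfolding v8 u_pow
      by (elim trans, intro arg_cong[where f = "\<lambda>a. a / (1 + x^2)^8"])
        (simp add: u_def eval_nat_numeral field_simps)
  qed
qed

text \<open>
  \<open>d\<close> starts at order 2, so that \<open>d^i\<close> starts at order \<open>2 i\<close>.
\<close>

lemma taylor_comp_low:
  assumes "fps_nth d 0 = 0" "fps_nth d 1 = 0"
  shows "fps_nth (taylor_comp f x d) 1 = 0"
    "fps_nth (taylor_comp f x d) 2 = deriv f x * fps_nth d 2"
    "fps_nth (taylor_comp f x d) 3 = deriv f x * fps_nth d 3"
    "fps_nth (taylor_comp f x d) 4 = deriv f x * fps_nth d 4 + deriv (deriv f) x / 2 * (fps_nth d 2)^2"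
proof -
  define e where "e = fps_shift 2 d"
  have d: "d = fps_X^2 * e"
  proof (rule fps_ext)
    fix n
    show "fps_nth d n = fps_nth (fps_X^2 * e) n"
    proof (cases "n < 2")
      case True
      then show ?thesis using assms by (auto simp: less_2_cases_iff fps_X_power_mult_nth)
    next
      case False
      then obtain m where "n = m + 2" using le_Suc_ex[of 2 n] by (auto simp: not_less add.commute)
      then show ?thesis by (simp add: e_def fps_X_power_mult_nth)
    qed
  qed
  have pw: "fps_nth (d ^ i) n = (if n < 2 * i then 0 else fps_nth (e ^ i) (n - 2 * i))" for i n
    unfolding d power_mult_distrib power_mult[symmetric] by (simp add: fps_X_power_mult_nth)
  have e: "fps_nth e n = fps_nth d (n + 2)" for n by (simp add: e_def)
  have s: "{0..1} = {0, 1::nat}" "{0..2} = {0, 1, 2::nat}" "{0..3} = {0, 1, 2, 3::nat}" "{0..4} = {0, 1, 2, 3, 4::nat}"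
    by auto
  show "fps_nth (taylor_comp f x d) 1 = 0"
    "fps_nth (taylor_comp f x d) 2 = deriv f x * fps_nth d 2"
    "fps_nth (taylor_comp f x d) 3 = deriv f x * fps_nth d 3"
    "fps_nth (taylor_comp f x d) 4 = deriv f x * fps_nth d 4 + deriv (deriv f) x / 2 * (fps_nth d 2)^2"
    by (simp_all only: taylor_comp_nth s pw)
      (simp_all add: e eval_nat_numeral)
qed

lemma qcoeff_explicit:
  "qcoeff 2 x = x * (x^2 - 1) / (x^2 + 1)^2"
  "qcoeff 3 x = 4 * x^3 * (2 * x^2 - 3) / (x^2 + 1)^4"
  "qcoeff 4 x = - (2 * x^3 * (8 * x^6 - 183 * x^4 + 336 * x^2 - 65) / (3 * (x^2 + 1)^6))"
  "qcoeff 5 x = - (x^3 * (679 * x^8 - 8384 * x^6 + 17226 * x^4 - 7168 * x^2 + 431) / (3 * (x^2 + 1)^8))"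
proof -
  define y where "y = 1 + x^2"
  have y: "y \<noteq> 0" "x^2 + 1 = y" by (simp_all add: y_def)
  have d0: "fps_nth (incr qcoeff x) 0 = 0" "fps_nth (incr qcoeff x) 1 = 0" by (simp_all add: incr_nth)
  have A1: "deriv arctan = (\<lambda>x. 1 / (1 + x^2))"
    by (rule ext) (metis DERIV_imp_deriv DERIV_arctan inverse_eq_divide)
  have A2: "deriv (\<lambda>x::real. 1 / (1 + x^2)) x = - 2 * x / (1 + x^2)^2"
  proof -
    have "((\<lambda>x. 1 / (1 + x^2)) has_real_derivative (0 * (1 + x^2) - 1 * (2 * x)) / ((1 + x^2) * (1 + x^2))) (at x)"
      by (rule DERIV_divide) (auto intro!: derivative_eq_intros)
    from DERIV_imp_deriv[OF this] show ?thesis by (simp add: power2_eq_square)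
  qed
  have cancel: "(P * y^2 - Q * (4 * x * y)) / (y^2 * y^2) = (P * y - 4 * x * Q) / y^3"
    "(P * y^4 - Q * (8 * x * y^3)) / (y^4 * y^4) = (P * y - 8 * x * Q) / y^5" for P Q
    using y(1) by (simp_all add: field_simps eval_nat_numeral)
  have D1: "deriv (L 1) x = ((1 - 3 * x^2) * y - 4 * x * (x * (1 - x^2))) / y^3"
  proof -
    have L: "L 1 = (\<lambda>x. x * (1 - x^2) / (1 + x^2)^2)" by (rule ext) (rule L_values)
    have "((\<lambda>x. x * (1 - x^2) / (1 + x^2)^2) has_real_derivative
       ((1 - 3 * x^2) * (1 + x^2)^2 - x * (1 - x^2) * (4 * x * (1 + x^2))) / ((1 + x^2)^2 * (1 + x^2)^2)) (at x)"
    proof (rule DERIV_divide)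
      show "((\<lambda>x. x * (1 - x^2)) has_real_derivative 1 - 3 * x^2) (at x)"
        "((\<lambda>x. (1 + x^2)^2) has_real_derivative 4 * x * (1 + x^2)) (at x)"
        by (auto intro!: derivative_eq_intros simp: algebra_simps power2_eq_square)
    qed simp
    from DERIV_imp_deriv[OF this] show ?thesis unfolding L y_def[symmetric] cancel .
  qed
  have D2: "deriv (L 2) x = ((- 1 + 36 * x^2 - 35 * x^4) * y - 8 * x * (- x + 12 * x^3 - 7 * x^5)) / y^5"
  proof -
    have L: "L 2 = (\<lambda>x. (- x + 12 * x^3 - 7 * x^5) / (1 + x^2)^4)" by (rule ext) (rule L_values)
    have "((\<lambda>x. (- x + 12 * x^3 - 7 * x^5) / (1 + x^2)^4) has_real_derivative
       ((- 1 + 36 * x^2 - 35 * x^4) * (1 + x^2)^4 - (- x + 12 * x^3 - 7 * x^5) * (8 * x * (1 + x^2)^3))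
         / ((1 + x^2)^4 * (1 + x^2)^4)) (at x)"
    proof (rule DERIV_divide)
      show "((\<lambda>x. - x + 12 * x^3 - 7 * x^5) has_real_derivative - 1 + 36 * x^2 - 35 * x^4) (at x)"
        "((\<lambda>x. (1 + x^2)^4) has_real_derivative 8 * x * (1 + x^2)^3) (at x)"
        by (auto intro!: derivative_eq_intros)
    qed simp
    from DERIV_imp_deriv[OF this] show ?thesis unfolding L y_def[symmetric] cancel .
  qed
  have l4: "{..<4} = {0, 1, 2, 3::nat}" "{..<3} = {0, 1, 2::nat}" "{..<2} = {0, 1::nat}" "{..<1} = {0::nat}" by auto
  have q2': "qcoeff 2 x = - L 1 x"
    using qcoeff_rec[of 1 x] taylor_comp_low[OF d0] by (simp add: rec_rhs_def l4 numeral_2_eq_2 incr_nth)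
  have q3': "qcoeff 3 x = deriv arctan x * qcoeff 2 x - L 2 x"
    using qcoeff_rec[of 2 x] taylor_comp_low[OF d0] by (simp add: rec_rhs_def l4 incr_nth eval_nat_numeral)
  have q4': "qcoeff 4 x = deriv arctan x * qcoeff 3 x - deriv (L 1) x * qcoeff 2 x - L 3 x"
    using qcoeff_rec[of 3 x] taylor_comp_low[OF d0] by (simp add: rec_rhs_def l4 incr_nth eval_nat_numeral)
  have q5': "qcoeff 5 x = deriv arctan x * qcoeff 4 x + deriv (deriv arctan) x / 2 * (qcoeff 2 x)^2
      - deriv (L 1) x * qcoeff 3 x - deriv (L 2) x * qcoeff 2 x - L 4 x"
    using qcoeff_rec[of 4 x] taylor_comp_low[OF d0] by (simp add: rec_rhs_def l4 incr_nth eval_nat_numeral)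
  show 2: "qcoeff 2 x = x * (x^2 - 1) / (x^2 + 1)^2"
    unfolding q2' L_values y(2) y_def[symmetric] by (simp add: algebra_simps diff_divide_distrib)
  show 3: "qcoeff 3 x = 4 * x^3 * (2 * x^2 - 3) / (x^2 + 1)^4"
    unfolding q3' 2 A1 L_values y(2) y_def[symmetric] using y(1)
    apply (simp add: divide_simps) apply (simp add: y_def eval_nat_numeral algebra_simps) done
  show 4: "qcoeff 4 x = - (2 * x^3 * (8 * x^6 - 183 * x^4 + 336 * x^2 - 65) / (3 * (x^2 + 1)^6))"
    unfolding q4' 2 3 A1 D1 L_values y(2) y_def[symmetric] using y(1)
    apply (simp add: divide_simps) apply (simp add: y_def eval_nat_numeral algebra_simps) done
  show "qcoeff 5 x = - (x^3 * (679 * x^8 - 8384 * x^6 + 17226 * x^4 - 7168 * x^2 + 431) / (3 * (x^2 + 1)^8))"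
  proof -
    define w where "w = 1 / y"
    have div: "a / y ^ k = a * w ^ k" for a k by (simp add: w_def power_divide)
    define N2 N3 N4 M1 M2 K where "N2 = x * (x^2 - 1)" and "N3 = 4 * x^3 * (2 * x^2 - 3)"
      and "N4 = 2 * x^3 * (8 * x^6 - 183 * x^4 + 336 * x^2 - 65)"
      and "M1 = (1 - 3 * x^2) * y - 4 * x * (x * (1 - x^2))"
      and "M2 = (- 1 + 36 * x^2 - 35 * x^4) * y - 8 * x * (- x + 12 * x^3 - 7 * x^5)"
      and "K = - x + 241 * x^3 - 2732 * x^5 + 5600 * x^7 - 2531 * x^9 + 191 * x^11"
    have "qcoeff 5 x = 1 / y ^ 1 * (- (N4 / 3 / y ^ 6)) + (- 2 * x / y^2) / 2 * (N2 / y^2)^2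
        - M1 / y^3 * (N3 / y ^ 4) - M2 / y ^ 5 * (N2 / y^2) - K / y ^ 8"
      unfolding q5' 2 3 4 A1 A2 D1 D2 L_values y(2) y_def[symmetric] N2_def N3_def N4_def M1_def M2_def K_def
      by simp
    also have "\<dots> = w^8 * (- (N4 / 3) * y - x * N2^2 * y^2 - M1 * N3 * y - M2 * N2 * y - K)"
    proof -
      have pw: "w^1 * w^6 = w^8 * y" "w^2 * (w^2)^2 = w^8 * y^2" "w^3 * w^4 = w^8 * y" "w^5 * w^2 = w^8 * y"
        using y(1) by (simp_all add: w_def power_divide eval_nat_numeral)
      have reg: "A * w^1 * (- (B * w^6)) + (C * w^2) / 2 * (D * w^2)^2 - E * w^3 * (F * w^4) - G * w^5 * (D * w^2) - H * w^8
         = (w^1 * w^6) * (- (A * B)) + (w^2 * (w^2)^2) * (C / 2 * D^2) - (w^3 * w^4) * (E * F) - (w^5 * w^2) * (G * D) - w^8 * H"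
        for A B C D E F G H :: real
        by (simp only: power_mult_distrib) (simp add: mult_ac)
      show ?thesis unfolding div unfolding reg pw by (simp add: algebra_simps)
    qed
    also have "\<dots> = w^8 * (- (x^3 * (679 * x^8 - 8384 * x^6 + 17226 * x^4 - 7168 * x^2 + 431) / 3))"
      by (rule arg_cong[where f = "\<lambda>a. w^8 * a"])
        (simp add: y_def N2_def N3_def N4_def M1_def M2_def K_def eval_nat_numeral field_simps)
    also have "\<dots> = - (x^3 * (679 * x^8 - 8384 * x^6 + 17226 * x^4 - 7168 * x^2 + 431) / (3 * (x^2 + 1)^8))"
      unfolding y(2) by (simp add: w_def power_divide)
    finally show ?thesis .
  qed
qed

section \<open>Location of the exact and approximate zeros\<close>

lemma powr_continuous_nonneg:
  fixes a :: real assumes "a > 1"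
  shows "continuous_on {0..} (\<lambda>t. t powr (a - 1))"
  using assms by (intro continuous_on_powr') (auto intro!: continuous_intros)

lemma Ci_integrand_continuous:
  fixes a :: real assumes "a > 1" shows "continuous_on {0..b} (\<lambda>t. t powr (a - 1) * cos t)"
  by (intro continuous_intros continuous_on_subset[OF powr_continuous_nonneg[OF assms]]) auto

lemma Ci_0: "Ci a 0 = 0" by (simp add: Ci_def)

lemma Ci_deriv_within:
  assumes "a > 1" "z \<in> {0..b}"
  shows "(Ci a has_real_derivative z powr (a - 1) * cos z) (at z within {0..b})"
  unfolding Ci_def[abs_def]
  by (rule integral_has_real_derivative[OF Ci_integrand_continuous]) (use assms in auto)

lemma Ci_deriv:
  assumes "a > 1" "z > 0"
  shows "(Ci a has_real_derivative z powr (a - 1) * cos z) (at z)"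
  using Ci_deriv_within[of a z "z + 1"] assms at_within_Icc_at[of 0 z "z + 1"] by simp

lemma Ci_continuous:
  assumes "a > 1" shows "continuous_on {0..} (Ci a)"
proof -
  have "continuous_on {0..b} (Ci a)" for b
    using Ci_deriv_within[OF assms] by (rule DERIV_continuous_on)
  have "continuous (at z within {0..}) (Ci a)" if "z \<ge> 0" for z
  proof (cases "z = 0")
    case True
    have "continuous (at 0 within {0..1}) (Ci a)"
      using \<open>continuous_on {0..1} (Ci a)\<close> by (simp add: continuous_on_eq_continuous_within)
    then show ?thesis unfolding True
      by (simp add: at_within_Icc_at_right at_within_Ici_at_right)
  next
    case False
    then have "isCont (Ci a) z" using that by (intro DERIV_isCont[OF Ci_deriv[OF assms]]) simp
    then show ?thesis by (rule continuous_at_imp_continuous_at_within)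
  qed
  then show ?thesis by (simp add: continuous_on_eq_continuous_within)
qed

text \<open>
  The difference of the two sides vanishes at 0 and has the derivative
  \<open>(a - 1) * z powr (a - 2) * (1 - \<sigma> * sin z)\<close>, which is never negative. Where \<open>sin z = \<sigma>\<close> the right-hand side
  is 0, and this yields the sign of \<open>Ci\<close> at each of its extrema.
\<close>

lemma Ci_bound:
  assumes a: "a > 1" and z: "z > 0" and \<sigma>: "\<sigma> = 1 \<or> \<sigma> = -1"
  shows "\<sigma> * Ci a z > z powr (a - 1) * (\<sigma> * sin z - 1)"
proof -
  define h where "h z = \<sigma> * Ci a z - z powr (a - 1) * (\<sigma> * sin z - 1)" for z
  have d: "(h has_real_derivative (a - 1) * z powr (a - 2) * (1 - \<sigma> * sin z)) (at z)" if "z > 0" for z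
  proof -
    have p: "((\<lambda>z. z powr (a - 1)) has_real_derivative (a - 1) * z powr (a - 2)) (at z)"
      using has_real_derivative_powr[OF that, of "a - 1"] by simp
    have s: "((\<lambda>z. \<sigma> * sin z - 1) has_real_derivative \<sigma> * cos z) (at z)"
      by (auto intro!: derivative_eq_intros)
    show ?thesis
      unfolding h_def using DERIV_diff[OF DERIV_cmult[OF Ci_deriv[OF a that], of \<sigma>] DERIV_mult[OF p s]]
      by (rule DERIV_cong) (simp add: algebra_simps)
  qed
  have c: "continuous_on {0..} h"
    unfolding h_def by (intro continuous_intros Ci_continuous powr_continuous_nonneg a)
  define w where "w = min z 1"
  have w: "0 < w" "w \<le> z" "w \<le> 1" using z by (auto simp: w_def)
  have "h 0 < h w"
  proof (rule DERIV_pos_imp_increasing_open[OF w(1)])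
    fix x assume x: "0 < x" "x < w"
    have "x < pi / 2" using x w pi_gt3 by linarith
    then have "sin x < 1" "sin x > 0" using x sin_monotone_2pi[of x "pi/2"] sin_gt_zero[of x] by auto
    then have "0 < (a - 1) * x powr (a - 2) * (1 - \<sigma> * sin x)"
      using a x \<sigma> by auto
    then show "\<exists>y. (h has_real_derivative y) (at x) \<and> 0 < y" using d[of x] x by blast
  qed (use c in \<open>auto intro: continuous_on_subset\<close>)
  also have "h w \<le> h z"
  proof (rule DERIV_nonneg_imp_nondecreasing[OF w(2)])
    fix x assume x: "w \<le> x" "x \<le> z"
    have "\<sigma> * sin x \<le> 1" using \<sigma> sin_le_one[of x] sin_ge_minus_one[of x] by auto
    then have "0 \<le> (a - 1) * x powr (a - 2) * (1 - \<sigma> * sin x)" using a by simp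
    then show "\<exists>y. (h has_real_derivative y) (at x) \<and> 0 \<le> y" using d[of x] x w by auto
  qed
  finally show ?thesis using a by (simp add: h_def Ci_0)
qed

definition cos_node :: "nat \<Rightarrow> real" where "cos_node m = (real m + 1/2) * pi"

lemma cos_node_pos [simp]: "cos_node m > 0" by (simp add: cos_node_def)

lemma sin_cos_node: "sin (cos_node m) = (-1) ^ m"
proof -
  have "cos_node m = pi / 2 + real m * pi" by (simp add: cos_node_def algebra_simps)
  then show ?thesis by (simp add: sin_add)
qed

lemma Ci_cos_node_sign: assumes "a > 1" shows "(-1) ^ m * Ci a (cos_node m) > 0"
proof -
  have s: "(-1) ^ m = (1::real) \<or> (-1) ^ m = (-1::real)" by (cases "even m") auto
  have "(-1) ^ m * (-1) ^ m = (1::real)" by (simp flip: power_mult_distrib)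
  then show ?thesis using Ci_bound[OF assms cos_node_pos[of m] s] by (simp add: sin_cos_node)
qed

lemma cos_sign_between:
  assumes "cos_node m < z" "z < cos_node (Suc m)"
  shows "(-1) ^ Suc m * cos z > 0"
proof -
  define y where "y = z - real (Suc m) * pi"
  have "- (pi/2) < y" "y < pi/2" using assms by (auto simp: y_def cos_node_def algebra_simps)
  then have "cos y > 0" by (rule cos_gt_zero_pi)
  moreover have "z = y + real (Suc m) * pi" by (simp add: y_def)
  then have "cos z = (-1) ^ Suc m * cos y"
    by (simp only: cos_add cos_npi sin_npi) simp
  moreover have "(-1) ^ Suc m * (-1) ^ Suc m = (1::real)" by (simp flip: power_mult_distrib)
  ultimately show ?thesis by (simp only: mult.assoc[symmetric]) 
qed

lemma Ci_pos_first: assumes "a > 1" "0 < z" "z \<le> cos_node 0" shows "Ci a z > 0"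
proof -
  have "Ci a 0 < Ci a z"
  proof (rule DERIV_pos_imp_increasing_open[OF assms(2)])
    fix x assume x: "0 < x" "x < z"
    then have "cos x > 0" using assms by (intro cos_gt_zero_pi) (auto simp: cos_node_def)
    then have "0 < x powr (a - 1) * cos x" using x by simp
    then show "\<exists>y. (Ci a has_real_derivative y) (at x) \<and> 0 < y"
      using Ci_deriv[OF assms(1) x(1)] by blast
  qed (use Ci_continuous[OF assms(1)] in \<open>auto intro: continuous_on_subset\<close>)
  then show ?thesis by (simp add: Ci_0)
qed

lemma Ci_unique_zero_between:
  assumes a: "a > 1"
  shows "\<exists>!z. cos_node m < z \<and> z < cos_node (Suc m) \<and> Ci a z = 0"
proof -
  define g where "g z = (-1) ^ Suc m * Ci a z" for z
  have le: "cos_node m < cos_node (Suc m)" by (simp add: cos_node_def)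
  have gc: "continuous_on {cos_node m..cos_node (Suc m)} g"
    unfolding g_def using cos_node_pos[of m]
    by (intro continuous_intros continuous_on_subset[OF Ci_continuous[OF a]]) (auto intro: less_imp_le order.trans)
  have mono: "g x < g y" if "cos_node m \<le> x" "x < y" "y \<le> cos_node (Suc m)" for x y
  proof (rule DERIV_pos_imp_increasing_open[OF that(2)])
    fix t assume t: "x < t" "t < y"
    have t0: "t > 0" using t that cos_node_pos[of m] by linarith
    have "(g has_real_derivative (-1) ^ Suc m * (t powr (a - 1) * cos t)) (at t)"
      unfolding g_def by (rule DERIV_cmult[OF Ci_deriv[OF a t0]])
    moreover have c: "0 < (-1) ^ Suc m * cos t"
      by (rule cos_sign_between) (use t that in linarith)+
    have p: "0 < t powr (a - 1)" using t0 by simp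
    from mult_pos_pos[OF p c] have "0 < (-1) ^ Suc m * (t powr (a - 1) * cos t)" by (simp only: mult.left_commute)
    ultimately show "\<exists>y. (g has_real_derivative y) (at t) \<and> 0 < y" by blast
  qed (use that in \<open>auto intro: continuous_on_subset[OF gc]\<close>)
  have s: "g (cos_node m) < 0" "g (cos_node (Suc m)) > 0"
    using Ci_cos_node_sign[OF a, of m] Ci_cos_node_sign[OF a, of "Suc m"] by (auto simp: g_def)
  have z: "g z = 0 \<longleftrightarrow> Ci a z = 0" for z by (simp add: g_def)
  obtain z where "cos_node m \<le> z" "z \<le> cos_node (Suc m)" "g z = 0"
    using IVT'[of g "cos_node m" 0 "cos_node (Suc m)"] s le gc by auto
  then have ex: "cos_node m < z \<and> z < cos_node (Suc m) \<and> Ci a z = 0" using s z by (metis less_eq_real_def less_irrefl)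
  show ?thesis
  proof (rule ex1I[where a = z])
    show "cos_node m < z \<and> z < cos_node (Suc m) \<and> Ci a z = 0" by (rule ex)
    fix z' assume "cos_node m < z' \<and> z' < cos_node (Suc m) \<and> Ci a z' = 0"
    then show "z' = z" using ex mono[of z z'] mono[of z' z] z[of z] z[of z'] by (cases z z' rule: linorder_cases) auto
  qed
qed

text \<open>
  Counted from 0, whereas \<open>ci_zero\<close> counts from 1. There is no zero below the first node \<open>\<pi> / 2\<close>.
\<close>

definition Ci_zero :: "real \<Rightarrow> nat \<Rightarrow> real" where
  "Ci_zero a m = (THE z. cos_node m < z \<and> z < cos_node (Suc m) \<and> Ci a z = 0)"

lemma Ci_zero:
  assumes "a > 1"
  shows "cos_node m < Ci_zero a m" "Ci_zero a m < cos_node (Suc m)" "Ci a (Ci_zero a m) = 0"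
  using theI'[OF Ci_unique_zero_between[OF assms, of m]] by (simp_all add: Ci_zero_def)

lemma Ci_zero_less_iff:
  assumes "a > 1" shows "Ci_zero a j < Ci_zero a m \<longleftrightarrow> j < m"
proof -
  have "Ci_zero a j < Ci_zero a m" if "j < m" for j m
  proof -
    have "cos_node (Suc j) \<le> cos_node m" using that by (simp add: cos_node_def)
    then show ?thesis using Ci_zero[OF assms, of j] Ci_zero[OF assms, of m] by linarith
  qed
  then show ?thesis by (metis linorder_neqE_nat not_less_iff_gr_or_eq)
qed

lemma Ci_zeros: assumes a: "a > 1" shows "{z. 0 < z \<and> Ci a z = 0} = range (Ci_zero a)"
proof safe
  fix z assume z: "0 < z" "Ci a z = 0"
  define k where "k = nat \<lfloor>z / pi + 1/2\<rfloor>"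
  have k: "real k = of_int \<lfloor>z / pi + 1/2\<rfloor>" using z by (simp add: k_def)
  have "real k \<le> z / pi + 1/2" "z / pi + 1/2 < real k + 1" unfolding k by linarith+
  then have k1: "(real k - 1/2) * pi \<le> z" "z < (real k + 1/2) * pi" by (auto simp: field_simps)
  show "z \<in> range (Ci_zero a)"
  proof (cases k)
    case 0
    then have "Ci a z > 0" using Ci_pos_first[OF a z(1)] k1 by (simp add: cos_node_def)
    then show ?thesis using z by simp
  next
    case (Suc m)
    have "cos_node m \<le> z" "z < cos_node (Suc m)" using k1 Suc by (auto simp: cos_node_def algebra_simps)
    moreover have "z \<noteq> cos_node m" using Ci_cos_node_sign[OF a, of m] z by auto
    ultimately have "z = Ci_zero a m"
      using Ci_unique_zero_between[OF a, of m] Ci_zero[OF a, of m] z by (metis less_eq_real_def)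
    then show ?thesis by simp
  qed
next
  fix m show "0 < Ci_zero a m" using Ci_zero(1)[OF a, of m] cos_node_pos[of m] by linarith
  show "Ci a (Ci_zero a m) = 0" by (rule Ci_zero(3)[OF a])
qed

lemma ci_zero_eq:
  assumes a: "a > 1"
  shows "ci_zero a (Suc m) = Ci_zero a m / a"
proof -
  have zeros: "{t. 0 < t \<and> Ci a (a * t) = 0} = range (\<lambda>j. Ci_zero a j / a)"
  proof safe
    fix t assume t: "0 < t" "Ci a (a * t) = 0"
    then have "a * t \<in> range (Ci_zero a)" using Ci_zeros[OF a] a by auto
    then obtain j where "a * t = Ci_zero a j" by auto
    then have "t = Ci_zero a j / a" using a by (simp add: field_simps)
    then show "t \<in> range (\<lambda>j. Ci_zero a j / a)" by (rule range_eqI)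
  next
    fix j
    have "0 < Ci_zero a j" using Ci_zero(1)[OF a, of j] cos_node_pos[of j] by linarith
    then show "0 < Ci_zero a j / a" using a by simp
    show "Ci a (a * (Ci_zero a j / a)) = 0" using a Ci_zero(3)[OF a, of j] by simp
  qed
  have count: "card {t. 0 < t \<and> t \<le> Ci_zero a j / a \<and> Ci a (a * t) = 0} = Suc j" for j
  proof -
    have "{t. 0 < t \<and> t \<le> Ci_zero a j / a \<and> Ci a (a * t) = 0} =
        {t \<in> {t. 0 < t \<and> Ci a (a * t) = 0}. t \<le> Ci_zero a j / a}" by auto
    also have "\<dots> = (\<lambda>i. Ci_zero a i / a) ` {..j}"
    proof -
      have "Ci_zero a i / a \<le> Ci_zero a j / a \<longleftrightarrow> Ci_zero a i \<le> Ci_zero a j" for i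
        using a by (simp add: divide_le_cancel)
      then have "Ci_zero a i / a \<le> Ci_zero a j / a \<longleftrightarrow> i \<le> j" for i
        using Ci_zero_less_iff[OF a, of j i] by (meson not_less)
      then show ?thesis unfolding zeros by auto
    qed
    also have "card \<dots> = Suc j"
      using a Ci_zero_less_iff[OF a] by (subst card_image) (auto simp: inj_on_def, metis linorder_neqE_nat order_less_irrefl)
    finally show ?thesis .
  qed
  show ?thesis
    unfolding ci_zero_def
  proof (rule the_equality)
    show "0 < Ci_zero a m / a \<and> Ci a (a * (Ci_zero a m / a)) = 0 \<and>
      card {t. 0 < t \<and> t \<le> Ci_zero a m / a \<and> Ci a (a * t) = 0} = Suc m"
      using count zeros by blast
  next
    fix \<theta> assume *: "0 < \<theta> \<and> Ci a (a * \<theta>) = 0 \<and> card {t. 0 < t \<and> t \<le> \<theta> \<and> Ci a (a * t) = 0} = Suc m"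
    then obtain j where "\<theta> = Ci_zero a j / a" using zeros by blast
    then show "\<theta> = Ci_zero a m / a" using * count[of j] by simp
  qed
qed

lemma ci_zero_enumerates:
  assumes a: "a > 1"
  shows "strict_mono_on {1..} (ci_zero a)" "ci_zero a ` {1..} = {\<theta>. 0 < \<theta> \<and> Ci a (a * \<theta>) = 0}"
proof -
  show "strict_mono_on {1..} (ci_zero a)"
  proof (rule strict_mono_onI)
    fix r s :: nat assume "r \<in> {1..}" "s \<in> {1..}" "r < s"
    then obtain j k where "r = Suc j" "s = Suc k" "j < k" by (cases r; cases s) auto
    then show "ci_zero a r < ci_zero a s"
      using a by (simp add: ci_zero_eq Ci_zero_less_iff divide_strict_right_mono)
  qed
  have "\<theta> \<in> ci_zero a ` {1..}" if "0 < \<theta>" "Ci a (a * \<theta>) = 0" for \<theta>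
  proof -
    have "a * \<theta> \<in> range (Ci_zero a)" using that Ci_zeros[OF a] a by auto
    then obtain j where "a * \<theta> = Ci_zero a j" by auto
    then have "\<theta> = ci_zero a (Suc j)" using a by (simp add: ci_zero_eq field_simps)
    then show ?thesis by auto
  qed
  moreover have "0 < ci_zero a m \<and> Ci a (a * ci_zero a m) = 0" if "m \<ge> 1" for m
  proof -
    obtain j where "m = Suc j" using \<open>m \<ge> 1\<close> by (cases m) auto
    moreover have "Ci_zero a j \<in> {z. 0 < z \<and> Ci a z = 0}" unfolding Ci_zeros[OF a] by simp
    ultimately show ?thesis using a by (simp add: ci_zero_eq)
  qed
  ultimately show "ci_zero a ` {1..} = {\<theta>. 0 < \<theta> \<and> Ci a (a * \<theta>) = 0}" by auto
qed

lemma ci_zero_bounds: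
  assumes "a > 1" "m \<ge> 1"
  shows "(real m - 1/2) * pi < a * ci_zero a m" "a * ci_zero a m < (real m + 1/2) * pi"
    "Ci a (a * ci_zero a m) = 0" "0 < ci_zero a m"
proof -
  obtain j where j: "m = Suc j" using assms(2) by (cases m) auto
  show "(real m - 1/2) * pi < a * ci_zero a m" "a * ci_zero a m < (real m + 1/2) * pi"
    using assms(1) Ci_zero[of a j] by (auto simp: j ci_zero_eq cos_node_def algebra_simps)
  show "Ci a (a * ci_zero a m) = 0" "0 < ci_zero a m" using ci_zero_enumerates(2)[OF assms(1)] assms(2) by auto
qed

lemma ci_zero0_exists:
  assumes a: "a > 1" and m: "m \<ge> 1"
  shows "\<exists>!\<theta>. 0 < \<theta> \<and> a * \<theta> - arctan \<theta> = (real m - 1/2) * pi"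
proof -
  define f where "f \<theta> = a * \<theta> - arctan \<theta>" for \<theta>
  have mono: "f x < f y" if "x < y" for x y
  proof (rule DERIV_pos_imp_increasing[OF that])
    fix t :: real
    have "(f has_real_derivative a - inverse (1 + t^2)) (at t)"
      unfolding f_def by (auto intro!: derivative_eq_intros)
    moreover have "inverse (1 + t^2) \<le> 1" using zero_le_power2[of t] by (intro inverse_le_1_iff[THEN iffD2]) auto
    ultimately show "\<exists>y. (f has_real_derivative y) (at t) \<and> 0 < y" using a by (intro exI conjI) auto
  qed
  define c where "c = (real m - 1/2) * pi"
  define b where "b = (c + pi) / a"
  have c: "c > 0" using m by (simp add: c_def)
  have "f 0 \<le> c" using c by (simp add: f_def)
  moreover have "a * b = c + pi" using a by (simp add: b_def)
  then have "c \<le> f b" using arctan_ubound[of b] pi_gt_zero unfolding f_def by linarith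
  moreover have "0 \<le> b" using c a by (simp add: b_def)
  moreover have "continuous_on {0..b} f" unfolding f_def by (intro continuous_intros)
  ultimately obtain x where x: "0 \<le> x" "f x = c" using IVT'[of f 0 c b] by auto
  have "x \<noteq> 0" using x c by (auto simp: f_def)
  then have "0 < x \<and> f x = c" using x by simp
  then have "\<exists>!x. 0 < x \<and> f x = c" using mono by (metis linorder_neqE_linordered_idom less_irrefl)
  then show ?thesis by (simp add: f_def c_def)
qed

lemma ci_zero0:
  assumes "a > 1" "m \<ge> 1"
  shows "0 < ci_zero0 a m" "a * ci_zero0 a m - arctan (ci_zero0 a m) = (real m - 1/2) * pi"
  using theI'[OF ci_zero0_exists[OF assms]] by (simp_all add: ci_zero0_def)

section \<open>Uniform error bounds for the amplitude and its logarithm\<close>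

lemma poly_bounded:
  fixes P :: "complex poly"
  shows "\<exists>B\<ge>0. \<forall>\<tau>. cmod \<tau> \<le> 1 \<longrightarrow> cmod (poly P \<tau>) \<le> B"
proof (induction P)
  case (pCons c P)
  then obtain B where B: "B \<ge> 0" "\<And>\<tau>. cmod \<tau> \<le> 1 \<Longrightarrow> cmod (poly P \<tau>) \<le> B" by blast
  have "cmod (poly (pCons c P) \<tau>) \<le> cmod c + B" if "cmod \<tau> \<le> 1" for \<tau>
  proof -
    have "cmod (\<tau> * poly P \<tau>) \<le> 1 * B"
      unfolding norm_mult using that B by (intro mult_mono) auto
    then show ?thesis using norm_triangle_ineq[of c "\<tau> * poly P \<tau>"] by simp
  qed
  then show ?case using B(1) by (intro exI[of _ "cmod c + B"]) auto
qed auto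

lemma poly_bounded_root:
  fixes P :: "complex poly"
  assumes "poly P 0 = 0"
  shows "\<exists>B\<ge>0. \<forall>\<tau>. cmod \<tau> \<le> 1 \<longrightarrow> cmod (poly P \<tau>) \<le> B * cmod \<tau>"
proof -
  obtain R where R: "P = [:0, 1:] * R" using assms poly_eq_0_iff_dvd[of P 0] by (auto elim: dvdE)
  obtain B where "B \<ge> 0" "\<And>\<tau>. cmod \<tau> \<le> 1 \<Longrightarrow> cmod (poly R \<tau>) \<le> B" using poly_bounded by blast
  then show ?thesis unfolding R
    by (intro exI[of _ B]) (auto simp: norm_mult mult.commute[of B] intro!: mult_left_mono)
qed

lemma poly_bounded_roots:
  fixes P :: "complex poly"
  assumes "poly P 0 = 0" "poly P 1 = 0"
  shows "\<exists>B\<ge>0. \<forall>\<tau>. cmod \<tau> \<le> 1 \<longrightarrow> cmod (poly P \<tau>) \<le> B * (cmod \<tau> * cmod (1 - \<tau>))"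
proof -
  obtain R where R: "P = [:0, 1:] * R" using assms poly_eq_0_iff_dvd[of P 0] by (auto elim: dvdE)
  then have "poly R 1 = 0" using assms by simp
  then obtain S where S: "R = [:-1, 1:] * S" using poly_eq_0_iff_dvd[of R 1] by (auto elim: dvdE)
  obtain B where B: "B \<ge> 0" "\<And>\<tau>. cmod \<tau> \<le> 1 \<Longrightarrow> cmod (poly S \<tau>) \<le> B" using poly_bounded by blast
  have "cmod (poly P \<tau>) \<le> B * (cmod \<tau> * cmod (1 - \<tau>))" if "cmod \<tau> \<le> 1" for \<tau>
  proof -
    have "poly P \<tau> = - (poly S \<tau> * (\<tau> * (1 - \<tau>)))" by (simp add: R S algebra_simps)
    then have "cmod (poly P \<tau>) = cmod (poly S \<tau>) * (cmod \<tau> * cmod (1 - \<tau>))"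
      by (simp only: norm_minus_cancel norm_mult)
    then show ?thesis using B(2)[OF that] by (auto intro: mult_right_mono)
  qed
  then show ?thesis using B(1) by blast
qed

text \<open>
  Polynomials in \<open>e\<close> whose coefficients are themselves polynomials in \<open>\<tau>\<close>: on the product of the two
  unit discs only the lowest power of \<open>e\<close> matters.
\<close>

lemma poly_family_bound:
  fixes W :: "complex \<Rightarrow> complex poly"
  assumes coeff: "\<And>\<tau> n. coeff (W \<tau>) n = poly (w n) \<tau>"
    and top: "\<And>n. n > D \<Longrightarrow> w n = 0" and low: "\<And>n. n < k \<Longrightarrow> w n = 0"
  shows "\<exists>C\<ge>0. \<forall>\<tau> e. cmod \<tau> \<le> 1 \<longrightarrow> cmod e \<le> 1 \<longrightarrow> cmod (poly (W \<tau>) e) \<le> C * cmod e ^ k"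
proof -
  have "\<forall>n. \<exists>B\<ge>0. \<forall>\<tau>. cmod \<tau> \<le> 1 \<longrightarrow> cmod (poly (w n) \<tau>) \<le> B" using poly_bounded by blast
  then obtain B where B: "\<And>n. B n \<ge> 0" "\<And>n \<tau>. cmod \<tau> \<le> 1 \<Longrightarrow> cmod (poly (w n) \<tau>) \<le> B n" by metis
  have "cmod (poly (W \<tau>) e) \<le> (\<Sum>n\<le>D. B n) * cmod e ^ k" if "cmod \<tau> \<le> 1" "cmod e \<le> 1" for \<tau> e
  proof -
    have deg: "degree (W \<tau>) \<le> D" using coeff top by (intro degree_le) auto
    have "poly (W \<tau>) e = (\<Sum>n\<le>degree (W \<tau>). coeff (W \<tau>) n * e ^ n)" by (rule poly_altdef)
    also have "\<dots> = (\<Sum>n\<le>D. poly (w n) \<tau> * e ^ n)"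
      unfolding coeff[symmetric] using deg by (intro sum.mono_neutral_left) (auto simp: coeff_eq_0)
    also have "cmod \<dots> \<le> (\<Sum>n\<le>D. cmod (poly (w n) \<tau> * e ^ n))" by (rule norm_sum)
    also have "\<dots> \<le> (\<Sum>n\<le>D. B n * cmod e ^ k)"
    proof (rule sum_mono)
      fix n
      show "cmod (poly (w n) \<tau> * e ^ n) \<le> B n * cmod e ^ k"
      proof (cases "n < k")
        case True
        then show ?thesis using low B(1) by simp
      next
        case False
        then show ?thesis unfolding norm_mult norm_power
          using B that by (intro mult_mono power_decreasing) auto
      qed
    qed
    finally show ?thesis by (simp add: sum_distrib_right)
  qed
  moreover have "(\<Sum>n\<le>D. B n) \<ge> 0" by (intro sum_nonneg B)
  ultimately show ?thesis by blast
qed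

definition ampl_poly :: "nat \<Rightarrow> complex \<Rightarrow> complex poly" where
  "ampl_poly N \<tau> = (\<Sum>s\<le>N. monom (poly (ampl s) \<tau>) s)"

definition logampl_poly :: "nat \<Rightarrow> complex \<Rightarrow> complex poly" where
  "logampl_poly N \<tau> = (\<Sum>s\<le>N. monom (poly (logampl s) \<tau>) s)"

lemma coeff_ampl_poly: "coeff (ampl_poly N \<tau>) n = (if n \<le> N then poly (ampl n) \<tau> else 0)"
  by (auto simp: ampl_poly_def coeff_sum)

lemma coeff_logampl_poly: "coeff (logampl_poly N \<tau>) n = (if n \<le> N then poly (logampl n) \<tau> else 0)"
  by (auto simp: logampl_poly_def coeff_sum)

lemma poly_logampl_poly: "poly (logampl_poly N \<tau>) e = (\<Sum>s<N. poly (logampl (Suc s)) \<tau> * e ^ Suc s)"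
  unfolding logampl_poly_def poly_sum poly_monom lessThan_Suc_atMost[symmetric]
  by (subst sum.lessThan_Suc_shift) simp

lemma poly_ampl_poly: "poly (ampl_poly N \<tau>) e = (\<Sum>s\<le>N. poly (ampl s) \<tau> * e ^ s)"
  by (simp add: ampl_poly_def poly_sum poly_monom)

text \<open>
  Below the order \<open>N\<close> the truncations satisfy the coefficient identities of \<open>u' = u p'\<close>.
\<close>

lemma log_derivative_small:
  "\<exists>C\<ge>0. \<forall>\<tau> e. cmod \<tau> \<le> 1 \<longrightarrow> cmod e \<le> 1 \<longrightarrow>
     cmod (poly (pderiv (ampl_poly N \<tau>) - ampl_poly N \<tau> * pderiv (logampl_poly N \<tau>)) e) \<le> C * cmod e ^ N"
proof -
  define u p where "u n = (if n \<le> N then ampl n else 0)" and "p n = (if n \<le> N then logampl n else 0)" for n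
  define w where "w n = smult (of_nat (Suc n)) (u (Suc n)) - (\<Sum>i\<le>n. u i * smult (of_nat (Suc (n - i))) (p (Suc (n - i))))" for n
  show ?thesis
  proof (rule poly_family_bound[where w = w and D = "2 * N"])
    fix \<tau> n
    show "coeff (pderiv (ampl_poly N \<tau>) - ampl_poly N \<tau> * pderiv (logampl_poly N \<tau>)) n = poly (w n) \<tau>"
      by (simp add: w_def coeff_diff coeff_mult coeff_pderiv coeff_ampl_poly coeff_logampl_poly u_def p_def poly_sum
            del: of_nat_Suc ampl.simps if_split cong: if_cong) 
        (auto intro!: sum.cong)
  next
    fix n assume "n > 2 * N"
    then show "w n = 0" by (auto simp: w_def u_def p_def intro!: sum.neutral)
  next
    fix n assume n: "n < N"
    have "(\<Sum>i\<le>n. u i * smult (of_nat (Suc (n - i))) (p (Suc (n - i))))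
        = (\<Sum>i\<le>n. smult (of_nat (Suc i)) (logampl (Suc i) * ampl (n - i)))"
      by (rule sum.reindex_bij_witness[of _ "\<lambda>i. n - i" "\<lambda>i. n - i"])
        (use n in \<open>auto simp: u_def p_def mult.commute simp del: of_nat_Suc\<close>)
    then show "w n = 0" using n ampl_log_recurrence[of n] by (simp add: w_def u_def del: of_nat_Suc ampl.simps)
  qed
qed

lemma logampl_poly_bound: "\<exists>K\<ge>0. \<forall>\<tau> e. cmod \<tau> \<le> 1 \<longrightarrow> cmod e \<le> 1 \<longrightarrow> cmod (poly (logampl_poly N \<tau>) e) \<le> K"
  using poly_family_bound[where W = "logampl_poly N" and w = "\<lambda>n. if n \<le> N then logampl n else 0" and D = N and k = 0]
  by (simp add: coeff_logampl_poly if_distrib[of "\<lambda>P. poly P _"] cong: if_cong)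

text \<open>
  The quotient \<open>f\<close> of the two sides is 1 at \<open>e = 0\<close>, and its derivative is \<open>O(e^N)\<close> by
  \<open>log_derivative_small\<close>. This form avoids the logarithm of the truncated amplitude, which might
  vanish when \<open>e\<close> is not small.
\<close>

lemma ampl_poly_exp_logampl_poly:
  "\<exists>C\<ge>0. \<forall>\<tau> e. cmod \<tau> \<le> 1 \<longrightarrow> cmod e \<le> 1 \<longrightarrow>
     cmod (poly (ampl_poly N \<tau>) e - exp (poly (logampl_poly N \<tau>) e)) \<le> C * cmod e ^ Suc N"
proof -
  obtain C where C: "C \<ge> 0" "\<And>\<tau> e. cmod \<tau> \<le> 1 \<Longrightarrow> cmod e \<le> 1 \<Longrightarrow>
     cmod (poly (pderiv (ampl_poly N \<tau>) - ampl_poly N \<tau> * pderiv (logampl_poly N \<tau>)) e) \<le> C * cmod e ^ N"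
    using log_derivative_small by blast
  obtain K where K: "\<And>\<tau> e. cmod \<tau> \<le> 1 \<Longrightarrow> cmod e \<le> 1 \<Longrightarrow> cmod (poly (logampl_poly N \<tau>) e) \<le> K"
    using logampl_poly_bound by blast
  have "cmod (poly (ampl_poly N \<tau>) e - exp (poly (logampl_poly N \<tau>) e)) \<le> (exp K * (exp K * C)) * cmod e ^ Suc N"
    if \<tau>: "cmod \<tau> \<le> 1" and e: "cmod e \<le> 1" for \<tau> e
  proof -
    define U S where "U = ampl_poly N \<tau>" and "S = logampl_poly N \<tau>"
    define f where "f x = poly U x * exp (- poly S x)" for x :: complex
    have d: "(f has_field_derivative exp (- poly S x) * poly (pderiv U - U * pderiv S) x) (at x within A)" for x A
      unfolding f_def by (rule derivative_eq_intros poly_DERIV[THEN has_field_derivative_at_within] refl)+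
        (simp add: algebra_simps)
    have "cmod (f e - f 0) \<le> (exp K * (C * cmod e ^ N)) * cmod (e - 0)"
    proof (rule field_differentiable_bound[OF convex_cball[of 0 "cmod e"] d])
      fix x :: complex assume "x \<in> cball 0 (cmod e)"
      then have x: "cmod x \<le> cmod e" "cmod x \<le> 1" using e by auto
      have "cmod (exp (- poly S x)) \<le> exp K"
        using norm_exp[of "- poly S x"] K[OF \<tau> x(2)] unfolding S_def by (simp add: order.trans)
      moreover have "cmod (poly (pderiv U - U * pderiv S) x) \<le> C * cmod e ^ N"
        using C(2)[OF \<tau> x(2)] C(1) x(1) unfolding U_def S_def
        by (meson mult_left_mono norm_ge_zero order.trans power_mono)
      ultimately show "cmod (exp (- poly S x) * poly (pderiv U - U * pderiv S) x) \<le> exp K * (C * cmod e ^ N)"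
        unfolding norm_mult by (intro mult_mono) auto
    qed auto
    moreover have "f 0 = 1"
      by (simp add: f_def U_def S_def poly_0_coeff_0 coeff_ampl_poly coeff_logampl_poly)
    ultimately have f: "cmod (f e - 1) \<le> exp K * C * cmod e ^ Suc N" by (simp add: mult_ac)
    have "poly U e - exp (poly S e) = exp (poly S e) * (f e - 1)"
      by (simp add: f_def exp_minus field_simps)
    moreover have "cmod (exp (poly S e)) \<le> exp K"
      using norm_exp[of "poly S e"] K[OF \<tau> e] unfolding S_def by (simp add: order.trans)
    ultimately have "cmod (poly U e - exp (poly S e)) \<le> exp K * (exp K * C * cmod e ^ Suc N)"
      using f by (simp only: norm_mult) (intro mult_mono, auto)
    then show ?thesis by (simp add: U_def S_def mult_ac)
  qed
  then show ?thesis using C(1) by (intro exI[of _ "exp K * (exp K * C)"]) auto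
qed

section \<open>The amplitude of the cosine integral\<close>

definition tvar :: "real \<Rightarrow> complex" where "tvar \<theta> = 1 / (1 + \<i> * of_real \<theta>)"

lemma one_plus_i_neq_0 [simp]: "1 + \<i> * of_real \<theta> \<noteq> 0"
  by (auto simp: complex_eq_iff)

lemma norm_tvar: "cmod (tvar \<theta>) = 1 / sqrt (1 + \<theta>^2)"
proof -
  have "cmod (1 + \<i> * of_real \<theta>) = sqrt (1 + \<theta>^2)" by (simp add: cmod_def)
  then show ?thesis by (simp add: tvar_def norm_divide)
qed

lemma norm_tvar_le_1: "cmod (tvar \<theta>) \<le> 1"
proof -
  have "1 \<le> sqrt (1 + \<theta>^2)" by simp
  then show ?thesis unfolding norm_tvar by (simp only: divide_le_eq_1) auto
qed

lemma norm_tvar_pos: "cmod (tvar \<theta>) > 0"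
  by (simp add: norm_tvar)

lemma tvar_polar: "tvar \<theta> = of_real (cmod (tvar \<theta>)) * cis (- arctan \<theta>)"
proof -
  have "sqrt (1 + \<theta>^2) * sqrt (1 + \<theta>^2) = 1 + \<theta>^2" by simp
  then show ?thesis
    unfolding norm_tvar
    by (simp add: tvar_def complex_eq_iff Re_divide Im_divide cos_arctan sin_arctan)
qed

lemma abs_le_by_deriv:
  fixes D Q :: "real \<Rightarrow> real"
  assumes z: "0 \<le> z" and c: "continuous_on {0..z} D" "continuous_on {0..z} Q" and 0: "D 0 = 0" "Q 0 = 0"
    and d: "\<And>x. 0 < x \<Longrightarrow> (D has_real_derivative d x) (at x)"
      "\<And>x. 0 < x \<Longrightarrow> (Q has_real_derivative q x) (at x)"
    and le: "\<And>x. 0 < x \<Longrightarrow> \<bar>d x\<bar> \<le> q x"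
  shows "\<bar>D z\<bar> \<le> Q z"
proof -
  have "Q 0 - D 0 \<le> Q z - D z"
    by (rule DERIV_nonneg_imp_increasing_open[OF z])
      (use le in \<open>force intro: DERIV_diff d continuous_intros c\<close>)+
  moreover have "Q 0 + D 0 \<le> Q z + D z"
    by (rule DERIV_nonneg_imp_increasing_open[OF z])
      (use le in \<open>force intro: DERIV_add d continuous_intros c\<close>)+
  ultimately show ?thesis using 0 by auto
qed

text \<open>
  The same double sum as \<open>ampl_poly\<close>, but read as a polynomial in \<open>t\<close> for fixed \<open>e\<close>; the first form is
  the one to be differentiated in \<open>\<theta>\<close>, the second the one to be differentiated in \<open>e\<close>.
\<close>

definition ampl_trunc :: "nat \<Rightarrow> real \<Rightarrow> complex poly" where
  "ampl_trunc N e = (\<Sum>s\<le>N. smult (of_real e ^ s) (ampl s))"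

lemma poly_ampl_trunc: "poly (ampl_trunc N e) \<tau> = poly (ampl_poly N \<tau>) (of_real e)"
  by (simp add: ampl_trunc_def poly_sum poly_ampl_poly mult.commute)

text \<open>
  The sum telescopes, which leaves the residual of the truncated amplitude in closed form.
\<close>

lemma ampl_trunc_equation:
  "ampl_trunc N e - smult (of_real e) (tau * pderiv ([:0, 1:] * ampl_trunc N e))
     = 1 - smult (of_real e ^ Suc N) (ampl (Suc N))"
proof (induction N)
  case 0
  show ?case by (simp add: ampl_trunc_def)
next
  case (Suc N)
  have "ampl_trunc (Suc N) e = ampl_trunc N e + smult (of_real e ^ Suc N) (ampl (Suc N))"
    by (simp add: ampl_trunc_def del: ampl.simps)
  then have "ampl_trunc (Suc N) e - smult (of_real e) (tau * pderiv ([:0, 1:] * ampl_trunc (Suc N) e))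
      = (ampl_trunc N e - smult (of_real e) (tau * pderiv ([:0, 1:] * ampl_trunc N e)))
        + smult (of_real e ^ Suc N) (ampl (Suc N)) - smult (of_real e ^ Suc (Suc N)) (tau * pderiv ([:0, 1:] * ampl (Suc N)))"
    by (simp only: distrib_left pderiv_add mult_smult_right pderiv_smult smult_add_right) (simp add: algebra_simps del: ampl.simps)
  also have "\<dots> = 1 - smult (of_real e ^ Suc (Suc N)) (ampl (Suc (Suc N)))"
    unfolding Suc.IH by (simp add: ampl.simps(2)[of "Suc N"] del: ampl.simps)
  finally show ?case .
qed

text \<open>
  The approximation solves the differential equation of the scaled cosine integral, whose
  derivative is \<open>a * \<theta> powr (a - 1) * cos (a * \<theta>)\<close>, up to the residual. The conversion uses
  \<open>\<theta> d/d\<theta> = - (t - t\<^sup>2) d/dt\<close>.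
\<close>

lemma approx_deriv:
  fixes a \<theta> :: real
  assumes a: "a > 1" and \<theta>: "\<theta> > 0"
  shows "((\<lambda>\<theta>. \<theta> powr a * Re (cis (a * \<theta>) * tvar \<theta> * poly (ampl_trunc N (1 / a)) (tvar \<theta>))) has_real_derivative
     a * \<theta> powr (a - 1) * (cos (a * \<theta>) - (1 / a) ^ Suc N * Re (cis (a * \<theta>) * poly (ampl (Suc N)) (tvar \<theta>)))) (at \<theta>)"
proof -
  define P where "P = [:0, 1:] * ampl_trunc N (1 / a)"
  define E where "E z = exp (\<i> * of_real a * z) * poly P (1 / (1 - (- \<i> * z)))" for z
  define t where "t = tvar \<theta>"
  have t: "t = 1 / (1 - (- \<i> * of_real \<theta>))" by (simp add: t_def tvar_def)
  define E' where "E' = exp (\<i> * of_real a * of_real \<theta>) * (\<i> * of_real a * poly P t - \<i> * t^2 * poly (pderiv P) t)"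
  have ne: "- \<i> * of_real \<theta> \<noteq> 1" by (auto simp: complex_eq_iff)
  have p: "((\<lambda>z. poly P (1 / (1 - (- \<i> * z)))) has_field_derivative poly (pderiv P) t * t^2 * (- \<i>)) (at (of_real \<theta>))"
    unfolding t
    by (rule DERIV_chain2[where f = "\<lambda>z. poly P (1 / (1 - z))" and g = "\<lambda>z. - \<i> * z"])
      (use poly_inv_has_deriv[OF ne] in \<open>auto intro!: derivative_eq_intros\<close>)
  have x: "((\<lambda>z. exp (\<i> * of_real a * z)) has_field_derivative exp (\<i> * of_real a * of_real \<theta>) * (\<i> * of_real a)) (at (of_real \<theta>))"
    by (auto intro!: derivative_eq_intros)
  have "(E has_field_derivative E') (at (of_real \<theta>))"
    unfolding E_def using DERIV_mult[OF x p] by (rule DERIV_cong) (simp add: E'_def t algebra_simps)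
  then have "((\<lambda>x. E (of_real x)) has_vector_derivative E') (at \<theta>)"
    by (rule has_vector_derivative_real_field)
  from bounded_linear.has_vector_derivative[OF bounded_linear_Re this]
  have RE: "((\<lambda>x. Re (E (of_real x))) has_real_derivative Re E') (at \<theta>)"
    by (simp add: has_real_derivative_iff_has_vector_derivative)
  have E: "E (of_real x) = cis (a * x) * tvar x * poly (ampl_trunc N (1 / a)) (tvar x)" for x
    by (simp add: E_def P_def tvar_def cis_conv_exp mult.assoc)
  have pw: "((\<lambda>x. x powr a) has_real_derivative a * \<theta> powr (a - 1)) (at \<theta>)"
    using has_real_derivative_powr[OF \<theta>, of a] .
  have "((\<lambda>\<theta>. \<theta> powr a * Re (E (of_real \<theta>))) has_real_derivative
      a * \<theta> powr (a - 1) * Re (E (of_real \<theta>)) + Re E' * \<theta> powr a) (at \<theta>)"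
    by (rule DERIV_mult[OF pw RE])
  moreover have "a * \<theta> powr (a - 1) * Re (E (of_real \<theta>)) + Re E' * \<theta> powr a =
     a * \<theta> powr (a - 1) * (cos (a * \<theta>) - (1 / a) ^ Suc N * Re (cis (a * \<theta>) * poly (ampl (Suc N)) t))"
  proof -
    have "\<theta> powr a = \<theta> powr (a - 1) * \<theta>" using \<theta> by (simp add: powr_diff)
    then have 1: "a * \<theta> powr (a - 1) * Re (E (of_real \<theta>)) + Re E' * \<theta> powr a =
        a * \<theta> powr (a - 1) * Re (E (of_real \<theta>) + of_real (\<theta> / a) * E')"
    proof -
      have "Re (X + of_real r * Y) = Re X + r * Re Y" for X Y r by simp
      then show ?thesis using a \<open>\<theta> powr a = \<theta> powr (a - 1) * \<theta>\<close>
        by (simp only:) (simp add: field_simps)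
    qed
    have t1: "(1 + \<i> * of_real \<theta>) * t = 1" by (simp add: t)
    have "E (of_real \<theta>) + of_real (\<theta> / a) * E' =
        cis (a * \<theta>) * (((1 + \<i> * of_real \<theta>) * t) * poly (ampl_trunc N (1 / a)) t
           - of_real (1 / a) * (\<i> * of_real \<theta> * t * t * poly (pderiv P) t))"
      using a by (simp add: E E'_def P_def cis_conv_exp t_def[symmetric] power2_eq_square field_simps)
    also have "\<i> * of_real \<theta> * t = 1 - t" using t1 by (simp add: algebra_simps)
    also have "cis (a * \<theta>) * (((1 + \<i> * of_real \<theta>) * t) * poly (ampl_trunc N (1 / a)) t
           - of_real (1 / a) * ((1 - t) * t * poly (pderiv P) t))
        = cis (a * \<theta>) * poly (ampl_trunc N (1 / a) - smult (of_real (1 / a)) (tau * pderiv P)) t"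
      unfolding t1 by (simp add: tau_def algebra_simps)
    also have "\<dots> = cis (a * \<theta>) - of_real ((1 / a) ^ Suc N) * (cis (a * \<theta>) * poly (ampl (Suc N)) t)"
      unfolding P_def ampl_trunc_equation by (simp add: algebra_simps del: ampl.simps)
    finally show ?thesis unfolding 1 by (simp del: ampl.simps)
  qed
  ultimately show ?thesis unfolding E t_def by simp
qed

text \<open>
  The residual is \<open>O(\<epsilon>^(N+1))\<close> times \<open>|t|\<close>, which is at most \<open>min 1 (1 / \<theta>)\<close>. Integrating the two bounds
  against \<open>a * x powr (a - 1)\<close> gives errors of the size of \<open>\<theta> powr a\<close> and of \<open>\<theta> powr (a - 1)\<close>. Both are needed,
  since the modulus \<open>\<theta> powr a * |t|\<close> of the approximation behaves like the first for small \<open>\<theta>\<close> and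
  like the second for large \<open>\<theta>\<close>. The assumption \<open>a \<ge> 2\<close> keeps the factor \<open>a / (a - 1)\<close> bounded.
\<close>

lemma Re_amplitude_small:
  "\<exists>C\<ge>0. \<forall>a\<ge>2. \<forall>\<theta>>0. Ci a (a * \<theta>) = 0 \<longrightarrow>
     \<bar>Re (cis (a * \<theta>) * tvar \<theta> * poly (ampl_trunc N (1 / a)) (tvar \<theta>))\<bar> \<le> C * (1 / a) ^ Suc N * cmod (tvar \<theta>)"
proof -
  obtain b where b: "b \<ge> 0" "\<And>\<tau>. cmod \<tau> \<le> 1 \<Longrightarrow> cmod (poly (ampl (Suc N)) \<tau>) \<le> b * cmod \<tau>"
    using poly_bounded_root[of "ampl (Suc N)"] ampl_roots[of "Suc N"] by blast
  have "\<bar>Re (cis (a * \<theta>) * tvar \<theta> * poly (ampl_trunc N (1 / a)) (tvar \<theta>))\<bar> \<le> (4 * b) * (1 / a) ^ Suc N * cmod (tvar \<theta>)"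
    if a: "a \<ge> 2" and \<theta>: "\<theta> > 0" and zero: "Ci a (a * \<theta>) = 0" for a \<theta> :: real
  proof -
    define \<eta> where "\<eta> = (1 / a) ^ Suc N"
    have \<eta>: "\<eta> \<ge> 0" using a by (simp add: \<eta>_def)
    have a1: "a > 1" using a by simp
    define B where "B x = x powr a * Re (cis (a * x) * tvar x * poly (ampl_trunc N (1 / a)) (tvar x))" for x
    define r where "r x = Re (cis (a * x) * poly (ampl (Suc N)) (tvar x))" for x
    define D where "D x = a powr (1 - a) * Ci a (a * x) - B x" for x
    have G: "((\<lambda>x. a powr (1 - a) * Ci a (a * x)) has_real_derivative a * x powr (a - 1) * cos (a * x)) (at x)"
      if "x > 0" for x
    proof -
      have "((\<lambda>x. Ci a (a * x)) has_real_derivative ((a * x) powr (a - 1) * cos (a * x)) * a) (at x)"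
        by (rule DERIV_chain2[OF Ci_deriv[OF a1]]) (use a that in \<open>auto intro!: derivative_eq_intros\<close>)
      from DERIV_cmult[OF this, of "a powr (1 - a)"]
      show ?thesis
      proof (rule DERIV_cong)
        have "a powr (1 - a) * a powr (a - 1) = 1" using a by (simp flip: powr_add)
        then show "a powr (1 - a) * ((a * x) powr (a - 1) * cos (a * x) * a) = a * x powr (a - 1) * cos (a * x)"
          using a that by (simp add: powr_mult)
      qed
    qed
    have dD: "(D has_real_derivative a * x powr (a - 1) * \<eta> * r x) (at x)" if "x > 0" for x
      unfolding D_def B_def using DERIV_diff[OF G[OF that] approx_deriv[OF a1 that, of N]]
      by (rule DERIV_cong) (simp only: \<eta>_def r_def algebra_simps)
    have cG: "continuous_on {0..\<theta>} (\<lambda>x. Ci a (a * x))"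
      by (rule continuous_on_compose2[OF Ci_continuous[OF a1]]) (use a in \<open>auto intro!: continuous_intros\<close>)
    have ctt: "continuous_on A tvar" for A
      unfolding tvar_def[abs_def] by (intro continuous_intros) simp
    have ccis: "continuous_on A (\<lambda>x. cis (a * x))" for A
      by (intro continuous_intros)
    have cpw: "continuous_on {0..\<theta>} (\<lambda>x. x powr p)" if "p > 0" for p :: real
      using that by (intro continuous_on_powr') (auto intro!: continuous_intros)
    have cD: "continuous_on {0..\<theta>} D"
      unfolding D_def B_def by (intro continuous_intros cG ctt ccis cpw) (use a in auto)
    have D0: "D 0 = 0" using a by (simp add: D_def B_def Ci_0)
    have rb: "\<bar>r x\<bar> \<le> b * cmod (tvar x)" for x
    proof -
      have "\<bar>r x\<bar> \<le> cmod (cis (a * x) * poly (ampl (Suc N)) (tvar x))" unfolding r_def by (rule abs_Re_le_cmod)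
      also have "\<dots> \<le> b * cmod (tvar x)" using b(2)[OF norm_tvar_le_1[of x]] by (simp add: norm_mult del: ampl.simps)
      finally show ?thesis .
    qed
    have d_le: "\<bar>a * x powr (a - 1) * \<eta> * r x\<bar> \<le> a * x powr (a - 1) * \<eta> * (b * c)"
      if "cmod (tvar x) \<le> c" for x c
    proof -
      have "\<bar>r x\<bar> \<le> b * c" using rb[of x] mult_left_mono[OF that b(1)] by linarith
      moreover have "\<bar>a * x powr (a - 1) * \<eta> * r x\<bar> = a * x powr (a - 1) * \<eta> * \<bar>r x\<bar>"
        using a \<eta> by (simp add: abs_mult)
      ultimately show ?thesis using a \<eta> by (simp add: mult_left_mono)
    qed
    have 1: "\<bar>D \<theta>\<bar> \<le> b * \<eta> * \<theta> powr a"
    proof (rule abs_le_by_deriv[where D = D and Q = "\<lambda>x. b * \<eta> * x powr a" and d = "\<lambda>x. a * x powr (a - 1) * \<eta> * r x"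
          and q = "\<lambda>x. b * \<eta> * (a * x powr (a - 1))"])
      fix x :: real assume x: "0 < x"
      show "((\<lambda>x. b * \<eta> * x powr a) has_real_derivative b * \<eta> * (a * x powr (a - 1))) (at x)"
        by (rule DERIV_cmult[OF has_real_derivative_powr[OF x]])
      show "\<bar>a * x powr (a - 1) * \<eta> * r x\<bar> \<le> b * \<eta> * (a * x powr (a - 1))"
        using d_le[OF norm_tvar_le_1[of x]] by (simp add: mult_ac)
    next
      show "continuous_on {0..\<theta>} (\<lambda>x. b * \<eta> * x powr a)"
        by (intro continuous_on_mult continuous_on_const cpw) (use a in simp)
    qed (use \<theta> cD D0 dD in auto)
    have 2: "\<bar>D \<theta>\<bar> \<le> 2 * b * \<eta> * \<theta> powr (a - 1)"
    proof (rule abs_le_by_deriv[where D = D and Q = "\<lambda>x. 2 * b * \<eta> * x powr (a - 1)" and d = "\<lambda>x. a * x powr (a - 1) * \<eta> * r x"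
          and q = "\<lambda>x. 2 * b * \<eta> * ((a - 1) * x powr (a - 2))"])
      fix x :: real assume x: "0 < x"
      show "((\<lambda>x. 2 * b * \<eta> * x powr (a - 1)) has_real_derivative 2 * b * \<eta> * ((a - 1) * x powr (a - 2))) (at x)"
        using DERIV_cmult[OF has_real_derivative_powr[OF x, of "a - 1"], of "2 * b * \<eta>"] by simp
      have "cmod (tvar x) \<le> 1 / x"
        unfolding norm_tvar using x by (intro divide_left_mono) (auto intro: real_le_rsqrt)
      from d_le[OF this] have "\<bar>a * x powr (a - 1) * \<eta> * r x\<bar> \<le> a * x powr (a - 1) * \<eta> * (b * (1 / x))" .
      also have "\<dots> = a * (b * \<eta> * x powr (a - 2))"
        using x powr_diff[of x "a - 1" 1] by (simp add: field_simps)
      also have "\<dots> \<le> (2 * (a - 1)) * (b * \<eta> * x powr (a - 2))"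
        using a b(1) \<eta> by (intro mult_right_mono) auto
      finally show "\<bar>a * x powr (a - 1) * \<eta> * r x\<bar> \<le> 2 * b * \<eta> * ((a - 1) * x powr (a - 2))"
        by (simp only: mult_ac)
    next
      show "continuous_on {0..\<theta>} (\<lambda>x. 2 * b * \<eta> * x powr (a - 1))"
        by (intro continuous_on_mult continuous_on_const cpw) (use a in simp)
    qed (use \<theta> cD D0 dD in auto)
    have "\<bar>D \<theta>\<bar> \<le> 4 * b * \<eta> * \<theta> powr a * cmod (tvar \<theta>)"
    proof (cases "\<theta> \<le> 1")
      case True
      have "\<theta>^2 \<le> 1" using True \<theta> by (simp add: power_le_one)
      then have "sqrt (1 + \<theta>^2) \<le> 4" by (intro real_le_lsqrt) auto
      then have "1 \<le> 4 * cmod (tvar \<theta>)" unfolding norm_tvar by (simp add: field_simps)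
      from mult_left_mono[OF this, of "b * \<eta> * \<theta> powr a"] 1 b(1) \<eta>
      show ?thesis by (simp add: mult_ac)
    next
      case False
      then have "1 \<le> \<theta>^2" by (simp add: one_le_power)
      then have "sqrt (1 + \<theta>^2) \<le> 2 * \<theta>" using \<theta> by (intro real_le_lsqrt) (auto simp: power_mult_distrib)
      then have "1 \<le> 2 * \<theta> * cmod (tvar \<theta>)" unfolding norm_tvar by (simp add: field_simps)
      from mult_left_mono[OF this, of "2 * b * \<eta> * \<theta> powr (a - 1)"]
      have "\<bar>D \<theta>\<bar> \<le> 2 * b * \<eta> * \<theta> powr (a - 1) * (2 * \<theta> * cmod (tvar \<theta>))"
        using 2 b(1) \<eta> by (simp only: mult_1_right) (meson mult_nonneg_nonneg order.trans powr_ge_zero zero_le_numeral)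
      moreover have "\<theta> powr a = \<theta> powr (a - 1) * \<theta>" using \<theta> by (simp add: powr_diff)
      ultimately show ?thesis by (simp add: mult_ac)
    qed
    moreover have "\<bar>D \<theta>\<bar> = \<theta> powr a * \<bar>Re (cis (a * \<theta>) * tvar \<theta> * poly (ampl_trunc N (1 / a)) (tvar \<theta>))\<bar>"
      unfolding D_def B_def zero by (simp add: abs_mult)
    ultimately have "\<theta> powr a * \<bar>Re (cis (a * \<theta>) * tvar \<theta> * poly (ampl_trunc N (1 / a)) (tvar \<theta>))\<bar>
        \<le> \<theta> powr a * (4 * b * \<eta> * cmod (tvar \<theta>))" by (simp add: mult_ac)
    moreover have "\<theta> powr a > 0" using \<theta> by simp
    ultimately show ?thesis unfolding \<eta>_def by (rule mult_left_le_imp_le)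
  qed
  then show ?thesis using b(1) by (intro exI[of _ "4 * b"]) auto
qed

section \<open>The phase and the zeros\<close>

definition Phi :: "nat \<Rightarrow> real \<Rightarrow> real \<Rightarrow> real" where
  "Phi N a \<theta> = a * \<theta> - arctan \<theta> + (\<Sum>s<N. L (Suc s) \<theta> * (1 / a) ^ Suc s)"

lemma L_tvar: "L (Suc s) \<theta> = Im (poly (logampl (Suc s)) (tvar \<theta>))"
  by (simp add: L_eq tvar_def)

lemma Im_logampl_poly: "Im (poly (logampl_poly N (tvar \<theta>)) (of_real e)) = (\<Sum>s<N. L (Suc s) \<theta> * e ^ Suc s)"
proof -
  have "Im (z * of_real e ^ Suc s) = Im z * e ^ Suc s" for z s
    by (metis Im_complex_of_real Re_complex_of_real add.left_neutral mult_zero_right of_real_power times_complex.sel(2))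
  then show ?thesis by (simp only: poly_logampl_poly Im_sum L_tvar)
qed

text \<open>
  In polar form the three factors \<open>exp (\<i>a\<theta>)\<close>, \<open>t\<close> and \<open>exp (\<Sum> p\<^sub>s(t) \<epsilon>^s)\<close> have the arguments \<open>a\<theta>\<close>,
  \<open>- arctan \<theta>\<close> and \<open>\<Sum> L\<^sub>s(\<theta>) \<epsilon>^s\<close>, which add up to the phase. The modulus of the last factor is bounded
  below, so a small real part forces a small cosine.
\<close>

lemma cos_phase_small:
  "\<exists>C\<ge>0. \<forall>a\<ge>2. \<forall>\<theta>>0. Ci a (a * \<theta>) = 0 \<longrightarrow> \<bar>cos (Phi N a \<theta>)\<bar> \<le> C * (1 / a) ^ Suc N"
proof -
  obtain C1 where C1: "C1 \<ge> 0" "\<And>a \<theta>. a \<ge> 2 \<Longrightarrow> \<theta> > 0 \<Longrightarrow> Ci a (a * \<theta>) = 0 \<Longrightarrow>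
     \<bar>Re (cis (a * \<theta>) * tvar \<theta> * poly (ampl_trunc N (1 / a)) (tvar \<theta>))\<bar> \<le> C1 * (1 / a) ^ Suc N * cmod (tvar \<theta>)"
    using Re_amplitude_small by blast
  obtain C2 where C2: "C2 \<ge> 0" "\<And>\<tau> e. cmod \<tau> \<le> 1 \<Longrightarrow> cmod e \<le> 1 \<Longrightarrow>
     cmod (poly (ampl_poly N \<tau>) e - exp (poly (logampl_poly N \<tau>) e)) \<le> C2 * cmod e ^ Suc N"
    using ampl_poly_exp_logampl_poly by blast
  obtain K where K: "\<And>\<tau> e. cmod \<tau> \<le> 1 \<Longrightarrow> cmod e \<le> 1 \<Longrightarrow> cmod (poly (logampl_poly N \<tau>) e) \<le> K"
    using logampl_poly_bound by blast
  have "\<bar>cos (Phi N a \<theta>)\<bar> \<le> exp K * (C1 + C2) * (1 / a) ^ Suc N"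
    if a: "a \<ge> 2" and \<theta>: "\<theta> > 0" and z: "Ci a (a * \<theta>) = 0" for a \<theta> :: real
  proof -
    define e t \<eta> where "e = 1 / a" and "t = tvar \<theta>" and "\<eta> = (1 / a) ^ Suc N"
    have "cmod (of_real e) = 1 / a" using a unfolding norm_of_real by (simp add: e_def)
    then have e: "cmod (of_real e) \<le> 1" "cmod (of_real e) ^ Suc N = \<eta>" using a by (simp_all add: \<eta>_def)
    have t: "cmod t \<le> 1" "cmod t > 0" unfolding t_def by (rule norm_tvar_le_1 norm_tvar_pos)+
    define U S where "U = poly (ampl_poly N t) (of_real e)" and "S = poly (logampl_poly N t) (of_real e)"
    have X: "cis (a * \<theta>) * t * exp S = of_real (cmod t * exp (Re S)) * cis (Phi N a \<theta>)"
    proof -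
      have "cis (a * \<theta>) * t * exp S = cis (a * \<theta>) * (of_real (cmod t) * cis (- arctan \<theta>)) * (of_real (exp (Re S)) * cis (Im S))"
        unfolding t_def by (subst tvar_polar) (simp add: exp_eq_polar)
      also have "\<dots> = of_real (cmod t * exp (Re S)) * (cis (a * \<theta>) * cis (- arctan \<theta>) * cis (Im S))"
        by simp
      also have "cis (a * \<theta>) * cis (- arctan \<theta>) * cis (Im S) = cis (Phi N a \<theta>)"
        unfolding cis_mult Phi_def S_def t_def Im_logampl_poly e_def by simp
      finally show ?thesis .
    qed
    have "cmod t * exp (Re S) * \<bar>cos (Phi N a \<theta>)\<bar> = \<bar>Re (cis (a * \<theta>) * t * exp S)\<bar>"
      unfolding X by (simp add: abs_mult)
    also have "\<dots> \<le> \<bar>Re (cis (a * \<theta>) * t * U)\<bar> + \<bar>Re (cis (a * \<theta>) * t * (U - exp S))\<bar>"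
      by (simp add: right_diff_distrib)
    also have "\<dots> \<le> C1 * \<eta> * cmod t + cmod t * (C2 * \<eta>)"
    proof (rule add_mono)
      show "\<bar>Re (cis (a * \<theta>) * t * U)\<bar> \<le> C1 * \<eta> * cmod t"
        using C1(2)[OF a \<theta> z] unfolding poly_ampl_trunc U_def t_def \<eta>_def e_def .
      have "\<bar>Re (cis (a * \<theta>) * t * (U - exp S))\<bar> \<le> cmod (cis (a * \<theta>) * t * (U - exp S))"
        by (rule abs_Re_le_cmod)
      also have "\<dots> = cmod t * cmod (U - exp S)" by (simp add: norm_mult)
      also have "\<dots> \<le> cmod t * (C2 * \<eta>)"
        using C2(2)[OF t(1) e(1)] unfolding e(2) U_def S_def by (intro mult_left_mono) auto
      finally show "\<bar>Re (cis (a * \<theta>) * t * (U - exp S))\<bar> \<le> cmod t * (C2 * \<eta>)" .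
    qed
    also have "\<dots> = cmod t * ((C1 + C2) * \<eta>)" by (simp add: algebra_simps)
    finally have "exp (Re S) * \<bar>cos (Phi N a \<theta>)\<bar> \<le> (C1 + C2) * \<eta>"
      using t(2) by (simp add: mult.assoc)
    moreover have "exp (- K) \<le> exp (Re S)"
      using K[OF t(1) e(1)] abs_Re_le_cmod[of S] unfolding S_def by simp
    ultimately have "exp (- K) * \<bar>cos (Phi N a \<theta>)\<bar> \<le> (C1 + C2) * \<eta>"
      using mult_right_mono[of "exp (- K)" "exp (Re S)" "\<bar>cos (Phi N a \<theta>)\<bar>"] by simp
    then show ?thesis unfolding \<eta>_def by (simp add: exp_minus field_simps)
  qed
  then show ?thesis using C1(1) C2(1) by (intro exI[of _ "exp K * (C1 + C2)"]) auto
qed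

text \<open>
  Both roots of \<open>p\<^sub>s\<close> are used: \<open>|t| |1 - t| = \<theta> / (1 + \<theta>\<^sup>2) = sin \<phi> cos \<phi> \<le> \<phi>\<close> for \<open>\<phi> = arctan \<theta>\<close>. A plain bound
  \<open>O(\<epsilon>)\<close> would not suffice to identify the zero when \<open>\<theta>\<close> itself is as small as \<open>\<epsilon>\<close>.
\<close>

lemma correction_le_arctan:
  "\<exists>K\<ge>0. \<forall>a\<ge>1. \<forall>\<theta>>0. \<bar>\<Sum>s<N. L (Suc s) \<theta> * (1 / a) ^ Suc s\<bar> \<le> K / a * arctan \<theta>"
proof -
  have "\<forall>s. \<exists>B\<ge>0. \<forall>\<tau>. cmod \<tau> \<le> 1 \<longrightarrow> cmod (poly (logampl s) \<tau>) \<le> B * (cmod \<tau> * cmod (1 - \<tau>))"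
    using poly_bounded_roots logampl_roots by blast
  then obtain B where B: "\<And>s. B s \<ge> 0" "\<And>s \<tau>. cmod \<tau> \<le> 1 \<Longrightarrow> cmod (poly (logampl s) \<tau>) \<le> B s * (cmod \<tau> * cmod (1 - \<tau>))"
    by metis
  have "\<bar>\<Sum>s<N. L (Suc s) \<theta> * (1 / a) ^ Suc s\<bar> \<le> (\<Sum>s<N. B (Suc s)) / a * arctan \<theta>"
    if a: "a \<ge> 1" and \<theta>: "\<theta> > 0" for a \<theta> :: real
  proof -
    have "1 - tvar \<theta> = \<i> * of_real \<theta> * tvar \<theta>" by (simp add: tvar_def field_simps)
    then have "cmod (tvar \<theta>) * cmod (1 - tvar \<theta>) = \<theta> * (cmod (tvar \<theta>) * cmod (tvar \<theta>))"
      using \<theta> by (simp add: norm_mult)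
    also have "\<dots> = sin (arctan \<theta>) * cos (arctan \<theta>)"
      by (simp add: norm_tvar sin_arctan cos_arctan)
    also have "\<dots> \<le> arctan \<theta> * 1"
      using \<theta> by (intro mult_mono sin_x_le_x) (auto simp: cos_arctan)
    finally have t: "cmod (tvar \<theta>) * cmod (1 - tvar \<theta>) \<le> arctan \<theta>" by simp
    have at: "arctan \<theta> \<ge> 0" using \<theta> by simp
    have "\<bar>\<Sum>s<N. L (Suc s) \<theta> * (1 / a) ^ Suc s\<bar> \<le> (\<Sum>s<N. \<bar>L (Suc s) \<theta> * (1 / a) ^ Suc s\<bar>)"
      by (rule sum_abs)
    also have "\<dots> \<le> (\<Sum>s<N. B (Suc s) * arctan \<theta> * (1 / a))"
    proof (rule sum_mono)
      fix s
      have "\<bar>L (Suc s) \<theta>\<bar> \<le> cmod (poly (logampl (Suc s)) (tvar \<theta>))"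
        unfolding L_tvar by (rule abs_Im_le_cmod)
      also have "\<dots> \<le> B (Suc s) * (cmod (tvar \<theta>) * cmod (1 - tvar \<theta>))" by (rule B(2)[OF norm_tvar_le_1])
      also have "\<dots> \<le> B (Suc s) * arctan \<theta>" using t B(1) by (intro mult_left_mono)
      finally have 1: "\<bar>L (Suc s) \<theta>\<bar> \<le> B (Suc s) * arctan \<theta>" .
      have "(1 / a) ^ Suc s \<le> (1 / a) ^ 1" using a by (intro power_decreasing) auto
      then have 2: "(1 / a) ^ Suc s \<le> 1 / a" by simp
      have "\<bar>L (Suc s) \<theta> * (1 / a) ^ Suc s\<bar> = \<bar>L (Suc s) \<theta>\<bar> * (1 / a) ^ Suc s"
        using a by (simp add: abs_mult)
      also have "\<dots> \<le> B (Suc s) * arctan \<theta> * (1 / a)"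
        using 1 2 a B(1) at by (intro mult_mono) auto
      finally show "\<bar>L (Suc s) \<theta> * (1 / a) ^ Suc s\<bar> \<le> B (Suc s) * arctan \<theta> * (1 / a)" .
    qed
    also have "\<dots> = (\<Sum>s<N. B (Suc s)) / a * arctan \<theta>"
      by (simp add: sum_distrib_right sum_divide_distrib)
    finally show ?thesis .
  qed
  moreover have "(\<Sum>s<N. B (Suc s)) \<ge> 0" by (intro sum_nonneg B)
  ultimately show ?thesis by blast
qed

lemma sin_ge_third: assumes "0 \<le> x" "x \<le> pi / 2" shows "x / 3 \<le> sin x"
proof -
  have x2: "x \<le> 2" using assms pi_half_less_two by linarith
  have s: "(\<Sum>m<3. sin_coeff m * x ^ m) = x" by (simp add: eval_nat_numeral sin_coeff_def)
  have "\<bar>sin x - x\<bar> \<le> inverse (fact 3) * \<bar>x\<bar> ^ 3" using Maclaurin_sin_bound[of x 3] unfolding s .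
  then have "\<bar>sin x - x\<bar> \<le> x ^ 3 / 6" using assms(1) by (simp add: fact_numeral field_simps)
  then have "x - sin x \<le> x ^ 3 / 6" by (rule order.trans[rotated]) simp
  moreover have "x ^ 3 \<le> 4 * x"
    using mult_left_mono[OF mult_mono[OF x2 x2], of x] assms(1) by (simp add: power3_eq_cube mult_ac)
  ultimately show ?thesis by linarith
qed

text \<open>
  Let \<open>d\<close> be the deviation of the phase from \<open>(m - 1/2) \<pi>\<close>. The location of the zero confines \<open>d\<close> to an
  interval of length less than \<open>2 \<pi>\<close> around 0, and \<open>|sin d|\<close> is \<open>O(\<epsilon>^(N+1))\<close>. So \<open>d\<close> is small, unless it is close
  to an end of that interval. The upper end is the delicate one: \<open>\<pi> - d\<close> exceeds \<open>3/4 arctan c\<close>, and \<open>c\<close> may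
  be as small as \<open>\<epsilon>\<close>. This is still larger than \<open>O(\<epsilon>\<^sup>2)\<close>, and this is where \<open>N \<ge> 1\<close> enters.
\<close>

lemma phase_at_zero:
  assumes N: "N \<ge> 1"
  shows "\<exists>C\<ge>0. \<exists>A\<ge>2. \<forall>a\<ge>A. \<forall>m\<ge>1.
    \<bar>Phi N a (ci_zero a m) - (real m - 1/2) * pi\<bar> \<le> C * (1 / a) ^ Suc N"
proof -
  obtain C where C: "C \<ge> 0" "\<And>a \<theta>. a \<ge> 2 \<Longrightarrow> \<theta> > 0 \<Longrightarrow> Ci a (a * \<theta>) = 0 \<Longrightarrow>
      \<bar>cos (Phi N a \<theta>)\<bar> \<le> C * (1 / a) ^ Suc N"
    using cos_phase_small by blast
  obtain K where K: "K \<ge> 0" "\<And>a \<theta>. a \<ge> 1 \<Longrightarrow> \<theta> > 0 \<Longrightarrow>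
      \<bar>\<Sum>s<N. L (Suc s) \<theta> * (1 / a) ^ Suc s\<bar> \<le> K / a * arctan \<theta>"
    using correction_le_arctan by blast
  \<comment> \<open>\<open>4 K\<close> makes the correction at most a quarter of \<open>arctan c\<close>; \<open>8 C\<close> makes \<open>\<eta>\<close> smaller than \<open>1 / (8 a)\<close>.\<close>
  define A where "A = 2 + 4 * K + 16 * C"
  have "\<bar>Phi N a (ci_zero a m) - (real m - 1/2) * pi\<bar> \<le> 3 * C * (1 / a) ^ Suc N"
    if a: "a \<ge> A" and m: "m \<ge> 1" for a m
  proof -
    have a2: "a \<ge> 2" "a \<ge> 4 * K" "a > 8 * C" using a K(1) C(1) by (auto simp: A_def)
    define c where "c = ci_zero a m"
    define \<eta> where "\<eta> = C * (1 / a) ^ Suc N"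
    have c: "c > 0" "Ci a (a * c) = 0" "(real m - 1/2) * pi < a * c" "a * c < (real m + 1/2) * pi"
      using ci_zero_bounds[of a m] a2 m by (auto simp: c_def)
    have at: "0 < arctan c" "arctan c < pi / 2" using c(1) arctan_ubound[of c] by auto
    have corr: "\<bar>\<Sum>s<N. L (Suc s) c * (1 / a) ^ Suc s\<bar> \<le> 1/4 * arctan c"
    proof -
      have "K / a \<le> 1 / 4" using a2 by (simp add: field_simps)
      then have "K / a * arctan c \<le> 1/4 * arctan c" using at by (intro mult_right_mono) auto
      then show ?thesis using K(2)[of a c] a2 c(1) by linarith
    qed
    define d where "d = Phi N a c - (real m - 1/2) * pi"
    have d_lo: "- (5/8 * pi) < d" using corr c(3) at unfolding d_def Phi_def by linarith
    have "(real m + 1/2) * pi = (real m - 1/2) * pi + pi" by (simp add: algebra_simps)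
    then have d_hi: "d < pi - 3/4 * arctan c" using corr c(4) at unfolding d_def Phi_def by linarith
    have sin_d: "\<bar>sin d\<bar> \<le> \<eta>"
    proof -
      have "Phi N a c = d - pi / 2 + real m * pi" unfolding d_def by (simp add: algebra_simps)
      then have "cos (Phi N a c) = (-1) ^ m * sin d"
        by (simp add: cos_add sin_diff cos_diff)
      then have "\<bar>cos (Phi N a c)\<bar> = \<bar>sin d\<bar>" by (simp add: abs_mult power_abs)
      then show ?thesis using C(2)[of a c] a2 c unfolding \<eta>_def by simp
    qed
    have \<eta>1: "\<eta> \<le> C * (1 / a) * (1 / a)"
    proof -
      have "(1 / a) ^ Suc N \<le> (1 / a) ^ 2" using a2 N by (intro power_decreasing) auto
      then have "\<eta> \<le> C * (1 / a) ^ 2" unfolding \<eta>_def using C(1) by (intro mult_left_mono)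
      then show ?thesis by (simp add: power2_eq_square mult.assoc)
    qed
    have "C * (1 / a) < 1 / 8" using a2 by (simp add: field_simps)
    then have "C * (1 / a) * (1 / a) < 1 / 8 * (1 / a)" using a2 by (intro mult_strict_right_mono) auto
    then have \<eta>2: "\<eta> < 1 / 8 * (1 / a)" using \<eta>1 by linarith
    have a_half: "1 / a \<le> 1 / 2" using a2 by simp
    have arc: "1 / a * (1 / 2) \<le> arctan c"
    proof -
      have "1 * pi \<le> real m * pi" using m by (intro mult_right_mono) auto
      moreover have "(real m - 1/2) * pi = real m * pi - pi / 2" by (simp add: algebra_simps)
      ultimately have "pi / 2 < a * c" using c(3) by linarith
      then have "1 < a * c" using pi_gt3 by linarith
      then have "1 / a < c" using a2 by (simp add: field_simps)
      then have mono: "arctan (1 / a) \<le> arctan c" by (simp only: arctan_le_iff less_imp_le)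
      have "1 / a * (1 / 2) \<le> (1 / a) / (1 + (1 / a)^2)"
      proof -
        have "(1 / a)^2 \<le> 1" using a2 by (intro power_le_one) auto
        then have "1 / 2 \<le> 1 / (1 + (1 / a)^2)" by (intro divide_left_mono) (auto intro: add_pos_nonneg)
        from mult_left_mono[OF this, of "1 / a"] show ?thesis using a2 by simp
      qed
      also have "\<dots> = sin (arctan (1 / a)) * cos (arctan (1 / a))" by (simp only: sin_arctan cos_arctan) simp
      also have "\<dots> \<le> arctan (1 / a) * 1"
        using a2 by (intro mult_mono sin_x_le_x) (auto simp: cos_arctan)
      finally show ?thesis using mono by simp
    qed
    have "\<bar>d\<bar> \<le> 3 * \<eta>"
    proof -
      consider "d < - (pi / 2)" | "- (pi / 2) \<le> d" "d \<le> 0" | "0 \<le> d" "d \<le> pi / 2" | "pi / 2 < d" by linarith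
      then show ?thesis
      proof cases
        case 1
        have "(d + pi) / 3 \<le> sin (d + pi)" using 1 d_lo by (intro sin_ge_third) auto
        then have "d + pi \<le> 3 * \<eta>" using sin_d by simp
        moreover have "3/8 * pi < d + pi" using d_lo by simp
        ultimately show ?thesis using \<eta>2 a_half pi_gt3 by linarith
      next
        case 2
        have "(- d) / 3 \<le> sin (- d)" using 2 by (intro sin_ge_third) auto
        then show ?thesis using sin_d 2 by simp
      next
        case 3
        have "d / 3 \<le> sin d" using 3 by (intro sin_ge_third) auto
        then show ?thesis using sin_d 3 by simp
      next
        case 4
        have "0 \<le> pi - d" "pi - d \<le> pi / 2" using d_hi at(1) 4 by linarith+
        then have "(pi - d) / 3 \<le> sin (pi - d)" by (rule sin_ge_third)
        then have "pi - d \<le> 3 * \<eta>" using sin_d by simp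
        moreover have "3/4 * arctan c < pi - d" using d_hi by simp
        moreover define w where "w = 1 / a"
        ultimately show ?thesis using arc[folded w_def] \<eta>2[folded w_def] by linarith
      qed
    qed
    then show ?thesis unfolding d_def c_def \<eta>_def by simp
  qed
  moreover have "A \<ge> 2" using K(1) C(1) by (simp add: A_def)
  ultimately show ?thesis using C(1) by (intro exI[of _ "3 * C"]) auto
qed

text \<open>
  The formal identity only sees finitely many \<open>q\<^sub>k\<close> at each order, so it applies to the family that is
  cut off at \<open>N\<close>. Multiplied by \<open>\<epsilon>\<close>, it becomes the vanishing of the first \<open>N + 1\<close> coefficients of a uniform
  expansion.
\<close>

lemma formal_solution_phase:
  "\<exists>C. \<forall>x. \<forall>a\<ge>1. \<bar>Phi N a (x + (\<Sum>k=2..N. qcoeff k x * (1 / a) ^ k)) - (a * x - arctan x)\<bar> \<le> C * (1 / a) ^ N"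
proof -
  define q where "q k = (if k \<le> N then qcoeff k else (\<lambda>_. 0))" for k
  define \<delta> where "\<delta> x e = (\<Sum>k=2..N. qcoeff k x * e ^ k)" for x e :: real
  have bd: "\<exists>B. \<forall>x. \<bar>qcoeff k x\<bar> \<le> B" for k
    using rat_bdd_bounded[OF rat_null_imp_bdd[OF qcoeff_rat_null]] by blast
  have "unif_exp M (\<lambda>x e. \<Sum>k=2..N. qcoeff k x * e ^ k) (\<lambda>x. \<Sum>k=2..N. fps_const (qcoeff k x) * fps_X ^ k)" for M
    by (intro unif_exp_sum unif_exp_mult unif_exp_const unif_exp_power unif_exp_X bd)
  moreover have "(\<Sum>k=2..N. fps_const (qcoeff k x) * fps_X ^ k) = incr q x" for x
  proof (rule fps_ext)
    fix n
    have "fps_nth (\<Sum>k=2..N. fps_const (qcoeff k x) * fps_X ^ k) n = (\<Sum>k=2..N. if k = n then qcoeff k x else 0)"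
      by (simp add: fps_sum_nth fps_X_power_nth if_distrib cong: if_cong)
    then show "fps_nth (\<Sum>k=2..N. fps_const (qcoeff k x) * fps_X ^ k) n = fps_nth (incr q x) n"
      by (simp add: incr_nth q_def)
  qed
  ultimately have exp\<delta>: "unif_exp M \<delta> (incr q)" for M by (simp add: \<delta>_def[abs_def])
  have sub: "unif_exp M (\<lambda>x e. f (x + \<delta> x e)) (\<lambda>x. taylor_comp f x (incr q x))" if "admissible f" for f M
    unfolding taylor_comp_def by (rule unif_exp_subst[OF that exp\<delta>]) (simp add: incr_nth)
  have cb: "\<exists>B. \<forall>x::real. \<bar>c :: real\<bar> \<le> B" for c by blast
  have ab: "\<exists>B. \<forall>x. \<bar>arctan x\<bar> \<le> B" using admissible_arctan by (simp add: admissible_def)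
  define c where "c x = incr q x + (fps_const (-1) * fps_X * taylor_comp arctan x (incr q x)
      + ((\<Sum>s<N. fps_X ^ Suc (Suc s) * taylor_comp (L (Suc s)) x (incr q x)) + fps_X * fps_const (arctan x)))" for x
  have "unif_exp (Suc N) (\<lambda>x e. \<delta> x e + (-1 * e * arctan (x + \<delta> x e)
      + ((\<Sum>s<N. e ^ Suc (Suc s) * L (Suc s) (x + \<delta> x e)) + e * arctan x))) c"
    unfolding c_def
    by (intro unif_exp_add exp\<delta> unif_exp_mult unif_exp_const unif_exp_X sub admissible_arctan unif_exp_sum unif_exp_power admissible_L cb ab)
  then obtain C where C: "\<And>x e. 0 < e \<Longrightarrow> e \<le> 1 \<Longrightarrow>
      \<bar>\<delta> x e + (-1 * e * arctan (x + \<delta> x e) + ((\<Sum>s<N. e ^ Suc (Suc s) * L (Suc s) (x + \<delta> x e)) + e * arctan x))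
        - (\<Sum>n<Suc N. fps_nth (c x) n * e ^ n)\<bar> \<le> C * e ^ Suc N"
    by (rule unif_exp_error) (rule that, blast)
  have c0: "fps_nth (c x) n = 0" if n: "n < Suc N" for x n
  proof (cases n)
    case 0
    then show ?thesis by (simp add: c_def incr_nth fps_sum_nth)
  next
    case (Suc k)
    have "fps_nth (\<Sum>s<N. fps_X ^ Suc (Suc s) * taylor_comp (L (Suc s)) x (incr q x)) n
        = (\<Sum>s<N. if n < Suc (Suc s) then 0 else fps_nth (taylor_comp (L (Suc s)) x (incr q x)) (n - Suc (Suc s)))"
      by (simp add: fps_sum_nth fps_X_power_mult_nth del: power_Suc)
    also have "\<dots> = (\<Sum>s<k. fps_nth (taylor_comp (L (Suc s)) x (incr q x)) (k - Suc s))"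
      using n Suc by (intro sum.mono_neutral_cong_right) auto
    finally have "fps_nth (c x) n = fps_nth (incr q x) (Suc k) - rec_rhs q x k + (if k = 0 then arctan x else 0)"
      by (simp add: c_def Suc rec_rhs_def mult.assoc del: power_Suc)
    also have "rec_rhs q x k = rec_rhs qcoeff x k"
      by (rule rec_rhs_cong) (use n Suc in \<open>auto simp: q_def\<close>)
    also have "fps_nth (incr q x) (Suc k) - rec_rhs qcoeff x k + (if k = 0 then arctan x else 0) = 0"
      using qcoeff_rec[of k x] n Suc by (cases "k = 0") (auto simp: incr_nth q_def rec_rhs_def)
    finally show ?thesis .
  qed
  have "\<bar>Phi N a (x + (\<Sum>k=2..N. qcoeff k x * (1 / a) ^ k)) - (a * x - arctan x)\<bar> \<le> C * (1 / a) ^ N"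
    if a: "a \<ge> 1" for x a
  proof -
    define e where "e = 1 / a"
    have e: "0 < e" "e \<le> 1" "a * e = 1" using a by (simp_all add: e_def)
    define G where "G = \<delta> x e + (-1 * e * arctan (x + \<delta> x e)
       + ((\<Sum>s<N. e ^ Suc (Suc s) * L (Suc s) (x + \<delta> x e)) + e * arctan x))"
    have "(\<Sum>n<Suc N. fps_nth (c x) n * e ^ n) = 0" by (rule sum.neutral) (use c0 in auto)
    then have G: "\<bar>G\<bar> \<le> C * e ^ Suc N" using C[OF e(1,2), of x] unfolding G_def by simp
    have m1: "a * (\<Sum>s<N. e ^ Suc (Suc s) * L (Suc s) (x + \<delta> x e)) = (\<Sum>s<N. L (Suc s) (x + \<delta> x e) * e ^ Suc s)"
      unfolding sum_distrib_left
    proof (rule sum.cong[OF refl])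
      fix s
      have "a * (e ^ Suc (Suc s) * L (Suc s) (x + \<delta> x e)) = (a * e) * (L (Suc s) (x + \<delta> x e) * e ^ Suc s)"
        by simp
      then show "a * (e ^ Suc (Suc s) * L (Suc s) (x + \<delta> x e)) = L (Suc s) (x + \<delta> x e) * e ^ Suc s"
        unfolding e(3) by simp
    qed
    have m2: "a * (-1 * e * arctan (x + \<delta> x e)) = - arctan (x + \<delta> x e)" "a * (e * arctan x) = arctan x"
      using e(3) by (simp_all flip: mult.assoc)
    have "Phi N a (x + \<delta> x e) - (a * x - arctan x) = a * G"
      unfolding Phi_def G_def e_def[symmetric] distrib_left m1 m2 by simp
    then have "\<bar>Phi N a (x + \<delta> x e) - (a * x - arctan x)\<bar> = a * \<bar>G\<bar>" using a by (simp add: abs_mult)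
    also have "\<dots> \<le> a * (C * e ^ Suc N)" using G a by (intro mult_left_mono) auto
    also have "\<dots> = (a * e) * (C * e ^ N)" by simp
    also have "\<dots> = C * e ^ N" unfolding e(3) by simp
    finally show ?thesis unfolding \<delta>_def e_def .
  qed
  then show ?thesis by blast
qed

lemma Phi_expands:
  "\<exists>A\<ge>1. \<forall>a\<ge>A. \<forall>u v. a / 2 * \<bar>u - v\<bar> \<le> \<bar>Phi N a u - Phi N a v\<bar>"
proof -
  have lip: "\<exists>C\<ge>0. \<forall>u v. \<bar>f u - f v\<bar> \<le> C * \<bar>u - v\<bar>" if adm: "admissible f" for f :: "real \<Rightarrow> real"
  proof -
    obtain C where C: "C \<ge> 0" "\<And>x h. \<bar>f (x + h) - (\<Sum>n<1. (deriv ^^ n) f x / fact n * h ^ n)\<bar> \<le> C * \<bar>h\<bar> ^ 1"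
      using admissible_taylor[OF adm, of 1] by blast
    have "\<bar>f u - f v\<bar> \<le> C * \<bar>u - v\<bar>" for u v using C(2)[of v "u - v"] by simp
    then show ?thesis using C(1) by blast
  qed
  obtain C0 where C0: "C0 \<ge> 0" "\<And>u v. \<bar>arctan u - arctan v\<bar> \<le> C0 * \<bar>u - v\<bar>"
    using lip[OF admissible_arctan] by blast
  have "\<forall>s. \<exists>C\<ge>0. \<forall>u v. \<bar>L (Suc s) u - L (Suc s) v\<bar> \<le> C * \<bar>u - v\<bar>" using lip[OF admissible_L] by blast
  then obtain C where C: "\<And>s. C s \<ge> 0" "\<And>s u v. \<bar>L (Suc s) u - L (Suc s) v\<bar> \<le> C s * \<bar>u - v\<bar>" by metis
  define K where "K = C0 + (\<Sum>s<N. C s)"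
  have K: "K \<ge> 0" using C0(1) C(1) by (simp add: K_def sum_nonneg)
  have "a / 2 * \<bar>u - v\<bar> \<le> \<bar>Phi N a u - Phi N a v\<bar>" if a: "a \<ge> 1 + 2 * K" for a u v
  proof -
    define R where "R w = (\<Sum>s<N. L (Suc s) w * (1 / a) ^ Suc s)" for w
    have a1: "a \<ge> 1" using a K by simp
    have "\<bar>R u - R v\<bar> = \<bar>\<Sum>s<N. (L (Suc s) u - L (Suc s) v) * (1 / a) ^ Suc s\<bar>"
      by (simp only: R_def sum_subtractf left_diff_distrib)
    also have "\<dots> \<le> (\<Sum>s<N. \<bar>(L (Suc s) u - L (Suc s) v) * (1 / a) ^ Suc s\<bar>)" by (rule sum_abs)
    also have "\<dots> \<le> (\<Sum>s<N. C s * \<bar>u - v\<bar>)"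
    proof (rule sum_mono)
      fix s
      have "(1 / a) ^ Suc s \<le> 1" using a1 by (intro power_le_one) auto
      have "\<bar>(L (Suc s) u - L (Suc s) v) * (1 / a) ^ Suc s\<bar> = \<bar>L (Suc s) u - L (Suc s) v\<bar> * (1 / a) ^ Suc s"
        using a1 by (simp add: abs_mult)
      also have "\<dots> \<le> (C s * \<bar>u - v\<bar>) * 1"
        using C \<open>(1 / a) ^ Suc s \<le> 1\<close> a1 by (intro mult_mono) auto
      finally show "\<bar>(L (Suc s) u - L (Suc s) v) * (1 / a) ^ Suc s\<bar> \<le> C s * \<bar>u - v\<bar>" by simp
    qed
    finally have R: "\<bar>R u - R v\<bar> \<le> (\<Sum>s<N. C s) * \<bar>u - v\<bar>" by (simp add: sum_distrib_right)
    have "a * \<bar>u - v\<bar> = \<bar>a * u - a * v\<bar>" using a1 by (simp add: abs_mult flip: right_diff_distrib)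
    also have "\<dots> \<le> \<bar>Phi N a u - Phi N a v\<bar> + \<bar>arctan u - arctan v\<bar> + \<bar>R u - R v\<bar>"
      unfolding Phi_def R_def by linarith
    also have "\<dots> \<le> \<bar>Phi N a u - Phi N a v\<bar> + K * \<bar>u - v\<bar>"
      using C0(2)[of u v] R by (simp add: K_def distrib_right)
    also have "K * \<bar>u - v\<bar> \<le> a / 2 * \<bar>u - v\<bar>" using a by (intro mult_right_mono) auto
    finally show ?thesis by simp
  qed
  then show ?thesis using K by (intro exI[of _ "1 + 2 * K"]) auto
qed

lemma uniform_expansion:
  assumes N: "N \<ge> 1"
  shows "\<exists>C. \<exists>A>1. \<forall>a\<ge>A. \<forall>m\<ge>1.
    \<bar>ci_zero a m - ci_zero0 a m - (\<Sum>k=2..N. qcoeff k (ci_zero0 a m) / a ^ k)\<bar> \<le> C / a ^ (N + 1)"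
proof -
  obtain C1 A1 where C1: "C1 \<ge> 0" "A1 \<ge> 2" "\<And>a m. a \<ge> A1 \<Longrightarrow> m \<ge> 1 \<Longrightarrow>
      \<bar>Phi N a (ci_zero a m) - (real m - 1/2) * pi\<bar> \<le> C1 * (1 / a) ^ Suc N"
    using phase_at_zero[OF N] by blast
  obtain C2 where C2: "\<And>x a. a \<ge> 1 \<Longrightarrow>
      \<bar>Phi N a (x + (\<Sum>k=2..N. qcoeff k x * (1 / a) ^ k)) - (a * x - arctan x)\<bar> \<le> C2 * (1 / a) ^ N"
    using formal_solution_phase by blast
  obtain A3 where A3: "A3 \<ge> 1" "\<And>a u v. a \<ge> A3 \<Longrightarrow> a / 2 * \<bar>u - v\<bar> \<le> \<bar>Phi N a u - Phi N a v\<bar>"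
    using Phi_expands by blast
  have "\<bar>ci_zero a m - ci_zero0 a m - (\<Sum>k=2..N. qcoeff k (ci_zero0 a m) / a ^ k)\<bar> \<le> (2 * (C1 + C2)) / a ^ (N + 1)"
    if a: "a \<ge> max A1 A3" and m: "m \<ge> 1" for a m
  proof -
    have a2: "a \<ge> 2" "a \<ge> A1" "a \<ge> A3" using a C1(2) by auto
    define x where "x = ci_zero0 a m"
    define y where "y = x + (\<Sum>k=2..N. qcoeff k x * (1 / a) ^ k)"
    have x: "a * x - arctan x = (real m - 1/2) * pi" using ci_zero0(2)[of a m] a2 m by (simp add: x_def)
    have "a / 2 * \<bar>ci_zero a m - y\<bar> \<le> \<bar>Phi N a (ci_zero a m) - Phi N a y\<bar>" by (rule A3(2)) fact
    also have "\<dots> \<le> C1 * (1 / a) ^ Suc N + C2 * (1 / a) ^ N"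
      using C1(3)[OF a2(2) m] C2[of a x] a2 unfolding x y_def[symmetric] by linarith
    also have "C1 * (1 / a) ^ Suc N \<le> C1 * (1 / a) ^ N"
      using C1(1) a2 by (intro mult_left_mono power_decreasing) auto
    finally have "a / 2 * \<bar>ci_zero a m - y\<bar> \<le> (C1 + C2) * (1 / a) ^ N" by (simp add: distrib_right)
    then have "\<bar>ci_zero a m - y\<bar> \<le> 2 * (C1 + C2) / a ^ (N + 1)"
      using a2 by (simp add: field_simps power_one_over)
    moreover have "y = x + (\<Sum>k=2..N. qcoeff k x / a ^ k)" by (simp add: y_def power_one_over divide_inverse power_inverse)
    ultimately show ?thesis by (simp add: x_def algebra_simps)
  qed
  moreover have "max A1 A3 > 1" using C1(2) by simp
  ultimately show ?thesis by blast
qed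

theorem mainTheorem4:
  shows "(\<comment> \<open>the objects named by definite descriptions exist and are unique\<close>
    (\<forall>a>1. strict_mono_on {1..} (ci_zero a) \<and>
        ci_zero a ` {1..} = {\<theta>. 0 < \<theta> \<and> Ci a (a * \<theta>) = 0}) \<and>
    (\<forall>a>1. \<forall>m\<ge>1. \<exists>!\<theta>. 0 < \<theta> \<and> a * \<theta> - arctan \<theta> = (real m - 1/2) * pi) \<and>
    (\<exists>!q. is_coeff_family q)) \<and>
    \<comment> \<open>the uniform asymptotic expansion\<close>
    (\<forall>N\<ge>1. \<exists>C. \<exists>A>1. \<forall>a\<ge>A. \<forall>m\<ge>1.
        \<bar>ci_zero a m - ci_zero0 a m - (\<Sum>k=2..N. qf k (ci_zero0 a m) / a ^ k)\<bar>
          \<le> C / a ^ (N + 1)) \<and>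
    \<comment> \<open>the coefficients are rational functions vanishing at 0 and at infinity\<close>
    (\<forall>k\<ge>2. (\<exists>p d :: real poly. \<forall>x. poly d x \<noteq> 0 \<and> qf k x = poly p x / poly d x) \<and>
        qf k 0 = 0 \<and> (qf k \<longlongrightarrow> 0) at_infinity) \<and>
    (\<forall>x. qf 2 x = x * (x^2 - 1) / (x^2 + 1)^2) \<and>
    (\<forall>x. qf 3 x = 4 * x^3 * (2 * x^2 - 3) / (x^2 + 1)^4) \<and>
    (\<forall>x. qf 4 x = - (2 * x^3 * (8 * x^6 - 183 * x^4 + 336 * x^2 - 65) / (3 * (x^2 + 1)^6))) \<and>
    (\<forall>x. qf 5 x = - (x^3 * (679 * x^8 - 8384 * x^6 + 17226 * x^4 - 7168 * x^2 + 431)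
        / (3 * (x^2 + 1)^8)))"
proof -
  have rat: "(\<exists>p d :: real poly. \<forall>x. poly d x \<noteq> 0 \<and> qf k x = poly p x / poly d x) \<and>
      qf k 0 = 0 \<and> (qf k \<longlongrightarrow> 0) at_infinity" for k
    using qcoeff_rat_null[of k] qcoeff_0[of k] rat_bdd_rational[OF rat_null_imp_bdd[OF qcoeff_rat_null[of k]]]
    unfolding qf_eq_qcoeff rat_null_def by blast
  have ex: "\<exists>!q. is_coeff_family q"
    using is_coeff_family_qcoeff is_coeff_family_unique by (rule ex1I)
  show ?thesis
    using ci_zero_enumerates ci_zero0_exists ex uniform_expansion[folded qf_eq_qcoeff] rat qcoeff_explicit[folded qf_eq_qcoeff]
    by (intro conjI allI impI) (assumption | blast)+
qed

end
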